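(* The following equalities define an algebra homomorphism $\rho$ (compatible with adjoints) from $\mathcal B$ to $C^\infty(D^2_{q+})\otimes C^\infty(D^2_{q-})\otimes C^\infty(S^1)$: $$\rho(\alpha_+)=-q\,\beta^*\otimes\beta\otimes u,\quad \rho(\alpha_-)=\alpha\otimes\alpha\otimes u^*,\quad \rho(\beta_+)=\alpha^*\otimes\beta\otimes u,\quad\rho(\beta_-)=\beta\otimes\alpha\otimes u^*,$$ where in the first two tensor factors $\alpha,\beta$ stand for $\pi_+(\alpha),\pi_+(\beta)$ and $\pi_-(\alpha),\pi_-(\beta)$ respectively.
   Context: Fix $q\in\,]0,1[$. Let $\mathcal H$ be the Hilbert space with orthonormal basis $e^{(n)}_{ij}$, $n\in\frac12\mathbb N$, $i,j\in\{-n,\dots,n\}$. Define $\alpha=\alpha_++\alpha_-$, $\beta=\beta_++\beta_-$ with $\alpha_\pm e^{(n)}_{ij}=a_\pm(n,i,j)\,e^{(n\pm1/2)}_{i-1/2,j-1/2}$, $\beta_\pm e^{(n)}_{ij}=b_\pm(n,i,j)\,e^{(n\pm1/2)}_{i+1/2,j-1/2}$, where $$a_+=q^{2n+i+j+1}\frac{(1-q^{2n-2j+2})^{1/2}(1-q^{2n-2i+2})^{1/2}}{(1-q^{4n+2})^{1/2}(1-q^{4n+4})^{1/2}},\quad a_-=\frac{(1-q^{2n+2j})^{1/2}(1-q^{2n+2i})^{1/2}}{(1-q^{4n})^{1/2}(1-q^{4n+2})^{1/2}},$$ $$b_+=-q^{n+j}\frac{(1-q^{2n-2j+2})^{1/2}(1-q^{2n+2i+2})^{1/2}}{(1-q^{4n+2})^{1/2}(1-q^{4n+4})^{1/2}},\quad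 b_-=q^{n+i}\frac{(1-q^{2n+2j})^{1/2}(1-q^{2n-2i})^{1/2}}{(1-q^{4n})^{1/2}(1-q^{4n+2})^{1/2}}$$ (terms with vanishing coefficient are $0$; $a_-=b_-=0$ for $n=0$). The operators $\alpha,\beta$ satisfy the relations of $SU_q(2)$: $\alpha^*\alpha+\beta^*\beta=1$, $\alpha\alpha^*+q^2\beta\beta^*=1$, $\alpha\beta=q\beta\alpha$, $\alpha\beta^*=q\beta^*\alpha$, $\beta\beta^*=\beta^*\beta$. With $D e^{(n)}_{ij}=(2\delta_0(n-i)-1)2n\,e^{(n)}_{ij}$ ($\delta_0(0)=1$, $\delta_0(k)=0$ for $k\neq 0$) and $\delta(T)=[|D|,T]$ one has $\delta(\alpha_\pm)=\pm\alpha_\pm$, $\delta(\beta_\pm)=\pm\beta_\pm$. $\mathcal B$ is the algebra generated by the operators $\delta^k(\alpha),\delta^k(\beta)$, $k\ge0$, and their adjoints, i.e. by $\alpha_\pm,\beta_\pm$ and their adjoints. The representations $\pi_\pm$ of the algebra of $SU_q(2)$ in $\ell^2(\mathbb N)$, with basis $(\varepsilon_x)_{x\in\mathbb N}$, are $\pi_\pm(\alpha)\varepsilon_x=(1-q^{2x})^{1/2}\varepsilon_{x-1}$, $\pi_\pm(\beta)\varepsilon_x=\pm q^x\varepsilon_x$. $C^\infty(D^2_{q\pm})$ is the image algebra under $\pi_\pm$ of $C^\infty(SU_q(2))$: concretely the algebra of all operators $T_f+R$ on $\ell^2(\mathbb N)$, where $R$ is a matrix of rapid decay and, for $f=\sum\hat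 f_ku^k\in C^\infty(S^1)$, $T_f=\sum_{k\ge0}\hat f_kS^k+\sum_{k>0}\hat f_{-k}S^{*k}$ with $S\varepsilon_x=\varepsilon_{x-1}$, $S\varepsilon_0=0$. $u=e^{i\theta}$ is the generator of $C^\infty(S^1)$; tensor products are of Fréchet algebras. *)

theory Defs
  imports "HOL-Analysis.Analysis"
begin

section \<open>Unital *-algebras, homomorphisms, generated subalgebras\<close>

record 'a star_alg =
  alg_set :: "'a set"
  alg_add :: "'a \<Rightarrow> 'a \<Rightarrow> 'a"
  alg_scale :: "complex \<Rightarrow> 'a \<Rightarrow> 'a"
  alg_mult :: "'a \<Rightarrow> 'a \<Rightarrow> 'a"
  alg_one :: 'a
  alg_star :: "'a \<Rightarrow> 'a"

definition star_hom :: "('a, 'm) star_alg_scheme \<Rightarrow> ('b, 'n) star_alg_scheme \<Rightarrow> ('a \<Rightarrow> 'b) \<Rightarrow> bool" where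
  "star_hom A B \<rho> \<longleftrightarrow>
     (\<forall>x\<in>alg_set A. \<rho> x \<in> alg_set B) \<and>
     (\<forall>x\<in>alg_set A. \<forall>y\<in>alg_set A. \<rho> (alg_add A x y) = alg_add B (\<rho> x) (\<rho> y)) \<and>
     (\<forall>c. \<forall>x\<in>alg_set A. \<rho> (alg_scale A c x) = alg_scale B c (\<rho> x)) \<and>
     (\<forall>x\<in>alg_set A. \<forall>y\<in>alg_set A. \<rho> (alg_mult A x y) = alg_mult B (\<rho> x) (\<rho> y)) \<and>
     \<rho> (alg_one A) = alg_one B \<and>
     (\<forall>x\<in>alg_set A. \<rho> (alg_star A x) = alg_star B (\<rho> x))"

inductive_set gen_alg :: "('a, 'm) star_alg_scheme \<Rightarrow> 'a set \<Rightarrow> 'a set"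
  for A :: "('a, 'm) star_alg_scheme" and G :: "'a set" where
  one: "alg_one A \<in> gen_alg A G"
| gen: "x \<in> G \<Longrightarrow> x \<in> gen_alg A G"
| add: "x \<in> gen_alg A G \<Longrightarrow> y \<in> gen_alg A G \<Longrightarrow> alg_add A x y \<in> gen_alg A G"
| scale: "x \<in> gen_alg A G \<Longrightarrow> alg_scale A c x \<in> gen_alg A G"
| mult: "x \<in> gen_alg A G \<Longrightarrow> y \<in> gen_alg A G \<Longrightarrow> alg_mult A x y \<in> gen_alg A G"


section \<open>Bounded operators on the Hilbert space with orthonormal basis indexed by a set\<close>

text \<open>The Hilbert space with orthonormal basis indexed by \<open>I\<close> is \<open>\<ell>\<^sup>2(I)\<close>: square-summable
  functions, normalised to vanish outside \<open>I\<close>. The inner product is linear in its first argument.\<close>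

type_synonym 'i vec = "'i \<Rightarrow> complex"
type_synonym 'i opr = "'i vec \<Rightarrow> 'i vec"

definition l2 :: "'i set \<Rightarrow> 'i vec set" where
  "l2 I = {\<xi>. (\<forall>v. v \<notin> I \<longrightarrow> \<xi> v = 0) \<and> (\<lambda>v. (cmod (\<xi> v))\<^sup>2) summable_on I}"

definition l2_inner :: "'i set \<Rightarrow> 'i vec \<Rightarrow> 'i vec \<Rightarrow> complex" where
  "l2_inner I \<xi> \<eta> = (\<Sum>\<^sub>\<infinity>v\<in>I. \<xi> v * cnj (\<eta> v))"

definition l2_norm :: "'i set \<Rightarrow> 'i vec \<Rightarrow> real" where
  "l2_norm I \<xi> = sqrt (\<Sum>\<^sub>\<infinity>v\<in>I. (cmod (\<xi> v))\<^sup>2)"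

definition basis_vec :: "'i \<Rightarrow> 'i vec" where
  "basis_vec w = (\<lambda>v. if v = w then 1 else 0)"

text \<open>Operators have the value \<open>0\<close> outside \<open>l2 I\<close>, so that equality of operators is equality in HOL.\<close>

definition bounded_op :: "'i set \<Rightarrow> 'i opr \<Rightarrow> bool" where
  "bounded_op I T \<longleftrightarrow>
     (\<forall>\<xi>\<in>l2 I. T \<xi> \<in> l2 I) \<and>
     (\<forall>\<xi>\<in>l2 I. \<forall>\<eta>\<in>l2 I. \<forall>a b. T (\<lambda>v. a * \<xi> v + b * \<eta> v) = (\<lambda>v. a * T \<xi> v + b * T \<eta> v)) \<and>
     (\<exists>C. \<forall>\<xi>\<in>l2 I. l2_norm I (T \<xi>) \<le> C * l2_norm I \<xi>) \<and>
     (\<forall>\<xi>. \<xi> \<notin> l2 I \<longrightarrow> T \<xi> = (\<lambda>v. 0))"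

definition adj :: "'i set \<Rightarrow> 'i opr \<Rightarrow> 'i opr" where
  "adj I T = (THE S. bounded_op I S \<and>
     (\<forall>\<xi>\<in>l2 I. \<forall>\<eta>\<in>l2 I. l2_inner I (T \<xi>) \<eta> = l2_inner I \<xi> (S \<eta>)))"

definition op_add :: "'i opr \<Rightarrow> 'i opr \<Rightarrow> 'i opr" where
  "op_add S T = (\<lambda>\<xi> v. S \<xi> v + T \<xi> v)"

definition op_scale :: "complex \<Rightarrow> 'i opr \<Rightarrow> 'i opr" where
  "op_scale c T = (\<lambda>\<xi> v. c * T \<xi> v)"

definition op_id :: "'i set \<Rightarrow> 'i opr" where
  "op_id I = (\<lambda>\<xi>. if \<xi> \<in> l2 I then \<xi> else (\<lambda>v. 0))"

definition op_alg :: "'i set \<Rightarrow> 'i opr star_alg" where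
  "op_alg I = \<lparr> alg_set = {T. bounded_op I T}, alg_add = op_add, alg_scale = op_scale,
     alg_mult = (\<circ>), alg_one = op_id I, alg_star = adj I \<rparr>"

definition op_of_basis :: "'i set \<Rightarrow> ('i \<Rightarrow> 'i vec) \<Rightarrow> 'i opr" where
  "op_of_basis I F = (THE T. bounded_op I T \<and> (\<forall>w\<in>I. T (basis_vec w) = F w))"


section \<open>The algebra \<open>\<B>\<close>\<close>

text \<open>Basis labels \<open>(n, i, j)\<close> with \<open>n \<in> \<nat>/2\<close> and \<open>i, j \<in> {-n, -n+1, \<dots>, n}\<close>.\<close>

type_synonym idx = "real \<times> real \<times> real"

definition idx_set :: "idx set" where
  "idx_set = {(n, i, j) | n i j. \<exists>N x y :: nat. n = real N / 2 \<and> x \<le> N \<and> y \<le> N \<and>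
     i = real x - n \<and> j = real y - n}"

definition a_plus :: "real \<Rightarrow> real \<Rightarrow> real \<Rightarrow> real \<Rightarrow> real" where
  "a_plus q n i j = q powr (2*n + i + j + 1) *
     (sqrt (1 - q powr (2*n - 2*j + 2)) * sqrt (1 - q powr (2*n - 2*i + 2))) /
     (sqrt (1 - q powr (4*n + 2)) * sqrt (1 - q powr (4*n + 4)))"

definition a_minus :: "real \<Rightarrow> real \<Rightarrow> real \<Rightarrow> real \<Rightarrow> real" where
  "a_minus q n i j = (if n = 0 then 0 else
     (sqrt (1 - q powr (2*n + 2*j)) * sqrt (1 - q powr (2*n + 2*i))) /
     (sqrt (1 - q powr (4*n)) * sqrt (1 - q powr (4*n + 2))))"

definition b_plus :: "real \<Rightarrow> real \<Rightarrow> real \<Rightarrow> real \<Rightarrow> real" where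
  "b_plus q n i j = - (q powr (n + j)) *
     (sqrt (1 - q powr (2*n - 2*j + 2)) * sqrt (1 - q powr (2*n + 2*i + 2))) /
     (sqrt (1 - q powr (4*n + 2)) * sqrt (1 - q powr (4*n + 4)))"

definition b_minus :: "real \<Rightarrow> real \<Rightarrow> real \<Rightarrow> real \<Rightarrow> real" where
  "b_minus q n i j = (if n = 0 then 0 else
     q powr (n + i) * (sqrt (1 - q powr (2*n + 2*j)) * sqrt (1 - q powr (2*n - 2*i))) /
     (sqrt (1 - q powr (4*n)) * sqrt (1 - q powr (4*n + 2))))"

definition alpha_plus :: "real \<Rightarrow> idx opr" where
  "alpha_plus q = op_of_basis idx_set (\<lambda>(n, i, j) v.
     complex_of_real (a_plus q n i j) * basis_vec (n + 1/2, i - 1/2, j - 1/2) v)"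

definition alpha_minus :: "real \<Rightarrow> idx opr" where
  "alpha_minus q = op_of_basis idx_set (\<lambda>(n, i, j) v.
     complex_of_real (a_minus q n i j) * basis_vec (n - 1/2, i - 1/2, j - 1/2) v)"

definition beta_plus :: "real \<Rightarrow> idx opr" where
  "beta_plus q = op_of_basis idx_set (\<lambda>(n, i, j) v.
     complex_of_real (b_plus q n i j) * basis_vec (n + 1/2, i + 1/2, j - 1/2) v)"

definition beta_minus :: "real \<Rightarrow> idx opr" where
  "beta_minus q = op_of_basis idx_set (\<lambda>(n, i, j) v.
     complex_of_real (b_minus q n i j) * basis_vec (n - 1/2, i + 1/2, j - 1/2) v)"

definition alpha :: "real \<Rightarrow> idx opr" where
  "alpha q = op_add (alpha_plus q) (alpha_minus q)"

definition beta :: "real \<Rightarrow> idx opr" where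
  "beta q = op_add (beta_plus q) (beta_minus q)"

text \<open>\<open>D\<close> is the self-adjoint operator, diagonal in the given basis, with these eigenvalues; hence
  \<open>\<bar>D\<bar>\<close> is diagonal with their absolute values, on the same domain.\<close>

definition dirac_ev :: "idx \<Rightarrow> real" where
  "dirac_ev = (\<lambda>(n, i, j). (2 * (if n - i = 0 then 1 else 0) - 1) * (2 * n))"

definition dirac_dom :: "idx vec set" where
  "dirac_dom = {\<xi> \<in> l2 idx_set. (\<lambda>v. complex_of_real (dirac_ev v) * \<xi> v) \<in> l2 idx_set}"

definition abs_dirac :: "idx opr" where
  "abs_dirac \<xi> = (\<lambda>v. complex_of_real \<bar>dirac_ev v\<bar> * \<xi> v)"

text \<open>The bounded extension of the commutator \<open>[\<bar>D\<bar>, T]\<close>, which is defined on the domain of \<open>D\<close>.\<close>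

definition delta :: "idx opr \<Rightarrow> idx opr" where
  "delta T = (THE S. bounded_op idx_set S \<and>
     (\<forall>\<xi>\<in>dirac_dom. T \<xi> \<in> dirac_dom \<and> S \<xi> = (\<lambda>v. abs_dirac (T \<xi>) v - T (abs_dirac \<xi>) v)))"

definition B_gens :: "real \<Rightarrow> idx opr set" where
  "B_gens q = (let G = (\<Union>k. {(delta ^^ k) (alpha q), (delta ^^ k) (beta q)})
     in G \<union> adj idx_set ` G)"

definition B_alg :: "real \<Rightarrow> idx opr star_alg" where
  "B_alg q = (op_alg idx_set)\<lparr> alg_set := gen_alg (op_alg idx_set) (B_gens q) \<rparr>"


section \<open>The Frechet algebras of smooth functions on the circle and on the quantum discs\<close>

record 'a frechet_alg = "'a star_alg" +
  seminorm :: "nat \<Rightarrow> 'a \<Rightarrow> real"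

text \<open>Functions on the circle are \<open>2\<pi>\<close>-periodic functions of the angle.\<close>

definition nth_deriv :: "nat \<Rightarrow> (real \<Rightarrow> complex) \<Rightarrow> real \<Rightarrow> complex" where
  "nth_deriv k = (\<lambda>f \<theta>. vector_derivative f (at \<theta>)) ^^ k"

definition smooth_circle_set :: "(real \<Rightarrow> complex) set" where
  "smooth_circle_set = {f. (\<forall>\<theta>. f (\<theta> + 2 * pi) = f \<theta>) \<and>
     (\<forall>k \<theta>. nth_deriv k f differentiable (at \<theta>))}"

definition circle_seminorm :: "nat \<Rightarrow> (real \<Rightarrow> complex) \<Rightarrow> real" where
  "circle_seminorm k f = (SUP \<theta>. cmod (nth_deriv k f \<theta>))"

definition smooth_circle :: "(real \<Rightarrow> complex) frechet_alg" where
  "smooth_circle = \<lparr> alg_set = smooth_circle_set,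
     alg_add = (\<lambda>f g \<theta>. f \<theta> + g \<theta>), alg_scale = (\<lambda>c f \<theta>. c * f \<theta>),
     alg_mult = (\<lambda>f g \<theta>. f \<theta> * g \<theta>), alg_one = (\<lambda>\<theta>. 1), alg_star = (\<lambda>f \<theta>. cnj (f \<theta>)),
     seminorm = circle_seminorm \<rparr>"

definition fourier_coeff :: "(real \<Rightarrow> complex) \<Rightarrow> int \<Rightarrow> complex" where
  "fourier_coeff f k =
     complex_of_real (1 / (2 * pi)) * integral {0..2 * pi} (\<lambda>\<theta>. f \<theta> * cis (- (of_int k * \<theta>)))"

definition shift :: "nat opr" where
  "shift = op_of_basis UNIV (\<lambda>x. if x = 0 then (\<lambda>v. 0) else basis_vec (x - 1))"

definition toeplitz :: "(real \<Rightarrow> complex) \<Rightarrow> nat opr" where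
  "toeplitz f = (\<lambda>\<xi>. if \<xi> \<in> l2 UNIV then
       (\<lambda>x. (\<Sum>\<^sub>\<infinity>k\<in>{0..}. fourier_coeff f (int k) * (shift ^^ k) \<xi> x) +
            (\<Sum>\<^sub>\<infinity>k\<in>{1..}. fourier_coeff f (- int k) * (adj UNIV shift ^^ k) \<xi> x))
     else (\<lambda>x. 0))"

definition rapid_decay :: "(nat \<Rightarrow> nat \<Rightarrow> complex) \<Rightarrow> bool" where
  "rapid_decay R \<longleftrightarrow>
     (\<forall>k. bdd_above (range (\<lambda>(x, y). (1 + real x + real y) ^ k * cmod (R x y))))"

definition matrix_op :: "(nat \<Rightarrow> nat \<Rightarrow> complex) \<Rightarrow> nat opr" where
  "matrix_op R = (\<lambda>\<xi>. if \<xi> \<in> l2 UNIV then (\<lambda>x. \<Sum>\<^sub>\<infinity>y. R x y * \<xi> y) else (\<lambda>x. 0))"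

definition matrix_seminorm :: "nat \<Rightarrow> (nat \<Rightarrow> nat \<Rightarrow> complex) \<Rightarrow> real" where
  "matrix_seminorm k R = (SUP (x, y). (1 + real x + real y) ^ k * cmod (R x y))"

definition smooth_disc_set :: "nat opr set" where
  "smooth_disc_set = {op_add (toeplitz f) (matrix_op R) | f R.
     f \<in> smooth_circle_set \<and> rapid_decay R}"

text \<open>The topology is that of \<open>C\<^sup>\<infinity>(S\<^sup>1)\<close> plus rapidly decreasing matrices, transported along
  \<open>(f, R) \<mapsto> T\<^sub>f + R\<close>. The pair \<open>(f, R)\<close> is determined by the operator, so the infimum below is over
  a single value.\<close>

definition disc_seminorm :: "nat \<Rightarrow> nat opr \<Rightarrow> real" where
  "disc_seminorm k T = Inf {circle_seminorm k f + matrix_seminorm k R | f R.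
     f \<in> smooth_circle_set \<and> rapid_decay R \<and> T = op_add (toeplitz f) (matrix_op R)}"

text \<open>\<open>C\<^sup>\<infinity>(D\<^sup>2\<^sub>q\<^sub>+)\<close> and \<open>C\<^sup>\<infinity>(D\<^sup>2\<^sub>q\<^sub>-)\<close> are one and the same algebra of operators on \<open>\<ell>\<^sup>2(\<nat>)\<close>.\<close>

definition smooth_disc :: "nat opr frechet_alg" where
  "smooth_disc = \<lparr> alg_set = smooth_disc_set, alg_add = op_add, alg_scale = op_scale,
     alg_mult = (\<circ>), alg_one = op_id UNIV, alg_star = adj UNIV, seminorm = disc_seminorm \<rparr>"

definition pi_alpha :: "real \<Rightarrow> nat opr" where
  "pi_alpha q = op_of_basis UNIV (\<lambda>x v. complex_of_real (sqrt (1 - q ^ (2 * x))) * basis_vec (x - 1) v)"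

text \<open>The real number \<open>s\<close> is the sign \<open>1\<close> or \<open>-1\<close> that distinguishes \<open>\<pi>\<^sub>+\<close> from \<open>\<pi>\<^sub>-\<close>; both agree
  on \<open>\<alpha>\<close>.\<close>

definition pi_beta :: "real \<Rightarrow> real \<Rightarrow> nat opr" where
  "pi_beta s q = op_of_basis UNIV (\<lambda>x v. complex_of_real (s * q ^ x) * basis_vec x v)"


section \<open>Completed tensor product of three Frechet algebras\<close>

text \<open>The completed projective tensor product of Frechet spaces is realised inside the algebraic dual
  of the space of continuous trilinear forms, \<open>a \<otimes> b \<otimes> c\<close> being evaluation at \<open>(a, b, c)\<close>. Its
  elements are the sums of absolutely convergent series of elementary tensors (Grothendieck), and
  continuous trilinear forms separate them. The spaces used here are nuclear, so that there is only
  one completed tensor product. Elements take the value \<open>0\<close> off the continuous trilinear forms.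
  Multiplication and involution extend \<open>(a \<otimes> b \<otimes> c)(a' \<otimes> b' \<otimes> c') = aa' \<otimes> bb' \<otimes> cc'\<close> and
  \<open>(a \<otimes> b \<otimes> c)\<^sup>* = a\<^sup>* \<otimes> b\<^sup>* \<otimes> c\<^sup>*\<close> bilinearly, respectively antilinearly, and continuously. The
  topology of the tensor product is not recorded.\<close>

definition linear_form_on :: "('a, 'm) star_alg_scheme \<Rightarrow> ('a \<Rightarrow> complex) \<Rightarrow> bool" where
  "linear_form_on A \<phi> \<longleftrightarrow>
     (\<forall>x\<in>alg_set A. \<forall>y\<in>alg_set A. \<phi> (alg_add A x y) = \<phi> x + \<phi> y) \<and>
     (\<forall>c. \<forall>x\<in>alg_set A. \<phi> (alg_scale A c x) = c * \<phi> x)"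

definition cont_trilinear ::
  "'a frechet_alg \<Rightarrow> 'b frechet_alg \<Rightarrow> 'c frechet_alg \<Rightarrow> ('a \<Rightarrow> 'b \<Rightarrow> 'c \<Rightarrow> complex) set" where
  "cont_trilinear A B C = {\<phi>.
     (\<forall>b\<in>alg_set B. \<forall>c\<in>alg_set C. linear_form_on A (\<lambda>a. \<phi> a b c)) \<and>
     (\<forall>a\<in>alg_set A. \<forall>c\<in>alg_set C. linear_form_on B (\<lambda>b. \<phi> a b c)) \<and>
     (\<forall>a\<in>alg_set A. \<forall>b\<in>alg_set B. linear_form_on C (\<lambda>c. \<phi> a b c)) \<and>
     (\<exists>M k. \<forall>a\<in>alg_set A. \<forall>b\<in>alg_set B. \<forall>c\<in>alg_set C.
        cmod (\<phi> a b c) \<le>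
          M * (\<Sum>l\<le>k. seminorm A l a) * (\<Sum>l\<le>k. seminorm B l b) * (\<Sum>l\<le>k. seminorm C l c))}"

type_synonym ('a, 'b, 'c) tensor = "('a \<Rightarrow> 'b \<Rightarrow> 'c \<Rightarrow> complex) \<Rightarrow> complex"

definition elem_tensor ::
  "'a frechet_alg \<Rightarrow> 'b frechet_alg \<Rightarrow> 'c frechet_alg \<Rightarrow> 'a \<Rightarrow> 'b \<Rightarrow> 'c \<Rightarrow> ('a, 'b, 'c) tensor" where
  "elem_tensor A B C a b c = (\<lambda>\<phi>. if \<phi> \<in> cont_trilinear A B C then \<phi> a b c else 0)"

definition tensor_set ::
  "'a frechet_alg \<Rightarrow> 'b frechet_alg \<Rightarrow> 'c frechet_alg \<Rightarrow> ('a, 'b, 'c) tensor set" where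
  "tensor_set A B C = {\<Phi>. \<exists>a b c.
     (\<forall>m::nat. a m \<in> alg_set A \<and> b m \<in> alg_set B \<and> c m \<in> alg_set C) \<and>
     (\<forall>k l r. summable (\<lambda>m. seminorm A k (a m) * seminorm B l (b m) * seminorm C r (c m))) \<and>
     \<Phi> = (\<lambda>\<phi>. \<Sum>m. elem_tensor A B C (a m) (b m) (c m) \<phi>)}"

definition tensor_mult ::
  "'a frechet_alg \<Rightarrow> 'b frechet_alg \<Rightarrow> 'c frechet_alg \<Rightarrow>
     ('a, 'b, 'c) tensor \<Rightarrow> ('a, 'b, 'c) tensor \<Rightarrow> ('a, 'b, 'c) tensor" where
  "tensor_mult A B C \<Phi> \<Psi> = (\<lambda>\<phi>. if \<phi> \<in> cont_trilinear A B C then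
     \<Phi> (\<lambda>a b c. \<Psi> (\<lambda>a' b' c'. \<phi> (alg_mult A a a') (alg_mult B b b') (alg_mult C c c'))) else 0)"

definition tensor_star ::
  "'a frechet_alg \<Rightarrow> 'b frechet_alg \<Rightarrow> 'c frechet_alg \<Rightarrow> ('a, 'b, 'c) tensor \<Rightarrow> ('a, 'b, 'c) tensor" where
  "tensor_star A B C \<Phi> = (\<lambda>\<phi>. if \<phi> \<in> cont_trilinear A B C then
     cnj (\<Phi> (\<lambda>a b c. cnj (\<phi> (alg_star A a) (alg_star B b) (alg_star C c)))) else 0)"

definition tensor_alg ::
  "'a frechet_alg \<Rightarrow> 'b frechet_alg \<Rightarrow> 'c frechet_alg \<Rightarrow> ('a, 'b, 'c) tensor star_alg" where
  "tensor_alg A B C = \<lparr> alg_set = tensor_set A B C,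
     alg_add = (\<lambda>\<Phi> \<Psi> \<phi>. \<Phi> \<phi> + \<Psi> \<phi>), alg_scale = (\<lambda>z \<Phi> \<phi>. z * \<Phi> \<phi>),
     alg_mult = tensor_mult A B C, alg_one = elem_tensor A B C (alg_one A) (alg_one B) (alg_one C),
     alg_star = tensor_star A B C \<rparr>"

abbreviation target_alg ::
  "(nat opr, nat opr, real \<Rightarrow> complex) tensor star_alg" where
  "target_alg \<equiv> tensor_alg smooth_disc smooth_disc smooth_circle"

abbreviation target_elem ::
  "nat opr \<Rightarrow> nat opr \<Rightarrow> (real \<Rightarrow> complex) \<Rightarrow> (nat opr, nat opr, real \<Rightarrow> complex) tensor" where
  "target_elem \<equiv> elem_tensor smooth_disc smooth_disc smooth_circle"

text \<open>The four equalities that define \<open>\<rho>\<close>; the generator \<open>u\<close> of \<open>C\<^sup>\<infinity>(S\<^sup>1)\<close> is \<open>cis\<close>.\<close>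

definition rho_on_generators ::
  "real \<Rightarrow> (idx opr \<Rightarrow> (nat opr, nat opr, real \<Rightarrow> complex) tensor) \<Rightarrow> bool" where
  "rho_on_generators q \<rho> \<longleftrightarrow>
     \<rho> (alpha_plus q) = alg_scale target_alg (- complex_of_real q)
        (target_elem (adj UNIV (pi_beta 1 q)) (pi_beta (-1) q) cis) \<and>
     \<rho> (alpha_minus q) = target_elem (pi_alpha q) (pi_alpha q) (alg_star smooth_circle cis) \<and>
     \<rho> (beta_plus q) = target_elem (adj UNIV (pi_alpha q)) (pi_beta (-1) q) cis \<and>
     \<rho> (beta_minus q) = target_elem (pi_beta 1 q) (pi_alpha q) (alg_star smooth_circle cis)"

end

theory Submission
  imports Defs
begin

text \<open>Put \<open>x = n + i\<close> and \<open>y = n + j\<close>. For fixed \<open>x\<close>, \<open>y\<close> and \<open>n \<rightarrow> \<infinity>\<close> the weights of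
  \<open>\<alpha>\<^sub>\<plusminus>\<close>, \<open>\<beta>\<^sub>\<plusminus>\<close> converge to those of the operators \<open>\<rho>(\<alpha>\<^sub>\<plusminus>)\<close>, \<open>\<rho>(\<beta>\<^sub>\<plusminus>)\<close>, where \<open>u\<close> acts as the shift
  in \<open>2n\<close>. Hence a noncommutative polynomial in the generators and their adjoints that vanishes on the
  Hilbert space has an image all of whose matrix entries vanish, and since matrix entries separate the
  points of each factor, that image is the zero tensor. So \<open>\<rho>\<close> is well defined on polynomials, where
  multiplicativity and compatibility with adjoints are immediate. The product of tensors makes sense
  because the smooth disc is a topological algebra: the map \<open>f \<mapsto> T\<^sub>f\<close> is multiplicative up to matrices of
  rapid decay, and \<open>f\<close> and \<open>R\<close> are determined by \<open>T\<^sub>f + R\<close>.\<close>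


section \<open>Square-summable families and bounded operators\<close>

text \<open>\<open>adj\<close>, \<open>op_of_basis\<close> and \<open>delta\<close> are definite
  descriptions, so they say nothing until a bounded candidate is exhibited. Candidates come from
  matrices satisfying Schur's condition; for the generators these are weighted shifts on integer
  lattices, a class closed under products and adjoints. With \<open>N = 2n\<close>,
  \<open>x\<close>, \<open>y\<close> as coordinates all displacements are integral: those in
  \<open>N\<close>, \<open>x\<close>, \<open>y\<close> are the exponent of \<open>u\<close> and the
  displacements in the two disc factors. The absolute Dirac operator has the eigenvalue
  \<open>N\<close>, so \<open>delta\<close> multiplies raising parts by 1 and lowering parts by -1;
  this is why \<open>\<B>\<close> contains the four parts separately. The obstacle lies in the
  target. A tensor is a functional that is 0 off the continuous trilinear forms, and a product
  applies one functional inside another. The product formula therefore holds only once the inner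
  function is known to be a continuous trilinear form, and this calls for explicit seminorm
  estimates for products of disc operators. The values of the homomorphism are finite sums of
  elementary tensors, so separating them by coordinates is linear algebra in finite-dimensional
  spans.\<close>

lemma l2D:
  assumes "\<xi> \<in> l2 I"
  shows "v \<notin> I \<Longrightarrow> \<xi> v = 0" "(\<lambda>v. (cmod (\<xi> v))\<^sup>2) summable_on I"
  using assms by (auto simp: l2_def)

lemma cmod_add_sq_le: "(cmod (x + y))\<^sup>2 \<le> 2 * (cmod x)\<^sup>2 + 2 * (cmod y)\<^sup>2"
proof -
  have "(cmod (x + y))\<^sup>2 \<le> (cmod x + cmod y)\<^sup>2"
    by (intro power_mono norm_triangle_ineq) auto
  also have "\<dots> \<le> 2 * (cmod x)\<^sup>2 + 2 * (cmod y)\<^sup>2"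
    using sum_squares_bound[of "cmod x" "cmod y"] by (simp add: power2_sum)
  finally show ?thesis .
qed

lemma cmod_mult_le: "cmod x * cmod y \<le> (cmod x)\<^sup>2 + (cmod y)\<^sup>2"
proof -
  have "0 \<le> cmod x * cmod y" by simp
  then show ?thesis using sum_squares_bound[of "cmod x" "cmod y"] by linarith
qed

lemma l2_zero [simp]: "(\<lambda>v. 0) \<in> l2 I"
  by (simp add: l2_def)

lemma l2_scale: "\<xi> \<in> l2 I \<Longrightarrow> (\<lambda>v. c * \<xi> v) \<in> l2 I"
  by (auto simp: l2_def norm_mult power_mult_distrib intro: summable_on_cmult_right)

lemma l2_add:
  assumes "\<xi> \<in> l2 I" "\<eta> \<in> l2 I"
  shows "(\<lambda>v. \<xi> v + \<eta> v) \<in> l2 I"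
proof -
  have "(\<lambda>v. 2 * (cmod (\<xi> v))\<^sup>2 + 2 * (cmod (\<eta> v))\<^sup>2) summable_on I"
    by (intro summable_on_add summable_on_cmult_right l2D assms)
  then have "(\<lambda>v. (cmod (\<xi> v + \<eta> v))\<^sup>2) summable_on I"
    by (rule summable_on_comparison_test) (auto intro: cmod_add_sq_le)
  then show ?thesis using assms by (auto simp: l2_def)
qed

lemma l2_comb: "\<xi> \<in> l2 I \<Longrightarrow> \<eta> \<in> l2 I \<Longrightarrow> (\<lambda>v. a * \<xi> v + b * \<eta> v) \<in> l2 I"
  by (intro l2_add l2_scale)

lemma l2_restrict:
  assumes "\<xi> \<in> l2 I"
  shows "(\<lambda>v. if v \<in> F then \<xi> v else 0) \<in> l2 I"
proof -
  have "(\<lambda>v. (cmod (if v \<in> F then \<xi> v else 0))\<^sup>2) summable_on I"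
    by (rule summable_on_comparison_test[OF l2D(2)[OF assms]]) auto
  then show ?thesis using assms by (auto simp: l2_def)
qed

lemma l2_basis [simp]: "w \<in> I \<Longrightarrow> basis_vec w \<in> l2 I"
proof -
  assume w: "w \<in> I"
  have "(\<lambda>v. (cmod (basis_vec w v))\<^sup>2) summable_on I \<longleftrightarrow> (\<lambda>v. (cmod (basis_vec w v))\<^sup>2) summable_on {w}"
    by (rule summable_on_cong_neutral) (use w in \<open>auto simp: basis_vec_def\<close>)
  then show ?thesis using w by (auto simp: l2_def basis_vec_def)
qed

lemma l2_norm_nonneg [simp]: "0 \<le> l2_norm I \<xi>"
  by (simp add: l2_norm_def infsum_nonneg)

lemma l2_norm_sq: "(l2_norm I \<xi>)\<^sup>2 = (\<Sum>\<^sub>\<infinity>v\<in>I. (cmod (\<xi> v))\<^sup>2)"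
  by (simp add: l2_norm_def infsum_nonneg)

lemma cmod_le_l2_norm:
  assumes "\<xi> \<in> l2 I"
  shows "cmod (\<xi> v) \<le> l2_norm I \<xi>"
proof (cases "v \<in> I")
  case True
  have "(\<Sum>v\<in>{v}. (cmod (\<xi> v))\<^sup>2) \<le> (\<Sum>\<^sub>\<infinity>v\<in>I. (cmod (\<xi> v))\<^sup>2)"
    by (rule finite_sum_le_infsum) (use True l2D[OF assms] in auto)
  then have "(cmod (\<xi> v))\<^sup>2 \<le> (l2_norm I \<xi>)\<^sup>2" by (simp add: l2_norm_sq)
  then show ?thesis by (rule power2_le_imp_le) simp
next
  case False
  then show ?thesis using l2D(1)[OF assms] by simp
qed

text \<open>The bound is asked for in squared form, where it compares sums over \<open>I\<close>
  directly. Taking \<open>\<bar>C\<bar>\<close> under the root makes any real \<open>C\<close>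
  admissible.\<close>

lemma bounded_opI:
  assumes "\<And>\<xi>. \<xi> \<in> l2 I \<Longrightarrow> T \<xi> \<in> l2 I"
    and "\<And>\<xi> \<eta> a b. \<xi> \<in> l2 I \<Longrightarrow> \<eta> \<in> l2 I \<Longrightarrow> T (\<lambda>v. a * \<xi> v + b * \<eta> v) = (\<lambda>v. a * T \<xi> v + b * T \<eta> v)"
    and "\<And>\<xi>. \<xi> \<in> l2 I \<Longrightarrow> (l2_norm I (T \<xi>))\<^sup>2 \<le> C * (l2_norm I \<xi>)\<^sup>2"
    and "\<And>\<xi>. \<xi> \<notin> l2 I \<Longrightarrow> T \<xi> = (\<lambda>v. 0)"
  shows "bounded_op I T"
proof -
  have "l2_norm I (T \<xi>) \<le> sqrt \<bar>C\<bar> * l2_norm I \<xi>" if "\<xi> \<in> l2 I" for \<xi>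
  proof (rule power2_le_imp_le)
    have "(l2_norm I (T \<xi>))\<^sup>2 \<le> C * (l2_norm I \<xi>)\<^sup>2" using assms(3) that by blast
    also have "\<dots> \<le> (sqrt \<bar>C\<bar> * l2_norm I \<xi>)\<^sup>2"
      by (simp add: power_mult_distrib mult_right_mono)
    finally show "(l2_norm I (T \<xi>))\<^sup>2 \<le> (sqrt \<bar>C\<bar> * l2_norm I \<xi>)\<^sup>2" .
  qed simp
  with assms(1,2,4) show ?thesis unfolding bounded_op_def by blast
qed

lemma bounded_opD:
  assumes "bounded_op I T"
  shows "\<xi> \<in> l2 I \<Longrightarrow> T \<xi> \<in> l2 I"
    and "\<xi> \<in> l2 I \<Longrightarrow> \<eta> \<in> l2 I \<Longrightarrow> T (\<lambda>v. a * \<xi> v + b * \<eta> v) = (\<lambda>v. a * T \<xi> v + b * T \<eta> v)"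
    and "\<xi> \<notin> l2 I \<Longrightarrow> T \<xi> = (\<lambda>v. 0)"
  using assms unfolding bounded_op_def by blast+

lemma bounded_op_sq:
  assumes "bounded_op I T"
  shows "\<exists>C\<ge>0. \<forall>\<xi>\<in>l2 I. (l2_norm I (T \<xi>))\<^sup>2 \<le> C * (l2_norm I \<xi>)\<^sup>2"
proof -
  obtain C where C: "\<forall>\<xi>\<in>l2 I. l2_norm I (T \<xi>) \<le> C * l2_norm I \<xi>"
    using assms unfolding bounded_op_def by blast
  have "(l2_norm I (T \<xi>))\<^sup>2 \<le> C\<^sup>2 * (l2_norm I \<xi>)\<^sup>2" if "\<xi> \<in> l2 I" for \<xi>
    using power_mono[OF C[rule_format, OF that], of 2] by (simp add: power_mult_distrib)
  then show ?thesis by (intro exI[of _ "C\<^sup>2"]) auto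
qed

lemma bounded_op_0: "bounded_op I T \<Longrightarrow> T (\<lambda>v. 0) = (\<lambda>v. 0)"
  using bounded_opD(2)[of I T "\<lambda>v. 0" "\<lambda>v. 0" 0 0] by simp

lemma bounded_op_scaleD: "bounded_op I T \<Longrightarrow> \<xi> \<in> l2 I \<Longrightarrow> T (\<lambda>v. a * \<xi> v) = (\<lambda>v. a * T \<xi> v)"
  using bounded_opD(2)[of I T \<xi> \<xi> a 0] by simp

lemma bounded_op_addD:
  "bounded_op I T \<Longrightarrow> \<xi> \<in> l2 I \<Longrightarrow> \<eta> \<in> l2 I \<Longrightarrow> T (\<lambda>v. \<xi> v + \<eta> v) = (\<lambda>v. T \<xi> v + T \<eta> v)"
  using bounded_opD(2)[of I T \<xi> \<eta> 1 1] by simp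

lemma bounded_op_diffD:
  "bounded_op I T \<Longrightarrow> \<xi> \<in> l2 I \<Longrightarrow> \<eta> \<in> l2 I \<Longrightarrow> T (\<lambda>v. \<xi> v - \<eta> v) = (\<lambda>v. T \<xi> v - T \<eta> v)"
  using bounded_opD(2)[of I T \<xi> \<eta> 1 "-1"] by simp

lemma l2_norm_mono_sq:
  assumes "\<eta> \<in> l2 I" "\<zeta> \<in> l2 I" "\<xi> \<in> l2 I"
    and "\<And>v. v \<in> I \<Longrightarrow> (cmod (\<xi> v))\<^sup>2 \<le> a * (cmod (\<eta> v))\<^sup>2 + b * (cmod (\<zeta> v))\<^sup>2"
  shows "(l2_norm I \<xi>)\<^sup>2 \<le> a * (l2_norm I \<eta>)\<^sup>2 + b * (l2_norm I \<zeta>)\<^sup>2"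
proof -
  have s: "(\<lambda>v. a * (cmod (\<eta> v))\<^sup>2) summable_on I" "(\<lambda>v. b * (cmod (\<zeta> v))\<^sup>2) summable_on I"
    by (intro summable_on_cmult_right l2D assms)+
  have "(\<Sum>\<^sub>\<infinity>v\<in>I. (cmod (\<xi> v))\<^sup>2) \<le> (\<Sum>\<^sub>\<infinity>v\<in>I. a * (cmod (\<eta> v))\<^sup>2 + b * (cmod (\<zeta> v))\<^sup>2)"
    by (intro infsum_mono summable_on_add s l2D assms)
  also have "\<dots> = a * (l2_norm I \<eta>)\<^sup>2 + b * (l2_norm I \<zeta>)\<^sup>2"
    using s by (simp add: infsum_add infsum_cmult_right l2D assms l2_norm_sq)
  finally show ?thesis by (simp add: l2_norm_sq)
qed

lemma bounded_op_add:
  assumes "bounded_op I S" "bounded_op I T"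
  shows "bounded_op I (op_add S T)"
proof -
  obtain C where C: "C \<ge> 0" "\<forall>\<xi>\<in>l2 I. (l2_norm I (S \<xi>))\<^sup>2 \<le> C * (l2_norm I \<xi>)\<^sup>2"
    using bounded_op_sq[OF assms(1)] by blast
  obtain C' where C': "C' \<ge> 0" "\<forall>\<xi>\<in>l2 I. (l2_norm I (T \<xi>))\<^sup>2 \<le> C' * (l2_norm I \<xi>)\<^sup>2"
    using bounded_op_sq[OF assms(2)] by blast
  show ?thesis
  proof (rule bounded_opI[where C = "2 * C + 2 * C'"])
    fix \<xi> assume \<xi>: "\<xi> \<in> l2 I"
    then show l: "op_add S T \<xi> \<in> l2 I"
      unfolding op_add_def by (intro l2_add bounded_opD(1)[OF assms(1)] bounded_opD(1)[OF assms(2)])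
    have "(l2_norm I (op_add S T \<xi>))\<^sup>2 \<le> 2 * (l2_norm I (S \<xi>))\<^sup>2 + 2 * (l2_norm I (T \<xi>))\<^sup>2"
      by (rule l2_norm_mono_sq[OF bounded_opD(1)[OF assms(1) \<xi>] bounded_opD(1)[OF assms(2) \<xi>] l])
        (simp add: op_add_def cmod_add_sq_le)
    also have "\<dots> \<le> (2 * C + 2 * C') * (l2_norm I \<xi>)\<^sup>2"
      using bspec[OF C(2) \<xi>] bspec[OF C'(2) \<xi>] by (simp add: algebra_simps)
    finally show "(l2_norm I (op_add S T \<xi>))\<^sup>2 \<le> (2 * C + 2 * C') * (l2_norm I \<xi>)\<^sup>2" .
  next
    fix \<xi> \<eta> a b assume "\<xi> \<in> l2 I" "\<eta> \<in> l2 I"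
    then show "op_add S T (\<lambda>v. a * \<xi> v + b * \<eta> v) = (\<lambda>v. a * op_add S T \<xi> v + b * op_add S T \<eta> v)"
      using assms by (simp add: op_add_def bounded_opD(2) algebra_simps)
  next
    fix \<xi> assume "\<xi> \<notin> l2 I"
    then show "op_add S T \<xi> = (\<lambda>v. 0)" using assms by (simp add: op_add_def bounded_opD(3))
  qed
qed

lemma bounded_op_scale:
  assumes "bounded_op I T"
  shows "bounded_op I (op_scale c T)"
proof -
  obtain C where C: "C \<ge> 0" "\<forall>\<xi>\<in>l2 I. (l2_norm I (T \<xi>))\<^sup>2 \<le> C * (l2_norm I \<xi>)\<^sup>2"
    using bounded_op_sq[OF assms(1)] by blast
  show ?thesis
  proof (rule bounded_opI[where C = "(cmod c)\<^sup>2 * C"])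
    fix \<xi> assume \<xi>: "\<xi> \<in> l2 I"
    then show l: "op_scale c T \<xi> \<in> l2 I"
      unfolding op_scale_def by (intro l2_scale bounded_opD(1)[OF assms])
    have "(l2_norm I (op_scale c T \<xi>))\<^sup>2 \<le> (cmod c)\<^sup>2 * (l2_norm I (T \<xi>))\<^sup>2 + 0 * (l2_norm I (T \<xi>))\<^sup>2"
      by (rule l2_norm_mono_sq[OF bounded_opD(1)[OF assms \<xi>] bounded_opD(1)[OF assms \<xi>] l])
        (simp add: op_scale_def norm_mult power_mult_distrib)
    also have "\<dots> \<le> (cmod c)\<^sup>2 * C * (l2_norm I \<xi>)\<^sup>2"
      using C(2) \<xi> by (simp add: mult.assoc mult_left_mono)
    finally show "(l2_norm I (op_scale c T \<xi>))\<^sup>2 \<le> (cmod c)\<^sup>2 * C * (l2_norm I \<xi>)\<^sup>2" .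
  next
    fix \<xi> \<eta> a b assume "\<xi> \<in> l2 I" "\<eta> \<in> l2 I"
    then show "op_scale c T (\<lambda>v. a * \<xi> v + b * \<eta> v) = (\<lambda>v. a * op_scale c T \<xi> v + b * op_scale c T \<eta> v)"
      using assms by (simp add: op_scale_def bounded_opD(2) algebra_simps)
  next
    fix \<xi> assume "\<xi> \<notin> l2 I"
    then show "op_scale c T \<xi> = (\<lambda>v. 0)" using assms by (simp add: op_scale_def bounded_opD(3))
  qed
qed

lemma bounded_op_comp:
  assumes "bounded_op I S" "bounded_op I T"
  shows "bounded_op I (S \<circ> T)"
proof -
  obtain C where C: "C \<ge> 0" "\<forall>\<xi>\<in>l2 I. (l2_norm I (S \<xi>))\<^sup>2 \<le> C * (l2_norm I \<xi>)\<^sup>2"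
    using bounded_op_sq[OF assms(1)] by blast
  obtain C' where C': "C' \<ge> 0" "\<forall>\<xi>\<in>l2 I. (l2_norm I (T \<xi>))\<^sup>2 \<le> C' * (l2_norm I \<xi>)\<^sup>2"
    using bounded_op_sq[OF assms(2)] by blast
  show ?thesis
  proof (rule bounded_opI[where C = "C * C'"])
    fix \<xi> assume \<xi>: "\<xi> \<in> l2 I"
    then show "(S \<circ> T) \<xi> \<in> l2 I" using assms by (simp add: bounded_opD(1))
    have "(l2_norm I (S (T \<xi>)))\<^sup>2 \<le> C * (l2_norm I (T \<xi>))\<^sup>2"
      using C(2) bounded_opD(1)[OF assms(2) \<xi>] by blast
    also have "\<dots> \<le> C * (C' * (l2_norm I \<xi>)\<^sup>2)" using C(1) C'(2) \<xi> by (intro mult_left_mono) auto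
    finally show "(l2_norm I ((S \<circ> T) \<xi>))\<^sup>2 \<le> C * C' * (l2_norm I \<xi>)\<^sup>2" by (simp add: mult.assoc)
  next
    fix \<xi> \<eta> a b assume "\<xi> \<in> l2 I" "\<eta> \<in> l2 I"
    then show "(S \<circ> T) (\<lambda>v. a * \<xi> v + b * \<eta> v) = (\<lambda>v. a * (S \<circ> T) \<xi> v + b * (S \<circ> T) \<eta> v)"
      using assms by (simp add: bounded_opD(1,2))
  next
    fix \<xi> assume "\<xi> \<notin> l2 I"
    then show "(S \<circ> T) \<xi> = (\<lambda>v. 0)" using assms by (simp add: bounded_opD(3) bounded_op_0)
  qed
qed

lemma bounded_op_id: "bounded_op I (op_id I)"
  by (rule bounded_opI[where C = 1]) (auto simp: op_id_def l2_comb)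

lemma bounded_op_zero: "bounded_op I (\<lambda>\<xi> v. 0)"
  by (rule bounded_opI[where C = 0]) (auto simp: l2_norm_def)

lemma comp_op_id: "bounded_op I T \<Longrightarrow> T \<circ> op_id I = T"
  by (rule ext) (auto simp: op_id_def bounded_opD(3) bounded_op_0)

lemma op_id_comp:
  assumes "bounded_op I T"
  shows "op_id I \<circ> T = T"
proof (rule ext)
  fix \<xi>
  have "T \<xi> \<in> l2 I"
    using bounded_opD(1,3)[OF assms, of \<xi>] by (cases "\<xi> \<in> l2 I") auto
  then show "(op_id I \<circ> T) \<xi> = T \<xi>" by (simp add: op_id_def)
qed

lemma bounded_op_vanish_on_finite:
  assumes T: "bounded_op I T" and 0: "\<And>w. w \<in> I \<Longrightarrow> T (basis_vec w) = (\<lambda>v. 0)"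
    and "finite F" "F \<subseteq> I" "\<xi> \<in> l2 I"
  shows "T (\<lambda>v. if v \<in> F then \<xi> v else 0) = (\<lambda>v. 0)"
  using assms(3,4)
proof (induction F rule: finite_induct)
  case empty
  then show ?case using bounded_op_0[OF T] by simp
next
  case (insert w F)
  have *: "(\<lambda>v. if v \<in> insert w F then \<xi> v else 0) =
    (\<lambda>v. 1 * (if v \<in> F then \<xi> v else 0) + \<xi> w * basis_vec w v)"
    using insert.hyps by (auto simp: basis_vec_def fun_eq_iff)
  show ?case unfolding *
    by (subst bounded_opD(2)[OF T l2_restrict[OF assms(5)] l2_basis])
      (use insert 0 in auto)
qed

text \<open>The truncations of a vector to finite sets of labels converge to it in norm, and the operator kills them.\<close>

lemma bounded_op_vanish:
  assumes T: "bounded_op I T" and 0: "\<And>w. w \<in> I \<Longrightarrow> T (basis_vec w) = (\<lambda>v. 0)"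
  shows "T \<xi> = (\<lambda>v. 0)"
proof (cases "\<xi> \<in> l2 I")
  case True
  obtain C where C: "C \<ge> 0" "\<forall>\<xi>\<in>l2 I. (l2_norm I (T \<xi>))\<^sup>2 \<le> C * (l2_norm I \<xi>)\<^sup>2"
    using bounded_op_sq[OF T] by blast
  have "(cmod (T \<xi> v))\<^sup>2 \<le> 0 + \<epsilon>" if "\<epsilon> > 0" for v \<epsilon>
  proof -
    let ?s = "\<lambda>v. (cmod (\<xi> v))\<^sup>2"
    \<comment> \<open>\<open>C + 1\<close> in place of \<open>C\<close> keeps the quotient
      meaningful when \<open>C = 0\<close>; \<open>C / (C + 1) \<le> 1\<close> closes the
      estimate.\<close>
    have pos: "\<epsilon> / (C + 1) > 0" using that C(1) by simp
    obtain F where F: "finite F" "F \<subseteq> I" "dist (sum ?s F) (infsum ?s I) \<le> \<epsilon> / (C + 1)"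
      using infsum_finite_approximation[OF l2D(2)[OF True] pos] by blast
    define \<zeta> where "\<zeta> = (\<lambda>v. if v \<in> F then \<xi> v else 0)"
    have \<zeta>: "\<zeta> \<in> l2 I" unfolding \<zeta>_def by (rule l2_restrict[OF True])
    have \<eta>: "(\<lambda>v. \<xi> v - \<zeta> v) \<in> l2 I"
      using l2_comb[OF True \<zeta>, of 1 "-1"] by simp
    have "T (\<lambda>v. \<xi> v - \<zeta> v) = T \<xi>"
      unfolding bounded_op_diffD[OF T True \<zeta>]
      using bounded_op_vanish_on_finite[OF T 0 F(1,2) True] by (simp add: \<zeta>_def)
    then have "(cmod (T \<xi> v))\<^sup>2 \<le> (l2_norm I (T (\<lambda>v. \<xi> v - \<zeta> v)))\<^sup>2"
      by (metis cmod_le_l2_norm bounded_opD(1)[OF T] True norm_ge_zero power_mono)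
    also have "\<dots> \<le> C * (l2_norm I (\<lambda>v. \<xi> v - \<zeta> v))\<^sup>2" using C(2) \<eta> by blast
    also have "(l2_norm I (\<lambda>v. \<xi> v - \<zeta> v))\<^sup>2 = infsum ?s (I - F)"
      unfolding l2_norm_sq \<zeta>_def by (rule infsum_cong_neutral) auto
    also have "infsum ?s (I - F) = infsum ?s I - sum ?s F"
      using infsum_Diff[OF l2D(2)[OF True] _ F(2)] F(1) by simp
    also have "C * (infsum ?s I - sum ?s F) \<le> C * (\<epsilon> / (C + 1))"
      using F(3) by (intro mult_left_mono C) (auto simp: dist_real_def)
    also have "\<dots> \<le> \<epsilon>" using C(1) that by (simp add: field_simps)
    finally show ?thesis by simp
  qed
  then have "(cmod (T \<xi> v))\<^sup>2 \<le> 0" for v using field_le_epsilon by blast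
  then show ?thesis by auto
qed (use bounded_opD(3)[OF T] in auto)

text \<open>Off \<open>l2 I\<close> both operators are 0 by convention, and their values vanish off
  \<open>I\<close>; so the difference kills every basis vector. The definite descriptions of
  operators are all settled by this uniqueness.\<close>

lemma bounded_op_eqI:
  assumes S: "bounded_op I S" and T: "bounded_op I T"
    and eq: "\<And>v w. v \<in> I \<Longrightarrow> w \<in> I \<Longrightarrow> S (basis_vec w) v = T (basis_vec w) v"
  shows "S = T"
proof (intro ext)
  fix \<xi> v
  have B: "bounded_op I (op_add S (op_scale (-1) T))"
    by (intro bounded_op_add bounded_op_scale S T)
  have "op_add S (op_scale (-1) T) \<xi> = (\<lambda>v. 0)"
  proof (rule bounded_op_vanish[OF B], rule ext)
    fix w v assume w: "w \<in> I"
    show "op_add S (op_scale (-1) T) (basis_vec w) v = 0"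
    proof (cases "v \<in> I")
      case False
      then show ?thesis
        using l2D(1)[OF bounded_opD(1)[OF B l2_basis[OF w]]] by blast
    qed (use eq w in \<open>simp add: op_add_def op_scale_def\<close>)
  qed
  then show "S \<xi> v = T \<xi> v" by (simp add: op_add_def op_scale_def fun_eq_iff)
qed

lemma op_of_basis_eq:
  assumes "bounded_op I T" "\<And>w. w \<in> I \<Longrightarrow> T (basis_vec w) = F w"
  shows "op_of_basis I F = T"
  unfolding op_of_basis_def
proof (rule the_equality)
  fix S assume S: "bounded_op I S \<and> (\<forall>w\<in>I. S (basis_vec w) = F w)"
  then show "S = T" by (intro bounded_op_eqI[OF _ assms(1)]) (auto simp: assms(2))
qed (use assms in blast)


section \<open>Adjoints\<close>

text \<open>The relational form of \<open>adj\<close>. Since it carries boundedness of both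
  operators, it passes through sums, products and scalars without a general existence theorem for
  adjoints.\<close>

definition is_adj :: "'i set \<Rightarrow> 'i opr \<Rightarrow> 'i opr \<Rightarrow> bool" where
  "is_adj I T S \<longleftrightarrow> bounded_op I T \<and> bounded_op I S \<and>
     (\<forall>\<xi>\<in>l2 I. \<forall>\<eta>\<in>l2 I. l2_inner I (T \<xi>) \<eta> = l2_inner I \<xi> (S \<eta>))"

lemma l2_inner_summable:
  assumes "\<xi> \<in> l2 I" "\<eta> \<in> l2 I"
  shows "(\<lambda>v. \<xi> v * cnj (\<eta> v)) summable_on I"
proof -
  have "(\<lambda>v. (cmod (\<xi> v))\<^sup>2 + (cmod (\<eta> v))\<^sup>2) summable_on I"
    by (intro summable_on_add l2D assms)
  then have "(\<lambda>v. norm (\<xi> v * cnj (\<eta> v))) summable_on I"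
  proof (rule summable_on_comparison_test)
    fix v
    show "norm (\<xi> v * cnj (\<eta> v)) \<le> (cmod (\<xi> v))\<^sup>2 + (cmod (\<eta> v))\<^sup>2"
      unfolding norm_mult complex_mod_cnj by (rule cmod_mult_le)
  qed auto
  then show ?thesis by (rule abs_summable_summable)
qed

lemma l2_inner_basis: "w \<in> I \<Longrightarrow> l2_inner I (basis_vec w) \<eta> = cnj (\<eta> w)"
proof -
  assume w: "w \<in> I"
  have "l2_inner I (basis_vec w) \<eta> = (\<Sum>\<^sub>\<infinity>v\<in>{w}. basis_vec w v * cnj (\<eta> v))"
    unfolding l2_inner_def by (rule infsum_cong_neutral) (use w in \<open>auto simp: basis_vec_def\<close>)
  then show ?thesis by (simp add: basis_vec_def)
qed

lemma l2_inner_comb: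
  assumes "\<xi> \<in> l2 I" "\<eta> \<in> l2 I" "\<zeta> \<in> l2 I"
  shows "l2_inner I (\<lambda>v. a * \<xi> v + b * \<eta> v) \<zeta> = a * l2_inner I \<xi> \<zeta> + b * l2_inner I \<eta> \<zeta>"
proof -
  have "l2_inner I (\<lambda>v. a * \<xi> v + b * \<eta> v) \<zeta> =
    (\<Sum>\<^sub>\<infinity>v\<in>I. a * (\<xi> v * cnj (\<zeta> v)) + b * (\<eta> v * cnj (\<zeta> v)))"
    unfolding l2_inner_def by (simp add: algebra_simps)
  also have "\<dots> = a * l2_inner I \<xi> \<zeta> + b * l2_inner I \<eta> \<zeta>"
    unfolding l2_inner_def using assms
    by (simp add: infsum_add summable_on_cmult_right l2_inner_summable infsum_cmult_right)
  finally show ?thesis .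
qed

lemma l2_inner_swap: "l2_inner I \<eta> \<xi> = cnj (l2_inner I \<xi> \<eta>)"
  unfolding l2_inner_def infsum_cnj[symmetric] by (simp add: mult.commute)

lemma is_adj_sym: "is_adj I T S \<Longrightarrow> is_adj I S T"
  unfolding is_adj_def using l2_inner_swap by metis

lemma is_adj_adj:
  assumes "is_adj I T S"
  shows "adj I T = S"
  unfolding adj_def
proof (rule the_equality)
  fix S' assume S': "bounded_op I S' \<and> (\<forall>\<xi>\<in>l2 I. \<forall>\<eta>\<in>l2 I. l2_inner I (T \<xi>) \<eta> = l2_inner I \<xi> (S' \<eta>))"
  show "S' = S"
  proof (rule bounded_op_eqI)
    fix v w assume vw: "v \<in> I" "w \<in> I"
    have "l2_inner I (basis_vec v) (S' (basis_vec w)) = l2_inner I (basis_vec v) (S (basis_vec w))"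
      using S' assms vw unfolding is_adj_def by (metis l2_basis)
    then show "S' (basis_vec w) v = S (basis_vec w) v"
      using vw by (simp add: l2_inner_basis)
  qed (use S' assms in \<open>auto simp: is_adj_def\<close>)
qed (use assms in \<open>auto simp: is_adj_def\<close>)

lemma is_adj_comp: "is_adj I T S \<Longrightarrow> is_adj I T' S' \<Longrightarrow> is_adj I (T \<circ> T') (S' \<circ> S)"
  unfolding is_adj_def by (simp add: bounded_op_comp bounded_opD(1))

lemma is_adj_id: "is_adj I (op_id I) (op_id I)"
  using bounded_op_id by (auto simp: is_adj_def op_id_def)

lemma is_adj_add:
  assumes "is_adj I T S" "is_adj I T' S'"
  shows "is_adj I (op_add T T') (op_add S S')"
proof -
  have *: "l2_inner I (op_add A B \<xi>) \<eta> = l2_inner I (A \<xi>) \<eta> + l2_inner I (B \<xi>) \<eta>"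
    if "bounded_op I A" "bounded_op I B" "\<xi> \<in> l2 I" "\<eta> \<in> l2 I" for A B \<xi> \<eta>
    using l2_inner_comb[of "A \<xi>" I "B \<xi>" \<eta> 1 1] that by (simp add: op_add_def bounded_opD(1))
  have "l2_inner I \<xi> (op_add S S' \<eta>) = l2_inner I \<xi> (S \<eta>) + l2_inner I \<xi> (S' \<eta>)"
    if "\<xi> \<in> l2 I" "\<eta> \<in> l2 I" for \<xi> \<eta>
    using *[of S S' \<eta> \<xi>] that assms by (metis is_adj_def l2_inner_swap complex_cnj_add)
  with * assms show ?thesis by (simp add: is_adj_def bounded_op_add)
qed

lemma is_adj_scale:
  assumes "is_adj I T S"
  shows "is_adj I (op_scale c T) (op_scale (cnj c) S)"
proof -
  have *: "l2_inner I (op_scale c A \<xi>) \<eta> = c * l2_inner I (A \<xi>) \<eta>"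
    if "bounded_op I A" "\<xi> \<in> l2 I" "\<eta> \<in> l2 I" for A \<xi> \<eta> c
    using l2_inner_comb[of "A \<xi>" I "A \<xi>" \<eta> c 0] that by (simp add: op_scale_def bounded_opD(1))
  have "l2_inner I \<xi> (op_scale (cnj c) S \<eta>) = c * l2_inner I \<xi> (S \<eta>)"
    if "\<xi> \<in> l2 I" "\<eta> \<in> l2 I" for \<xi> \<eta>
    using *[of S \<eta> \<xi> "cnj c"] that assms
    by (metis is_adj_def l2_inner_swap complex_cnj_mult complex_cnj_cnj)
  with * assms show ?thesis by (simp add: is_adj_def bounded_op_scale)
qed


section \<open>Matrices satisfying Schur's condition\<close>

definition schur_bound :: "'i set \<Rightarrow> ('i \<Rightarrow> 'i \<Rightarrow> complex) \<Rightarrow> real \<Rightarrow> bool" where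
  "schur_bound I K M \<longleftrightarrow>
     (\<forall>v\<in>I. ((\<lambda>w. cmod (K v w)) summable_on I) \<and> (\<Sum>\<^sub>\<infinity>w\<in>I. cmod (K v w)) \<le> M) \<and>
     (\<forall>w\<in>I. ((\<lambda>v. cmod (K v w)) summable_on I) \<and> (\<Sum>\<^sub>\<infinity>v\<in>I. cmod (K v w)) \<le> M)"

definition schur :: "'i set \<Rightarrow> ('i \<Rightarrow> 'i \<Rightarrow> complex) \<Rightarrow> bool" where
  "schur I K \<longleftrightarrow> (\<exists>M. schur_bound I K M)"

definition mat_op :: "'i set \<Rightarrow> ('i \<Rightarrow> 'i \<Rightarrow> complex) \<Rightarrow> 'i opr" where
  "mat_op I K \<xi> = (if \<xi> \<in> l2 I then (\<lambda>v. if v \<in> I then (\<Sum>\<^sub>\<infinity>w\<in>I. K v w * \<xi> w) else 0) else (\<lambda>v. 0))"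

lemma schur_transpose: "schur I K \<Longrightarrow> schur I (\<lambda>v w. cnj (K w v))"
  unfolding schur_def schur_bound_def by auto

lemma schurE:
  assumes "schur I K"
  obtains M where "M > 0" "schur_bound I K M"
proof -
  obtain M where M: "schur_bound I K M" using assms schur_def by blast
  then have "schur_bound I K (\<bar>M\<bar> + 1)" unfolding schur_bound_def by force
  then show ?thesis using that[of "\<bar>M\<bar> + 1"] by simp
qed

lemma schur_boundD:
  assumes "schur_bound I K M"
  shows "v \<in> I \<Longrightarrow> (\<lambda>w. cmod (K v w)) summable_on I" "v \<in> I \<Longrightarrow> (\<Sum>\<^sub>\<infinity>w\<in>I. cmod (K v w)) \<le> M"
    and "w \<in> I \<Longrightarrow> (\<lambda>v. cmod (K v w)) summable_on I" "w \<in> I \<Longrightarrow> (\<Sum>\<^sub>\<infinity>v\<in>I. cmod (K v w)) \<le> M"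
  using assms by (auto simp: schur_bound_def)

lemma schur_row_summable:
  assumes "schur I K" "\<xi> \<in> l2 I" "v \<in> I"
  shows "(\<lambda>w. cmod (K v w) * (cmod (\<xi> w))\<^sup>2) summable_on I"
proof -
  obtain M where M0: "M > 0" and MB: "schur_bound I K M"
    by (rule schurE[OF assms(1)])
  note M = M0 schur_boundD[OF MB]
  have "(\<lambda>w. (l2_norm I \<xi>)\<^sup>2 * cmod (K v w)) summable_on I"
    by (intro summable_on_cmult_right M assms)
  then show ?thesis
  proof (rule summable_on_comparison_test)
    fix w
    have "(cmod (\<xi> w))\<^sup>2 \<le> (l2_norm I \<xi>)\<^sup>2"
      by (intro power_mono cmod_le_l2_norm assms) auto
    then show "cmod (K v w) * (cmod (\<xi> w))\<^sup>2 \<le> (l2_norm I \<xi>)\<^sup>2 * cmod (K v w)"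
      by (subst mult.commute) (auto intro: mult_right_mono)
  qed auto
qed

lemma schur_row_abs_summable:
  assumes "schur I K" "\<xi> \<in> l2 I" "v \<in> I"
  shows "(\<lambda>w. cmod (K v w * \<xi> w)) summable_on I"
proof -
  obtain M where M0: "M > 0" and MB: "schur_bound I K M"
    by (rule schurE[OF assms(1)])
  note M = M0 schur_boundD[OF MB]
  have "(\<lambda>w. cmod (K v w) * l2_norm I \<xi>) summable_on I"
    by (intro summable_on_cmult_left M assms)
  then show ?thesis
    by (rule summable_on_comparison_test)
      (auto simp: norm_mult intro!: mult_left_mono cmod_le_l2_norm assms)
qed

text \<open>Summing over \<open>v\<close> first leaves column sums, at most \<open>M\<close>, as
  weights on \<open>(cmod (\<xi> w))\<^sup>2\<close>. The second claim ranges over all vectors so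
  that \<open>bounded_mat_op\<close> obtains a single constant.\<close>

lemma schur_col_summable:
  assumes "schur I K" "\<xi> \<in> l2 I"
  shows "(\<lambda>(w, v). cmod (K v w) * (cmod (\<xi> w))\<^sup>2) summable_on I \<times> I"
    and "\<exists>M. (\<forall>\<xi>\<in>l2 I. (\<Sum>\<^sub>\<infinity>(w, v)\<in>I \<times> I. cmod (K v w) * (cmod (\<xi> w))\<^sup>2) \<le> M * (l2_norm I \<xi>)\<^sup>2)"
proof -
  obtain M where M0: "M > 0" and MB: "schur_bound I K M"
    by (rule schurE[OF assms(1)])
  note M = M0 schur_boundD[OF MB]
  have bd: "(\<Sum>\<^sub>\<infinity>v\<in>I. cmod (K v w)) * (cmod (\<xi> w))\<^sup>2 \<le> M * (cmod (\<xi> w))\<^sup>2" if "w \<in> I" for w \<xi>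
    by (intro mult_right_mono M that) auto
  have g: "(\<lambda>w. (\<Sum>\<^sub>\<infinity>v\<in>I. cmod (K v w)) * (cmod (\<xi> w))\<^sup>2) summable_on I" if "\<xi> \<in> l2 I" for \<xi>
    by (rule summable_on_comparison_test[OF summable_on_cmult_right[OF l2D(2)[OF that], of M]])
      (auto intro!: mult_nonneg_nonneg infsum_nonneg bd)
  have hs: "((\<lambda>v. cmod (K v w) * (cmod (\<xi> w))\<^sup>2) has_sum (\<Sum>\<^sub>\<infinity>v\<in>I. cmod (K v w)) * (cmod (\<xi> w))\<^sup>2) I"
    if "w \<in> I" for w \<xi>
    by (intro has_sum_cmult_left has_sum_infsum M that)
  have sm: "(\<lambda>(w, v). cmod (K v w) * (cmod (\<xi> w))\<^sup>2) summable_on I \<times> I" if "\<xi> \<in> l2 I" for \<xi>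
    by (rule summable_on_SigmaI[OF _ g[OF that]]) (use hs in auto)
  show "(\<lambda>(w, v). cmod (K v w) * (cmod (\<xi> w))\<^sup>2) summable_on I \<times> I" by (rule sm[OF assms(2)])
  have "(\<Sum>\<^sub>\<infinity>(w, v)\<in>I \<times> I. cmod (K v w) * (cmod (\<xi> w))\<^sup>2) \<le> M * (l2_norm I \<xi>)\<^sup>2"
    if "\<xi> \<in> l2 I" for \<xi>
  proof -
    have "(\<Sum>\<^sub>\<infinity>(w, v)\<in>I \<times> I. cmod (K v w) * (cmod (\<xi> w))\<^sup>2) =
      (\<Sum>\<^sub>\<infinity>w\<in>I. \<Sum>\<^sub>\<infinity>v\<in>I. cmod (K v w) * (cmod (\<xi> w))\<^sup>2)"
      by (rule infsum_Sigma'_banach[symmetric, OF sm[OF that]])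
    also have "\<dots> = (\<Sum>\<^sub>\<infinity>w\<in>I. (\<Sum>\<^sub>\<infinity>v\<in>I. cmod (K v w)) * (cmod (\<xi> w))\<^sup>2)"
      by (intro infsum_cong infsumI hs)
    also have "\<dots> \<le> (\<Sum>\<^sub>\<infinity>w\<in>I. M * (cmod (\<xi> w))\<^sup>2)"
      by (intro infsum_mono g bd summable_on_cmult_right l2D that)
    also have "\<dots> = M * (l2_norm I \<xi>)\<^sup>2" by (simp add: infsum_cmult_right l2D that l2_norm_sq)
    finally show ?thesis .
  qed
  then show "\<exists>M. (\<forall>\<xi>\<in>l2 I. (\<Sum>\<^sub>\<infinity>(w, v)\<in>I \<times> I. cmod (K v w) * (cmod (\<xi> w))\<^sup>2) \<le> M * (l2_norm I \<xi>)\<^sup>2)"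
    by blast
qed

text \<open>Cauchy-Schwarz for the row weights \<open>cmod (K v w)\<close>, whose total mass is at
  most \<open>M\<close>; derived from the arithmetic-geometric mean inequality with a free
  parameter.\<close>

lemma schur_pointwise:
  assumes "M > 0" "(\<lambda>w. cmod (K v w)) summable_on I" "(\<Sum>\<^sub>\<infinity>w\<in>I. cmod (K v w)) \<le> M"
    "schur I K" "\<xi> \<in> l2 I" "v \<in> I"
  shows "(cmod (\<Sum>\<^sub>\<infinity>w\<in>I. K v w * \<xi> w))\<^sup>2 \<le> M * (\<Sum>\<^sub>\<infinity>w\<in>I. cmod (K v w) * (cmod (\<xi> w))\<^sup>2)"
proof -
  define s where "s = (\<Sum>\<^sub>\<infinity>w\<in>I. cmod (K v w * \<xi> w))"
  define h where "h = (\<Sum>\<^sub>\<infinity>w\<in>I. cmod (K v w) * (cmod (\<xi> w))\<^sup>2)"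
  have s0: "s \<ge> 0" unfolding s_def by (auto intro: infsum_nonneg)
  have h0: "h \<ge> 0" unfolding h_def by (auto intro: infsum_nonneg)
  note hsum = schur_row_summable[OF assms(4-6)]
  have "s\<^sup>2 \<le> M * h"
  proof (cases "s = 0")
    case False
    \<comment> \<open>With this value the averaged bound reads
      \<open>s \<le> s/2 + M * h / (2 * s)\<close>, which rearranges to the claim without extracting
      a root of \<open>h\<close>.\<close>
    define t where "t = s / M"
    have t: "t > 0" using False s0 assms(1) by (simp add: t_def)
    \<comment> \<open>\<open>2 |K| |\<xi>| \<le> |K| (t + |\<xi>|\<^sup>2 / t)\<close>, summed and then optimised in \<open>t\<close>\<close>
    have "s \<le> (\<Sum>\<^sub>\<infinity>w\<in>I. (t/2) * cmod (K v w) + (1/(2*t)) * (cmod (K v w) * (cmod (\<xi> w))\<^sup>2))"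
      unfolding s_def
    proof (rule infsum_mono)
      show "(\<lambda>w. cmod (K v w * \<xi> w)) summable_on I" by (rule schur_row_abs_summable[OF assms(4-6)])
      show "(\<lambda>w. (t/2) * cmod (K v w) + (1/(2*t)) * (cmod (K v w) * (cmod (\<xi> w))\<^sup>2)) summable_on I"
        by (rule summable_on_add[OF summable_on_cmult_right[OF assms(2)] summable_on_cmult_right[OF hsum]])
      fix w
      have "2 * t * cmod (\<xi> w) \<le> t\<^sup>2 + (cmod (\<xi> w))\<^sup>2" by (rule sum_squares_bound)
      then have "cmod (\<xi> w) \<le> t/2 + (1/(2*t)) * (cmod (\<xi> w))\<^sup>2"
        using t by (simp add: field_simps power2_eq_square)
      then have "cmod (K v w) * cmod (\<xi> w) \<le> cmod (K v w) * (t/2 + (1/(2*t)) * (cmod (\<xi> w))\<^sup>2)"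
        by (intro mult_left_mono) auto
      then show "cmod (K v w * \<xi> w) \<le> (t/2) * cmod (K v w) + (1/(2*t)) * (cmod (K v w) * (cmod (\<xi> w))\<^sup>2)"
        by (simp add: norm_mult algebra_simps)
    qed
    also have "\<dots> = (t/2) * (\<Sum>\<^sub>\<infinity>w\<in>I. cmod (K v w)) + (1/(2*t)) * h"
      unfolding h_def
      using infsum_add[OF summable_on_cmult_right[OF assms(2), of "t/2"] summable_on_cmult_right[OF hsum, of "1/(2*t)"]]
      by (simp only: infsum_cmult_right hsum assms)
    also have "\<dots> \<le> (t/2) * M + (1/(2*t)) * h"
      using t assms(3) by (intro add_right_mono mult_left_mono) auto
    finally have "s \<le> s/2 + M * h / (2 * s)" using assms(1) by (simp add: t_def)
    then have "s * s \<le> (s/2 + M * h / (2 * s)) * s" using s0 by (rule mult_right_mono)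
    also have "\<dots> = s * s / 2 + M * h / 2" using False by (simp add: field_simps)
    finally show ?thesis by (simp add: power2_eq_square)
  qed (use assms(1) h0 in simp)
  moreover have "cmod (\<Sum>\<^sub>\<infinity>w\<in>I. K v w * \<xi> w) \<le> s"
    unfolding s_def by (rule norm_infsum_bound[OF schur_row_abs_summable[OF assms(4-6)]])
  ultimately show ?thesis
    unfolding h_def using power_mono[of "cmod (\<Sum>\<^sub>\<infinity>w\<in>I. K v w * \<xi> w)" s 2] by fastforce
qed

text \<open>Schur's test. The row bound \<open>M\<close> enters pointwise; after the two summations
  are interchanged, the column constant \<open>M'\<close> controls what is left.\<close>

lemma bounded_mat_op:
  assumes K: "schur I K"
  shows "bounded_op I (mat_op I K)"
proof -
  obtain M where M0: "M > 0" and MB: "schur_bound I K M"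
    by (rule schurE[OF K])
  note M = M0 schur_boundD[OF MB]
  obtain M' where M': "\<forall>\<xi>\<in>l2 I. (\<Sum>\<^sub>\<infinity>(w, v)\<in>I \<times> I. cmod (K v w) * (cmod (\<xi> w))\<^sup>2) \<le> M' * (l2_norm I \<xi>)\<^sup>2"
    using schur_col_summable(2)[OF K l2_zero] by blast
  have main: "(\<lambda>v. (cmod (mat_op I K \<xi> v))\<^sup>2) summable_on I \<and>
    (l2_norm I (mat_op I K \<xi>))\<^sup>2 \<le> M * M' * (l2_norm I \<xi>)\<^sup>2" if \<xi>: "\<xi> \<in> l2 I" for \<xi>
  proof -
    let ?h = "\<lambda>v. \<Sum>\<^sub>\<infinity>w\<in>I. cmod (K v w) * (cmod (\<xi> w))\<^sup>2"
    have bd: "(cmod (mat_op I K \<xi> v))\<^sup>2 \<le> M * ?h v" if "v \<in> I" for v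
      using schur_pointwise[OF M(1) M(2)[OF that] M(3)[OF that] K \<xi> that] \<xi> that
      by (simp add: mat_op_def)
    have d: "(\<lambda>(v, w). cmod (K v w) * (cmod (\<xi> w))\<^sup>2) summable_on I \<times> I"
      using schur_col_summable(1)[OF K \<xi>] by (subst summable_on_swap) (simp add: case_prod_unfold)
    have hs: "?h summable_on I" by (rule summable_on_Sigma_banach[OF d])
    have sm: "(\<lambda>v. (cmod (mat_op I K \<xi> v))\<^sup>2) summable_on I"
      by (rule summable_on_comparison_test[OF summable_on_cmult_right[OF hs] bd]) auto
    have "(l2_norm I (mat_op I K \<xi>))\<^sup>2 \<le> (\<Sum>\<^sub>\<infinity>v\<in>I. M * ?h v)"
      unfolding l2_norm_sq by (intro infsum_mono sm bd summable_on_cmult_right hs)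
    also have "\<dots> = M * (\<Sum>\<^sub>\<infinity>v\<in>I. ?h v)" by (simp add: infsum_cmult_right hs)
    also have "(\<Sum>\<^sub>\<infinity>v\<in>I. ?h v) = (\<Sum>\<^sub>\<infinity>w\<in>I. \<Sum>\<^sub>\<infinity>v\<in>I. cmod (K v w) * (cmod (\<xi> w))\<^sup>2)"
      by (rule infsum_swap_banach[OF d])
    also have "\<dots> = (\<Sum>\<^sub>\<infinity>(w, v)\<in>I \<times> I. cmod (K v w) * (cmod (\<xi> w))\<^sup>2)"
      by (rule infsum_Sigma'_banach[OF schur_col_summable(1)[OF K \<xi>]])
    also have "M * \<dots> \<le> M * (M' * (l2_norm I \<xi>)\<^sup>2)"
      using M' \<xi> M(1) by (intro mult_left_mono) auto
    finally show ?thesis using sm by (simp add: mult.assoc)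
  qed
  show ?thesis
  proof (rule bounded_opI[where C = "M * M'"])
    fix \<xi> assume "\<xi> \<in> l2 I"
    then show "mat_op I K \<xi> \<in> l2 I" using main[of \<xi>] by (auto simp: l2_def mat_op_def)
  next
    fix \<xi> \<eta> a b assume \<xi>: "\<xi> \<in> l2 I" and \<eta>: "\<eta> \<in> l2 I"
    show "mat_op I K (\<lambda>v. a * \<xi> v + b * \<eta> v) = (\<lambda>v. a * mat_op I K \<xi> v + b * mat_op I K \<eta> v)"
    proof (rule ext)
      fix v
      have "(\<Sum>\<^sub>\<infinity>w\<in>I. K v w * (a * \<xi> w + b * \<eta> w)) = a * (\<Sum>\<^sub>\<infinity>w\<in>I. K v w * \<xi> w) + b * (\<Sum>\<^sub>\<infinity>w\<in>I. K v w * \<eta> w)"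
        if v: "v \<in> I"
      proof -
        note s = abs_summable_summable[OF schur_row_abs_summable[OF K _ v]]
        have "(\<Sum>\<^sub>\<infinity>w\<in>I. K v w * (a * \<xi> w + b * \<eta> w)) = (\<Sum>\<^sub>\<infinity>w\<in>I. a * (K v w * \<xi> w) + b * (K v w * \<eta> w))"
          by (simp add: algebra_simps)
        also have "\<dots> = a * (\<Sum>\<^sub>\<infinity>w\<in>I. K v w * \<xi> w) + b * (\<Sum>\<^sub>\<infinity>w\<in>I. K v w * \<eta> w)"
          using s[OF \<xi>] s[OF \<eta>] by (simp add: infsum_add summable_on_cmult_right infsum_cmult_right)
        finally show ?thesis .
      qed
      then show "mat_op I K (\<lambda>v. a * \<xi> v + b * \<eta> v) v = a * mat_op I K \<xi> v + b * mat_op I K \<eta> v"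
        using \<xi> \<eta> l2_comb[OF \<xi> \<eta>] by (simp add: mat_op_def)
    qed
  qed (use main in \<open>auto simp: mat_op_def\<close>)
qed

lemma mat_op_basis: "v \<in> I \<Longrightarrow> w \<in> I \<Longrightarrow> mat_op I K (basis_vec w) v = K v w"
proof -
  assume v: "v \<in> I" and w: "w \<in> I"
  have "(\<Sum>\<^sub>\<infinity>u\<in>I. K v u * basis_vec w u) = (\<Sum>\<^sub>\<infinity>u\<in>{w}. K v u * basis_vec w u)"
    by (rule infsum_cong_neutral) (use w in \<open>auto simp: basis_vec_def\<close>)
  then show ?thesis using v w by (simp add: mat_op_def) (simp add: basis_vec_def)
qed

lemma mat_op_comp_basis:
  assumes "bounded_op I T" "v \<in> I" "w \<in> I"
  shows "(mat_op I K \<circ> T) (basis_vec w) v = (\<Sum>\<^sub>\<infinity>u\<in>I. K v u * T (basis_vec w) u)"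
  unfolding o_apply mat_op_def using assms(2) bounded_opD(1)[OF assms(1) l2_basis[OF assms(3)]] by (simp only: if_True)

text \<open>Only the interchange of the two summations needs an argument:
  \<open>cmod (\<xi> w) * cmod (\<eta> v)\<close> is at most the sum of the two squares, which
  splits the double family into one summable by the column bound and one summable by the row
  bound.\<close>

lemma is_adj_mat_op:
  assumes K: "schur I K"
  shows "is_adj I (mat_op I K) (mat_op I (\<lambda>v w. cnj (K w v)))"
proof -
  have "l2_inner I (mat_op I K \<xi>) \<eta> = l2_inner I \<xi> (mat_op I (\<lambda>v w. cnj (K w v)) \<eta>)"
    if \<xi>: "\<xi> \<in> l2 I" and \<eta>: "\<eta> \<in> l2 I" for \<xi> \<eta>
  proof -
    have d1: "(\<lambda>(v, w). cmod (K v w) * (cmod (\<xi> w))\<^sup>2) summable_on I \<times> I"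
      using schur_col_summable(1)[OF K \<xi>] by (subst summable_on_swap) (simp add: case_prod_unfold)
    have d2: "(\<lambda>(v, w). cmod (K v w) * (cmod (\<eta> v))\<^sup>2) summable_on I \<times> I"
      using schur_col_summable(1)[OF schur_transpose[OF K] \<eta>] by simp
    have "(\<lambda>p. (\<lambda>(v, w). cmod (K v w) * (cmod (\<xi> w))\<^sup>2) p + (\<lambda>(v, w). cmod (K v w) * (cmod (\<eta> v))\<^sup>2) p)
        summable_on I \<times> I"
      by (rule summable_on_add[OF d1 d2])
    then have "(\<lambda>p. norm ((\<lambda>(v, w). K v w * \<xi> w * cnj (\<eta> v)) p)) summable_on I \<times> I"
    proof (rule summable_on_comparison_test, goal_cases)
      case (1 p)
      obtain v w where p: "p = (v, w)" by (cases p)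
      have "cmod (\<xi> w) * cmod (\<eta> v) \<le> (cmod (\<xi> w))\<^sup>2 + (cmod (\<eta> v))\<^sup>2"
        by (rule cmod_mult_le)
      then have "cmod (K v w) * (cmod (\<xi> w) * cmod (\<eta> v)) \<le> cmod (K v w) * ((cmod (\<xi> w))\<^sup>2 + (cmod (\<eta> v))\<^sup>2)"
        by (intro mult_left_mono) auto
      then show ?case by (simp add: p norm_mult algebra_simps)
    qed auto
    then have s: "(\<lambda>(v, w). K v w * \<xi> w * cnj (\<eta> v)) summable_on I \<times> I"
      by (rule abs_summable_summable)
    have "l2_inner I (mat_op I K \<xi>) \<eta> = (\<Sum>\<^sub>\<infinity>v\<in>I. \<Sum>\<^sub>\<infinity>w\<in>I. K v w * \<xi> w * cnj (\<eta> v))"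
      unfolding l2_inner_def using \<xi>
      by (intro infsum_cong) (simp add: mat_op_def infsum_cmult_left' )
    also have "\<dots> = (\<Sum>\<^sub>\<infinity>w\<in>I. \<Sum>\<^sub>\<infinity>v\<in>I. K v w * \<xi> w * cnj (\<eta> v))"
      by (rule infsum_swap_banach[OF s])
    also have "\<dots> = (\<Sum>\<^sub>\<infinity>w\<in>I. \<xi> w * (\<Sum>\<^sub>\<infinity>v\<in>I. K v w * cnj (\<eta> v)))"
      by (simp add: infsum_cmult_right' [symmetric] mult_ac)
    also have "\<dots> = l2_inner I \<xi> (mat_op I (\<lambda>v w. cnj (K w v)) \<eta>)"
      unfolding l2_inner_def using \<eta>
      by (intro infsum_cong) (simp add: mat_op_def infsum_cnj[symmetric])
    finally show ?thesis .
  qed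
  then show ?thesis
    unfolding is_adj_def by (simp add: bounded_mat_op K schur_transpose)
qed


section \<open>Weighted shifts\<close>

lemma summable_on_single:
  fixes f :: "'a \<Rightarrow> 'b::{comm_monoid_add,t2_space}"
  assumes "\<And>w. w \<in> I \<Longrightarrow> f w \<noteq> 0 \<Longrightarrow> w = a"
  shows "f summable_on I" "infsum f I = (if a \<in> I then f a else 0)"
proof -
  let ?A = "if a \<in> I then {a} else {}"
  have "f summable_on I \<longleftrightarrow> f summable_on ?A"
    by (rule summable_on_cong_neutral) (use assms in \<open>auto split: if_splits\<close>)
  then show "f summable_on I" by (simp split: if_splits)
  have "infsum f I = infsum f ?A"
    by (rule infsum_cong_neutral) (use assms in \<open>auto split: if_splits\<close>)
  then show "infsum f I = (if a \<in> I then f a else 0)" by simp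
qed

text \<open>The labels in \<open>I\<close> are parametrised by the points \<open>V\<close> of a lattice \<open>'p\<close>. A weighted shift moves the
  basis vector at \<open>p\<close> to the one at \<open>p + D\<close>, with weight \<open>c p\<close>; the weight vanishes unless both
  points are in \<open>V\<close>.\<close>

locale shift_lattice =
  fixes I :: "'i set" and V :: "'p::ab_group_add set" and e :: "'p \<Rightarrow> 'i"
  assumes bij: "bij_betw e V I"
begin

definition coord :: "'i \<Rightarrow> 'p" where "coord = inv_into V e"

definition weight :: "('p \<Rightarrow> real) \<Rightarrow> 'p \<Rightarrow> bool" where
  "weight c D \<longleftrightarrow> (\<forall>p. c p \<noteq> 0 \<longrightarrow> p \<in> V \<and> p + D \<in> V) \<and> (\<exists>K. \<forall>p. \<bar>c p\<bar> \<le> K)"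

text \<open>Values are read at the target point, so the formula covers all vectors at once. If
  \<open>p - D\<close> is not in \<open>V\<close>, the label \<open>e (p - D)\<close> is arbitrary,
  but its coefficient is then 0.\<close>

definition wshift :: "'i opr \<Rightarrow> ('p \<Rightarrow> real) \<Rightarrow> 'p \<Rightarrow> bool" where
  "wshift T c D \<longleftrightarrow> bounded_op I T \<and> weight c D \<and>
     (\<forall>\<xi>\<in>l2 I. \<forall>p\<in>V. T \<xi> (e p) = of_real (c (p - D)) * \<xi> (e (p - D)))"

definition shift_mat :: "('p \<Rightarrow> real) \<Rightarrow> 'p \<Rightarrow> 'i \<Rightarrow> 'i \<Rightarrow> complex" where
  "shift_mat c D v w = (if coord v = coord w + D then of_real (c (coord w)) else 0)"

lemma coord_e [simp]: "p \<in> V \<Longrightarrow> coord (e p) = p"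
  using bij by (simp add: coord_def bij_betw_def)

lemma e_coord [simp]: "v \<in> I \<Longrightarrow> e (coord v) = v"
  using bij by (simp add: coord_def bij_betw_def f_inv_into_f)

lemma e_in [simp]: "p \<in> V \<Longrightarrow> e p \<in> I"
  using bij by (auto simp: bij_betw_def)

lemma coord_in [simp]: "v \<in> I \<Longrightarrow> coord v \<in> V"
  using bij by (auto simp: coord_def bij_betw_def inv_into_into)

lemma e_inj: "p \<in> V \<Longrightarrow> p' \<in> V \<Longrightarrow> e p = e p' \<longleftrightarrow> p = p'"
  using coord_e by metis

lemma label_cases: assumes "v \<in> I" obtains p where "p \<in> V" "v = e p"
  using assms e_coord coord_in by metis

lemma wshiftD:
  assumes "wshift T c D"
  shows "bounded_op I T" "weight c D" "c p \<noteq> 0 \<Longrightarrow> p \<in> V" "c p \<noteq> 0 \<Longrightarrow> p + D \<in> V"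
    and "\<xi> \<in> l2 I \<Longrightarrow> q \<in> V \<Longrightarrow> T \<xi> (e q) = of_real (c (q - D)) * \<xi> (e (q - D))"
  using assms unfolding wshift_def weight_def by blast+

lemma weight_cnj_transpose: "weight c D \<Longrightarrow> weight (\<lambda>p. c (p - D)) (- D)"
  unfolding weight_def by (metis add.right_neutral add_diff_cancel_left' diff_add_cancel uminus_add_conv_diff add.commute)

lemma shift_mat_row:
  assumes "weight c D" "v \<in> I" "w \<in> I" "shift_mat c D v w \<noteq> 0"
  shows "w = e (coord v - D)"
proof -
  have "coord w = coord v - D" using assms(4) by (auto simp: shift_mat_def split: if_splits)
  then show ?thesis using e_coord[OF assms(3)] by simp
qed

lemma shift_mat_col:
  assumes "weight c D" "v \<in> I" "w \<in> I" "shift_mat c D v w \<noteq> 0"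
  shows "v = e (coord w + D)"
proof -
  have "coord v = coord w + D" using assms(4) by (auto simp: shift_mat_def split: if_splits)
  then show ?thesis using e_coord[OF assms(2)] by simp
qed

text \<open>Each row and each column has at most one nonzero entry, so a bound for the weights is
  itself a Schur bound.\<close>

lemma schur_shift_mat:
  assumes "weight c D"
  shows "schur I (shift_mat c D)"
proof -
  obtain K where K: "\<forall>p. \<bar>c p\<bar> \<le> K" using assms by (auto simp: weight_def)
  then have K0: "K \<ge> 0" using order_trans abs_ge_zero by blast
  have e: "cmod (shift_mat c D v w) \<le> K" for v w using K K0 by (simp add: shift_mat_def)
  have r: "w = e (coord v - D)" if "v \<in> I" "w \<in> I" "cmod (shift_mat c D v w) \<noteq> 0" for v w
    using shift_mat_row[OF assms that(1,2)] that(3) by auto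
  have cl: "v = e (coord w + D)" if "w \<in> I" "v \<in> I" "cmod (shift_mat c D v w) \<noteq> 0" for v w
    using shift_mat_col[OF assms that(2,1)] that(3) by auto
  have "schur_bound I (shift_mat c D) K"
    unfolding schur_bound_def
  proof (intro conjI ballI)
    fix v assume "v \<in> I"
    note s = summable_on_single[of I "\<lambda>w. cmod (shift_mat c D v w)", OF r[OF this]]
    show "(\<lambda>w. cmod (shift_mat c D v w)) summable_on I" "(\<Sum>\<^sub>\<infinity>w\<in>I. cmod (shift_mat c D v w)) \<le> K"
      using s e K0 by auto
  next
    fix w assume "w \<in> I"
    note s = summable_on_single[of I "\<lambda>v. cmod (shift_mat c D v w)", OF cl[OF this]]
    show "(\<lambda>v. cmod (shift_mat c D v w)) summable_on I" "(\<Sum>\<^sub>\<infinity>v\<in>I. cmod (shift_mat c D v w)) \<le> K"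
      using s e K0 by auto
  qed
  then show ?thesis unfolding schur_def by blast
qed

lemma wshift_mat_op:
  assumes "weight c D"
  shows "wshift (mat_op I (shift_mat c D)) c D"
proof -
  have "mat_op I (shift_mat c D) \<xi> (e p) = of_real (c (p - D)) * \<xi> (e (p - D))"
    if \<xi>: "\<xi> \<in> l2 I" and p: "p \<in> V" for \<xi> p
  proof -
    have "w = e (coord (e p) - D)" if "w \<in> I" "shift_mat c D (e p) w * \<xi> w \<noteq> 0" for w
      by (rule shift_mat_row[OF assms e_in[OF p] that(1)]) (use that in auto)
    from summable_on_single(2)[of I "\<lambda>w. shift_mat c D (e p) w * \<xi> w", OF this]
    have "mat_op I (shift_mat c D) \<xi> (e p) =
      (if e (p - D) \<in> I then shift_mat c D (e p) (e (p - D)) * \<xi> (e (p - D)) else 0)"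
      using \<xi> p by (simp add: mat_op_def)
    also have "\<dots> = of_real (c (p - D)) * \<xi> (e (p - D))"
    proof (cases "p - D \<in> V")
      case True
      then show ?thesis using p by (simp add: shift_mat_def)
    next
      case False
      then have "c (p - D) = 0" using assms by (auto simp: weight_def)
      \<comment> \<open>\<open>e\<close> is only known to be injective on \<open>V\<close> and may
        send an outside point into \<open>I\<close>, as \<open>nat\<close> sends negative integers
        to 0. The entry still vanishes, since the matrix compares coordinates and these lie in
        \<open>V\<close>.\<close>
      moreover have "shift_mat c D (e p) (e (p - D)) = 0" if "e (p - D) \<in> I"
      proof (rule ccontr)
        assume a: "\<not> ?thesis"
        then have "p = coord (e (p - D)) + D" using p by (auto simp: shift_mat_def split: if_splits)
        then have "p - D = coord (e (p - D))" by (metis add_diff_cancel_right')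
        then show False using coord_in[OF that] False by simp
      qed
      ultimately show ?thesis by simp
    qed
    finally show ?thesis .
  qed
  then show ?thesis
    unfolding wshift_def using assms bounded_mat_op[OF schur_shift_mat[OF assms]] by blast
qed

lemma wshift_unique:
  assumes "wshift S c D" "wshift T c D"
  shows "S = T"
proof (rule bounded_op_eqI[OF wshiftD(1)[OF assms(1)] wshiftD(1)[OF assms(2)]])
  fix v w assume "v \<in> I" "w \<in> I"
  obtain p where "p \<in> V" "v = e p" using label_cases[OF \<open>v \<in> I\<close>] by blast
  then show "S (basis_vec w) v = T (basis_vec w) v"
    using wshiftD(5)[OF assms(1) l2_basis[OF \<open>w \<in> I\<close>]] wshiftD(5)[OF assms(2) l2_basis[OF \<open>w \<in> I\<close>]]
    by simp
qed

lemma wshift_basis: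
  assumes T: "wshift T c D" and p: "p \<in> V"
  shows "T (basis_vec (e p)) = (\<lambda>v. of_real (c p) * basis_vec (e (p + D)) v)"
proof (rule ext)
  fix v
  show "T (basis_vec (e p)) v = of_real (c p) * basis_vec (e (p + D)) v"
  proof (cases "v \<in> I")
    case True
    then obtain q where q: "q \<in> V" "v = e q" by (rule label_cases)
    have *: "T (basis_vec (e p)) v = of_real (c (q - D)) * basis_vec (e p) (e (q - D))"
      using wshiftD(5)[OF T l2_basis[OF e_in[OF p]] q(1)] q(2) by simp
    show ?thesis
    proof (cases "q = p + D")
      case True
      then show ?thesis using q * by (simp add: basis_vec_def)
    next
      case False
      then have "q - D \<noteq> p" by (metis diff_add_cancel)
      then have 1: "T (basis_vec (e p)) v = 0"
        using * wshiftD(3)[OF T, of "q - D"] e_inj[OF _ p] by (auto simp: basis_vec_def)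
      have "of_real (c p) * basis_vec (e (p + D)) v = (0::complex)"
        using wshiftD(4)[OF T, of p] e_inj[OF q(1)] q(2) False by (auto simp: basis_vec_def)
      then show ?thesis using 1 by simp
    qed
  next
    case False
    then have "T (basis_vec (e p)) v = 0"
      using l2D(1)[OF bounded_opD(1)[OF wshiftD(1)[OF T] l2_basis[OF e_in[OF p]]]] by blast
    moreover have "v \<noteq> e (p + D)" if "c p \<noteq> 0" using wshiftD(4)[OF T that] False by auto
    ultimately show ?thesis by (auto simp: basis_vec_def)
  qed
qed

text \<open>Discharges the definite description in \<open>op_of_basis\<close> for all concrete
  operators: the shift matrix supplies a bounded operator with the prescribed values on the
  basis.\<close>

lemma wshift_op_of_basis:
  assumes "weight c D" "\<And>p. p \<in> V \<Longrightarrow> F (e p) = (\<lambda>v. of_real (c p) * basis_vec (e (p + D)) v)"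
  shows "wshift (op_of_basis I F) c D"
proof -
  note w = wshift_mat_op[OF assms(1)]
  have "mat_op I (shift_mat c D) (basis_vec v) = F v" if "v \<in> I" for v
    using label_cases[OF that] wshift_basis[OF w] assms(2) by metis
  then show ?thesis using op_of_basis_eq[OF wshiftD(1)[OF w]] w by simp
qed

lemma wshift_comp:
  assumes S: "wshift S c D" and T: "wshift T c' D'"
  shows "wshift (S \<circ> T) (\<lambda>p. c (p + D') * c' p) (D + D')"
proof -
  obtain K K' where K: "\<forall>p. \<bar>c p\<bar> \<le> K" "\<forall>p. \<bar>c' p\<bar> \<le> K'"
    using wshiftD(2)[OF S] wshiftD(2)[OF T] by (auto simp: weight_def)
  have "\<bar>c (p + D') * c' p\<bar> \<le> K * K'" for p
    unfolding abs_mult using K by (intro mult_mono) (auto intro: order_trans[OF abs_ge_zero])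
  moreover have "p \<in> V \<and> p + (D + D') \<in> V" if "c (p + D') * c' p \<noteq> 0" for p
    using wshiftD(4)[OF S, of "p + D'"] wshiftD(3)[OF T, of p] that by (auto simp: ac_simps)
  ultimately have w: "weight (\<lambda>p. c (p + D') * c' p) (D + D')" unfolding weight_def by blast
  have "(S \<circ> T) \<xi> (e p) = of_real (c (p - (D + D') + D') * c' (p - (D + D'))) * \<xi> (e (p - (D + D')))"
    if \<xi>: "\<xi> \<in> l2 I" and p: "p \<in> V" for \<xi> p
  proof -
    have "(S \<circ> T) \<xi> (e p) = of_real (c (p - D)) * T \<xi> (e (p - D))"
      using wshiftD(5)[OF S bounded_opD(1)[OF wshiftD(1)[OF T] \<xi>] p] by simp
    also have "\<dots> = of_real (c (p - D)) * (of_real (c' (p - D - D')) * \<xi> (e (p - D - D')))"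
      using wshiftD(3)[OF S, of "p - D"] wshiftD(5)[OF T \<xi>, of "p - D"] by auto
    finally show ?thesis by (simp add: algebra_simps)
  qed
  then show ?thesis
    unfolding wshift_def using bounded_op_comp[OF wshiftD(1)[OF S] wshiftD(1)[OF T]] w by blast
qed

text \<open>The weights are real, so the conjugate transpose of a shift matrix is again a shift
  matrix: its displacement is \<open>- D\<close>, and its weight at \<open>p\<close> is the old one
  at the point \<open>p - D\<close> to which the adjoint moves.\<close>

lemma wshift_adj:
  assumes T: "wshift T c D"
  obtains S where "is_adj I T S" "wshift S (\<lambda>p. c (p - D)) (- D)"
proof -
  have w: "weight c D" by (rule wshiftD(2)[OF T])
  have eq: "(\<lambda>v w. cnj (shift_mat c D w v)) = shift_mat (\<lambda>p. c (p - D)) (- D)"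
    by (intro ext) (auto simp: shift_mat_def)
  have "T = mat_op I (shift_mat c D)" by (rule wshift_unique[OF T wshift_mat_op[OF w]])
  then have "is_adj I T (mat_op I (shift_mat (\<lambda>p. c (p - D)) (- D)))"
    using is_adj_mat_op[OF schur_shift_mat[OF w]] eq by simp
  then show ?thesis
    using that wshift_mat_op[OF weight_cnj_transpose[OF w]] by blast
qed

lemma wshift_id: "wshift (op_id I) (\<lambda>p. if p \<in> V then 1 else 0) 0"
  using bounded_op_id unfolding wshift_def weight_def
  by (auto simp: op_id_def intro: exI[of _ 1])

end


section \<open>Smooth functions on the circle\<close>

abbreviation circle_deriv :: "(real \<Rightarrow> complex) \<Rightarrow> real \<Rightarrow> complex" where
  "circle_deriv f \<equiv> (\<lambda>\<theta>. vector_derivative f (at \<theta>))"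

lemma nth_deriv_0 [simp]: "nth_deriv 0 f = f"
  by (simp add: nth_deriv_def)

lemma nth_deriv_Suc: "nth_deriv (Suc k) f = circle_deriv (nth_deriv k f)"
  by (simp add: nth_deriv_def)

lemma nth_deriv_Suc': "nth_deriv (Suc k) f = nth_deriv k (circle_deriv f)"
  unfolding nth_deriv_def by (simp only: funpow_Suc_right o_apply)

lemma smooth_periodic: "f \<in> smooth_circle_set \<Longrightarrow> f (\<theta> + 2 * pi) = f \<theta>"
  by (simp add: smooth_circle_set_def)

lemma smooth_has_deriv:
  assumes "f \<in> smooth_circle_set"
  shows "(nth_deriv k f has_vector_derivative nth_deriv (Suc k) f \<theta>) (at \<theta>)"
  using assms unfolding nth_deriv_Suc smooth_circle_set_def
  by (simp add: vector_derivative_works[symmetric])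

lemma smooth_has_deriv0:
  "f \<in> smooth_circle_set \<Longrightarrow> (f has_vector_derivative circle_deriv f \<theta>) (at \<theta>)"
  using smooth_has_deriv[of f 0 \<theta>] by (simp add: nth_deriv_Suc)

lemma smooth_continuous: "f \<in> smooth_circle_set \<Longrightarrow> continuous_on S f"
  using smooth_has_deriv0
  by (intro continuous_at_imp_continuous_on ballI) (blast intro: has_vector_derivative_continuous)

lemma periodic_deriv:
  assumes "\<And>\<theta>. f (\<theta> + 2 * pi) = f \<theta>" "\<And>\<theta>. (f has_vector_derivative f' \<theta>) (at \<theta>)"
  shows "f' (\<theta> + 2 * pi) = f' \<theta>"
proof -
  have "((f \<circ> (\<lambda>x. x + 2 * pi)) has_vector_derivative (1 *\<^sub>R f' (\<theta> + 2 * pi))) (at \<theta>)"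
    by (rule vector_diff_chain_at) (auto intro!: derivative_eq_intros assms(2))
  moreover have "f \<circ> (\<lambda>x. x + 2 * pi) = f" using assms(1) by auto
  ultimately have "(f has_vector_derivative f' (\<theta> + 2 * pi)) (at \<theta>)" by simp
  then show ?thesis by (rule vector_derivative_unique_at[OF _ assms(2)])
qed

text \<open>Smoothness is an infinite conjunction over iterated derivatives, so it is proved
  coinductively: an invariant \<open>P\<close> stable under differentiation passes to every
  \<open>nth_deriv k f\<close>.\<close>

lemma smooth_coinduct:
  assumes "P f"
    and step: "\<And>g. P g \<Longrightarrow> (\<forall>\<theta>. g (\<theta> + 2 * pi) = g \<theta>) \<and>
      (\<exists>g'. (\<forall>\<theta>. (g has_vector_derivative g' \<theta>) (at \<theta>)) \<and> P g')"
  shows "f \<in> smooth_circle_set"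
proof -
  have D: "P (circle_deriv g) \<and> (\<forall>\<theta>. g differentiable (at \<theta>))" if "P g" for g
  proof -
    obtain g' where g': "\<forall>\<theta>. (g has_vector_derivative g' \<theta>) (at \<theta>)" "P g'"
      using step[OF \<open>P g\<close>] by blast
    then have "circle_deriv g = g'" by (auto intro: vector_derivative_at)
    then show ?thesis using g' by (blast intro: differentiableI_vector)
  qed
  have "P (nth_deriv k f)" for k
    by (induction k) (use assms(1) D in \<open>auto simp: nth_deriv_Suc\<close>)
  then show ?thesis using step[OF assms(1)] D unfolding smooth_circle_set_def by blast
qed

lemma smooth_deriv:
  assumes "f \<in> smooth_circle_set"
  shows "circle_deriv f \<in> smooth_circle_set"
proof -
  have "nth_deriv k (circle_deriv f) differentiable (at \<theta>)" for k \<theta>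
    using assms unfolding nth_deriv_Suc'[symmetric] smooth_circle_set_def by blast
  moreover have "circle_deriv f (\<theta> + 2 * pi) = circle_deriv f \<theta>" for \<theta>
    by (rule periodic_deriv[of f]) (use assms smooth_periodic smooth_has_deriv0 in blast)+
  ultimately show ?thesis unfolding smooth_circle_set_def by blast
qed

lemma smooth_nth_deriv: "f \<in> smooth_circle_set \<Longrightarrow> nth_deriv k f \<in> smooth_circle_set"
  by (induction k) (auto simp: nth_deriv_Suc smooth_deriv)

lemma smooth_add:
  assumes "f \<in> smooth_circle_set" "g \<in> smooth_circle_set"
  shows "(\<lambda>\<theta>. f \<theta> + g \<theta>) \<in> smooth_circle_set"
proof (rule smooth_coinduct[where P = "\<lambda>h. \<exists>f\<in>smooth_circle_set. \<exists>g\<in>smooth_circle_set. h = (\<lambda>\<theta>. f \<theta> + g \<theta>)"], goal_cases)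
  case (2 h)
  then obtain f g where fg: "f \<in> smooth_circle_set" "g \<in> smooth_circle_set" "h = (\<lambda>\<theta>. f \<theta> + g \<theta>)" by blast
  then show ?case
    by (auto simp: smooth_periodic intro!: exI[of _ "\<lambda>\<theta>. circle_deriv f \<theta> + circle_deriv g \<theta>"]
        has_vector_derivative_add smooth_has_deriv0 smooth_deriv bexI)
qed (use assms in blast)

text \<open>The coinduction invariant for products: by the Leibniz rule products alone are not
  closed under differentiation, sums of products are.\<close>

inductive product_sum :: "(real \<Rightarrow> complex) \<Rightarrow> bool" where
  mult: "f \<in> smooth_circle_set \<Longrightarrow> g \<in> smooth_circle_set \<Longrightarrow> product_sum (\<lambda>\<theta>. f \<theta> * g \<theta>)"
| add: "product_sum f \<Longrightarrow> product_sum g \<Longrightarrow> product_sum (\<lambda>\<theta>. f \<theta> + g \<theta>)"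

lemma smooth_mult:
  assumes "f \<in> smooth_circle_set" "g \<in> smooth_circle_set"
  shows "(\<lambda>\<theta>. f \<theta> * g \<theta>) \<in> smooth_circle_set"
proof (rule smooth_coinduct[where P = product_sum], goal_cases)
  case 1
  show ?case using assms by (rule product_sum.mult)
next
  case (2 h)
  then show ?case
  proof induction
    case (mult f g)
    have "((\<lambda>\<theta>. f \<theta> * g \<theta>) has_vector_derivative f \<theta> * circle_deriv g \<theta> + circle_deriv f \<theta> * g \<theta>) (at \<theta>)" for \<theta>
      by (rule has_vector_derivative_mult[OF smooth_has_deriv0[OF mult(1)] smooth_has_deriv0[OF mult(2)]])
    moreover have "product_sum (\<lambda>\<theta>. f \<theta> * circle_deriv g \<theta> + circle_deriv f \<theta> * g \<theta>)"
      by (rule product_sum.add[OF product_sum.mult product_sum.mult]) (use mult smooth_deriv in auto)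
    ultimately show ?case using smooth_periodic[OF mult(1)] smooth_periodic[OF mult(2)]
      by (intro conjI exI[of _ "\<lambda>\<theta>. f \<theta> * circle_deriv g \<theta> + circle_deriv f \<theta> * g \<theta>"]) auto
  next
    case (add f g)
    then obtain f' g' where "\<forall>\<theta>. (f has_vector_derivative f' \<theta>) (at \<theta>)" "product_sum f'"
      "\<forall>\<theta>. (g has_vector_derivative g' \<theta>) (at \<theta>)" "product_sum g'" by blast
    then have "\<forall>\<theta>. ((\<lambda>\<theta>. f \<theta> + g \<theta>) has_vector_derivative f' \<theta> + g' \<theta>) (at \<theta>)"
      "product_sum (\<lambda>\<theta>. f' \<theta> + g' \<theta>)"
      by (auto intro: has_vector_derivative_add product_sum.add)
    moreover have "f (\<theta> + 2 * pi) + g (\<theta> + 2 * pi) = f \<theta> + g \<theta>" for \<theta> using add by simp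
    ultimately show ?case by (intro conjI exI[of _ "\<lambda>\<theta>. f' \<theta> + g' \<theta>"]) auto
  qed
qed

lemma cis_int_has_deriv:
  "((\<lambda>\<theta>. c * cis (of_int n * \<theta>)) has_vector_derivative (c * \<i> * of_int n) * cis (of_int n * \<theta>)) (at \<theta>)"
proof -
  have "((\<lambda>z. c * exp (\<i> * (of_int n * z))) has_field_derivative
      (c * \<i> * of_int n) * exp (\<i> * (of_int n * of_real \<theta>))) (at (of_real \<theta>))"
    by (auto intro!: derivative_eq_intros simp: mult_ac)
  from has_vector_derivative_real_field[OF this]
  show ?thesis by (simp add: cis_conv_exp)
qed

lemma cis_int_periodic: "cis (of_int n * (\<theta> + 2 * pi)) = cis (of_int n * \<theta>)"
proof -
  have "cis (of_int n * (\<theta> + 2 * pi)) = cis (of_int n * \<theta>) * cis (2 * pi * of_int n)"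
    by (simp add: cis_mult algebra_simps)
  then show ?thesis by (simp add: cis_multiple_2pi)
qed

lemma smooth_cis: "(\<lambda>\<theta>. c * cis (of_int n * \<theta>)) \<in> smooth_circle_set"
proof (rule smooth_coinduct[where P = "\<lambda>h. \<exists>c. h = (\<lambda>\<theta>. c * cis (of_int n * \<theta>))"], goal_cases)
  case (2 h)
  then obtain c where h: "h = (\<lambda>\<theta>. c * cis (of_int n * \<theta>))" by blast
  show ?case unfolding h
    by (intro conjI exI[of _ "\<lambda>\<theta>. (c * \<i> * of_int n) * cis (of_int n * \<theta>)"] allI cis_int_has_deriv)
      (auto simp only: cis_int_periodic)
qed blast

lemma smooth_const: "(\<lambda>\<theta>. c) \<in> smooth_circle_set"
  using smooth_cis[of c 0] by simp

lemma smooth_scale: "f \<in> smooth_circle_set \<Longrightarrow> (\<lambda>\<theta>. c * f \<theta>) \<in> smooth_circle_set"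
  by (rule smooth_mult[OF smooth_const])

lemma smooth_cnj:
  assumes "f \<in> smooth_circle_set"
  shows "(\<lambda>\<theta>. cnj (f \<theta>)) \<in> smooth_circle_set"
proof (rule smooth_coinduct[where P = "\<lambda>h. \<exists>f\<in>smooth_circle_set. h = (\<lambda>\<theta>. cnj (f \<theta>))"], goal_cases)
  case (2 h)
  then obtain f where fg: "f \<in> smooth_circle_set" "h = (\<lambda>\<theta>. cnj (f \<theta>))" by blast
  then show ?case
    by (auto simp: smooth_periodic intro!: exI[of _ "\<lambda>\<theta>. cnj (circle_deriv f \<theta>)"]
        has_vector_derivative_cnj smooth_has_deriv0 smooth_deriv bexI)
qed (use assms in blast)

lemma circle_deriv_add:
  assumes "f \<in> smooth_circle_set" "g \<in> smooth_circle_set"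
  shows "circle_deriv (\<lambda>\<theta>. f \<theta> + g \<theta>) = (\<lambda>\<theta>. circle_deriv f \<theta> + circle_deriv g \<theta>)"
  by (rule ext, rule vector_derivative_at,
      rule has_vector_derivative_add[OF smooth_has_deriv0[OF assms(1)] smooth_has_deriv0[OF assms(2)]])

lemma circle_deriv_mult:
  assumes "f \<in> smooth_circle_set" "g \<in> smooth_circle_set"
  shows "circle_deriv (\<lambda>\<theta>. f \<theta> * g \<theta>) = (\<lambda>\<theta>. f \<theta> * circle_deriv g \<theta> + circle_deriv f \<theta> * g \<theta>)"
  by (rule ext, rule vector_derivative_at,
      rule has_vector_derivative_mult[OF smooth_has_deriv0[OF assms(1)] smooth_has_deriv0[OF assms(2)]])

lemma nth_deriv_add:
  assumes "f \<in> smooth_circle_set" "g \<in> smooth_circle_set"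
  shows "nth_deriv k (\<lambda>\<theta>. f \<theta> + g \<theta>) = (\<lambda>\<theta>. nth_deriv k f \<theta> + nth_deriv k g \<theta>)"
  using assms
  by (induction k arbitrary: f g) (simp_all add: nth_deriv_Suc' circle_deriv_add smooth_deriv)

lemma nth_deriv_scale:
  assumes "f \<in> smooth_circle_set"
  shows "nth_deriv k (\<lambda>\<theta>. c * f \<theta>) = (\<lambda>\<theta>. c * nth_deriv k f \<theta>)"
  using assms
proof (induction k arbitrary: f)
  case (Suc k)
  have "circle_deriv (\<lambda>\<theta>. c * f \<theta>) = (\<lambda>\<theta>. c * circle_deriv f \<theta>)"
    using circle_deriv_mult[OF smooth_const[of c] Suc.prems] by simp
  then show ?case using Suc by (simp add: nth_deriv_Suc' smooth_deriv)
qed simp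

lemma nth_deriv_cnj:
  assumes "f \<in> smooth_circle_set"
  shows "nth_deriv k (\<lambda>\<theta>. cnj (f \<theta>)) = (\<lambda>\<theta>. cnj (nth_deriv k f \<theta>))"
  using assms
proof (induction k arbitrary: f)
  case (Suc k)
  have "circle_deriv (\<lambda>\<theta>. cnj (f \<theta>)) = (\<lambda>\<theta>. cnj (circle_deriv f \<theta>))"
    by (rule ext, rule vector_derivative_at, rule has_vector_derivative_cnj[OF smooth_has_deriv0[OF Suc.prems]])
  then show ?case using Suc by (simp add: nth_deriv_Suc' smooth_deriv)
qed simp

lemma periodic_int:
  fixes f :: "real \<Rightarrow> 'a"
  assumes "\<And>\<theta>. f (\<theta> + 2 * pi) = f \<theta>"
  shows "f (\<theta> + 2 * pi * of_int n) = f \<theta>"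
proof (induction n rule: int_induct[where k = 0])
  case (step1 i)
  then show ?case using assms[of "\<theta> + 2 * pi * of_int i"] by (simp add: algebra_simps)
next
  case (step2 i)
  then show ?case using assms[of "\<theta> + 2 * pi * of_int (i - 1)"] by (simp add: algebra_simps)
qed simp

lemma periodic_reduce:
  fixes f :: "real \<Rightarrow> 'a"
  assumes "\<And>\<theta>. f (\<theta> + 2 * pi) = f \<theta>"
  obtains \<theta>' where "\<theta>' \<in> {0..2 * pi}" "f \<theta> = f \<theta>'"
proof
  define n where "n = \<lfloor>\<theta> / (2 * pi)\<rfloor>"
  have "of_int n \<le> \<theta> / (2 * pi)" "\<theta> / (2 * pi) < of_int n + 1" unfolding n_def by linarith+
  then have "of_int n * (2 * pi) \<le> \<theta>" "\<theta> < (of_int n + 1) * (2 * pi)"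
    by (simp_all add: le_divide_eq divide_less_eq)
  then show "\<theta> - 2 * pi * of_int n \<in> {0..2 * pi}" by (simp add: algebra_simps)
  show "f \<theta> = f (\<theta> - 2 * pi * of_int n)"
    using periodic_int[where f = f, OF assms, of "\<theta> - 2 * pi * of_int n" n] by simp
qed

text \<open>By periodicity the range is the image of one compact period. The bound makes the
  supremum in \<open>circle_seminorm\<close> a genuine one.\<close>

lemma smooth_bdd:
  assumes "f \<in> smooth_circle_set"
  shows "bdd_above (range (\<lambda>\<theta>. cmod (f \<theta>)))"
proof -
  have "compact (f ` {0..2 * pi})"
    by (intro compact_continuous_image smooth_continuous assms) simp
  then obtain B where B: "\<forall>z\<in>f ` {0..2 * pi}. cmod z \<le> B"
    using compact_imp_bounded bounded_iff by metis
  have "cmod (f \<theta>) \<le> B" for \<theta>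
  proof -
    obtain \<theta>' where "\<theta>' \<in> {0..2 * pi}" "f \<theta> = f \<theta>'"
      by (rule periodic_reduce[of f, OF smooth_periodic[OF assms]])
    then show ?thesis using B by auto
  qed
  then show ?thesis by (rule bdd_aboveI2)
qed

lemma le_circle_seminorm:
  assumes "f \<in> smooth_circle_set"
  shows "cmod (nth_deriv k f \<theta>) \<le> circle_seminorm k f"
  unfolding circle_seminorm_def
  by (rule cSUP_upper[OF UNIV_I smooth_bdd[OF smooth_nth_deriv[OF assms]]])

lemma circle_seminorm_le:
  assumes "\<And>\<theta>. cmod (nth_deriv k f \<theta>) \<le> B"
  shows "circle_seminorm k f \<le> B"
  unfolding circle_seminorm_def by (rule cSUP_least) (use assms in auto)

lemma circle_seminorm_nonneg: "f \<in> smooth_circle_set \<Longrightarrow> 0 \<le> circle_seminorm k f"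
  using order_trans[OF norm_ge_zero le_circle_seminorm] by blast

lemma circle_seminorm_deriv: "circle_seminorm k (circle_deriv f) = circle_seminorm (Suc k) f"
  by (simp add: circle_seminorm_def nth_deriv_Suc')

lemma circle_seminorm_add:
  assumes "f \<in> smooth_circle_set" "g \<in> smooth_circle_set"
  shows "circle_seminorm k (\<lambda>\<theta>. f \<theta> + g \<theta>) \<le> circle_seminorm k f + circle_seminorm k g"
  by (rule circle_seminorm_le)
    (auto simp: nth_deriv_add assms intro!: order_trans[OF norm_triangle_ineq] add_mono le_circle_seminorm)

lemma circle_seminorm_cnj:
  assumes "f \<in> smooth_circle_set"
  shows "circle_seminorm k (\<lambda>\<theta>. cnj (f \<theta>)) = circle_seminorm k f"
  by (simp add: circle_seminorm_def nth_deriv_cnj assms)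

text \<open>Each differentiation produces two products, hence the factor \<open>2 ^ k\<close>; the
  sums of seminorms up to order \<open>k\<close> absorb every distribution of derivatives over the
  factors.\<close>

lemma circle_seminorm_mult:
  assumes "f \<in> smooth_circle_set" "g \<in> smooth_circle_set"
  shows "circle_seminorm k (\<lambda>\<theta>. f \<theta> * g \<theta>) \<le>
    2 ^ k * (\<Sum>l\<le>k. circle_seminorm l f) * (\<Sum>l\<le>k. circle_seminorm l g)"
  using assms
proof (induction k arbitrary: f g)
  case 0
  show ?case
    by (rule circle_seminorm_le)
      (use le_circle_seminorm[OF 0(1), of 0] le_circle_seminorm[OF 0(2), of 0] 0
        in \<open>auto simp: norm_mult intro!: mult_mono circle_seminorm_nonneg\<close>)
next
  case (Suc k)
  let ?N = "\<lambda>k f. \<Sum>l\<le>k. circle_seminorm l f"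
  have n0: "0 \<le> ?N k h" if "h \<in> smooth_circle_set" for h k
    by (intro sum_nonneg circle_seminorm_nonneg that)
  have le: "?N k h \<le> ?N (Suc k) h" if "h \<in> smooth_circle_set" for h
    using circle_seminorm_nonneg[OF that] by simp
  have leD: "?N k (circle_deriv h) \<le> ?N (Suc k) h" if "h \<in> smooth_circle_set" for h
    using circle_seminorm_nonneg[OF that, of 0]
    by (simp add: circle_seminorm_deriv sum.atMost_Suc_shift del: sum.atMost_Suc)
  note sm = Suc.prems smooth_deriv[OF Suc.prems(1)] smooth_deriv[OF Suc.prems(2)]
  have "circle_seminorm (Suc k) (\<lambda>\<theta>. f \<theta> * g \<theta>) =
    circle_seminorm k (\<lambda>\<theta>. f \<theta> * circle_deriv g \<theta> + circle_deriv f \<theta> * g \<theta>)"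
    by (simp add: circle_seminorm_deriv[symmetric] circle_deriv_mult Suc.prems)
  also have "\<dots> \<le> circle_seminorm k (\<lambda>\<theta>. f \<theta> * circle_deriv g \<theta>) + circle_seminorm k (\<lambda>\<theta>. circle_deriv f \<theta> * g \<theta>)"
    by (intro circle_seminorm_add smooth_mult sm)
  also have "\<dots> \<le> 2 ^ k * ?N k f * ?N k (circle_deriv g) + 2 ^ k * ?N k (circle_deriv f) * ?N k g"
    by (intro add_mono Suc.IH sm)
  also have "\<dots> \<le> 2 ^ k * ?N (Suc k) f * ?N (Suc k) g + 2 ^ k * ?N (Suc k) f * ?N (Suc k) g"
    using sm by (intro add_mono mult_mono le leD n0 mult_nonneg_nonneg) auto
  finally show ?case by simp
qed


section \<open>Fourier coefficients\<close>

lemma fourier_integrable: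
  assumes "continuous_on {0..2 * pi} f"
  shows "(\<lambda>\<theta>. f \<theta> * cis (- (of_int k * \<theta>))) integrable_on {0..2 * pi}"
  by (intro integrable_continuous_real continuous_intros assms)

lemma fourier_coeff_add:
  assumes "continuous_on {0..2 * pi} f" "continuous_on {0..2 * pi} g"
  shows "fourier_coeff (\<lambda>\<theta>. f \<theta> + g \<theta>) k = fourier_coeff f k + fourier_coeff g k"
  unfolding fourier_coeff_def
  using integral_add[OF fourier_integrable[OF assms(1)] fourier_integrable[OF assms(2)]]
  by (simp add: algebra_simps add_divide_distrib)

lemma fourier_coeff_scale: "fourier_coeff (\<lambda>\<theta>. c * f \<theta>) k = c * fourier_coeff f k"
  by (simp add: fourier_coeff_def mult.assoc)

lemma fourier_coeff_cnj: "fourier_coeff (\<lambda>\<theta>. cnj (f \<theta>)) k = cnj (fourier_coeff f (- k))"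
proof -
  have "integral {0..2 * pi} (\<lambda>\<theta>. cnj (f \<theta>) * cis (- (of_int k * \<theta>))) =
    integral {0..2 * pi} (\<lambda>\<theta>. cnj (f \<theta> * cis (- (of_int (- k) * \<theta>))))"
    by (simp add: cis_cnj)
  then show ?thesis by (simp add: fourier_coeff_def integral_cnj)
qed

lemma fourier_coeff_bound:
  assumes "continuous_on {0..2 * pi} f" "\<And>\<theta>. \<theta> \<in> {0..2 * pi} \<Longrightarrow> cmod (f \<theta>) \<le> B"
  shows "cmod (fourier_coeff f k) \<le> B"
proof -
  have "cmod (integral {0..2 * pi} (\<lambda>\<theta>. f \<theta> * cis (- (of_int k * \<theta>)))) \<le> B * (2 * pi - 0)"
    by (rule integral_bound) (use assms in \<open>auto simp: norm_mult intro!: continuous_intros\<close>)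
  then show ?thesis
    by (simp add: fourier_coeff_def norm_mult norm_divide field_simps)
qed

text \<open>Integration by parts over one period; periodicity removes the boundary term.\<close>

lemma fourier_coeff_deriv:
  assumes "f \<in> smooth_circle_set"
  shows "fourier_coeff (circle_deriv f) k = \<i> * of_int k * fourier_coeff f k"
proof -
  let ?e = "\<lambda>\<theta>. cis (- (of_int k * \<theta>))"
  have e: "(?e has_vector_derivative (- \<i> * of_int k) * ?e \<theta>) (at \<theta>)" for \<theta>
    using cis_int_has_deriv[of 1 "- k" \<theta>] by simp
  have "((\<lambda>\<theta>. f \<theta> * ?e \<theta>) has_vector_derivative f \<theta> * ((- \<i> * of_int k) * ?e \<theta>) + circle_deriv f \<theta> * ?e \<theta>) (at \<theta>)" for \<theta>
    by (rule has_vector_derivative_mult[OF smooth_has_deriv0[OF assms] e])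
  then have "((\<lambda>\<theta>. f \<theta> * ((- \<i> * of_int k) * ?e \<theta>) + circle_deriv f \<theta> * ?e \<theta>) has_integral
      f (2 * pi) * ?e (2 * pi) - f 0 * ?e 0) {0..2 * pi}"
    by (intro fundamental_theorem_of_calculus) (auto intro: has_vector_derivative_at_within)
  moreover have "f (2 * pi) * ?e (2 * pi) = f 0 * ?e 0"
    using smooth_periodic[OF assms, of 0] cis_int_periodic[of "- k" 0] by simp
  ultimately have "integral {0..2 * pi} (\<lambda>\<theta>. (- \<i> * of_int k) * (f \<theta> * ?e \<theta>) + circle_deriv f \<theta> * ?e \<theta>) = 0"
    by (simp add: integral_unique mult_ac)
  moreover have "integral {0..2 * pi} (\<lambda>\<theta>. (- \<i> * of_int k) * (f \<theta> * ?e \<theta>) + circle_deriv f \<theta> * ?e \<theta>) =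
    (- \<i> * of_int k) * integral {0..2 * pi} (\<lambda>\<theta>. f \<theta> * ?e \<theta>) + integral {0..2 * pi} (\<lambda>\<theta>. circle_deriv f \<theta> * ?e \<theta>)"
    by (subst integral_add)
      (auto intro!: integrable_on_mult_right fourier_integrable smooth_continuous assms smooth_deriv
        simp only: integral_mult_right)
  ultimately show ?thesis by (simp add: fourier_coeff_def)
qed

lemma fourier_coeff_nth_deriv:
  assumes "f \<in> smooth_circle_set"
  shows "fourier_coeff (nth_deriv m f) k = (\<i> * of_int k) ^ m * fourier_coeff f k"
  by (induction m) (use assms in \<open>auto simp: nth_deriv_Suc fourier_coeff_deriv smooth_nth_deriv mult_ac\<close>)

text \<open>Up to a unimodular factor, \<open>\<bar>k\<bar> ^ m\<close> times the coefficient is a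
  coefficient of the \<open>m\<close>-th derivative. The constant comes from \<open>(1 +
  \<bar>k\<bar>) ^ m \<le> 2 ^ m * (1 + \<bar>k\<bar> ^ m)\<close>, where each of the two resulting
  terms is at most the sum of seminorms.\<close>

lemma fourier_coeff_decay:
  assumes f: "f \<in> smooth_circle_set"
  shows "(1 + real_of_int \<bar>k\<bar>) ^ m * cmod (fourier_coeff f k) \<le> 2 ^ Suc m * (\<Sum>l\<le>m. circle_seminorm l f)"
proof -
  let ?N = "\<Sum>l\<le>m. circle_seminorm l f"
  have le: "circle_seminorm l f \<le> ?N" if "l \<le> m" for l
    by (rule member_le_sum) (use that f circle_seminorm_nonneg in auto)
  have b: "cmod (fourier_coeff (nth_deriv l f) k) \<le> ?N" if "l \<le> m" for l
    by (rule order_trans[OF fourier_coeff_bound le[OF that]])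
      (use f in \<open>auto intro: smooth_continuous smooth_nth_deriv le_circle_seminorm\<close>)
  have p: "real_of_int \<bar>k\<bar> ^ m * cmod (fourier_coeff f k) \<le> ?N"
    using b[of m] by (simp add: fourier_coeff_nth_deriv f norm_mult norm_power)
  have "(1 + real_of_int \<bar>k\<bar>) ^ m \<le> 2 ^ m * (1 + real_of_int \<bar>k\<bar> ^ m)"
  proof (cases "k = 0")
    case False
    then have "(1 + real_of_int \<bar>k\<bar>) ^ m \<le> (2 * real_of_int \<bar>k\<bar>) ^ m" by (intro power_mono) auto
    also have "\<dots> \<le> 2 ^ m * (1 + real_of_int \<bar>k\<bar> ^ m)" by (simp add: power_mult_distrib)
    finally show ?thesis .
  qed (use mult_mono[of 1 "2 ^ m" 1 "1 + 0 ^ m :: real"] in auto)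
  then have "(1 + real_of_int \<bar>k\<bar>) ^ m * cmod (fourier_coeff f k) \<le>
      2 ^ m * (1 + real_of_int \<bar>k\<bar> ^ m) * cmod (fourier_coeff f k)"
    by (rule mult_right_mono) simp
  also have "\<dots> = 2 ^ m * (cmod (fourier_coeff f k) + real_of_int \<bar>k\<bar> ^ m * cmod (fourier_coeff f k))"
    by (simp add: algebra_simps)
  also have "\<dots> \<le> 2 ^ m * (?N + ?N)"
    using b[of 0] p by (intro mult_left_mono add_mono) auto
  finally show ?thesis by simp
qed


section \<open>Density of trigonometric polynomials and uniqueness of Fourier coefficients\<close>

inductive trig_poly :: "(real \<Rightarrow> complex) \<Rightarrow> bool" where
  monom: "trig_poly (\<lambda>\<theta>. c * cis (of_int n * \<theta>))"
| add: "trig_poly s \<Longrightarrow> trig_poly t \<Longrightarrow> trig_poly (\<lambda>\<theta>. s \<theta> + t \<theta>)"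

lemma trig_poly_const: "trig_poly (\<lambda>\<theta>. c)"
  using trig_poly.monom[of c 0] by simp

lemma trig_poly_monom_mult: "trig_poly t \<Longrightarrow> trig_poly (\<lambda>\<theta>. c * cis (of_int n * \<theta>) * t \<theta>)"
proof (induction rule: trig_poly.induct)
  case (monom d m)
  have "(\<lambda>\<theta>. c * cis (of_int n * \<theta>) * (d * cis (of_int m * \<theta>))) =
    (\<lambda>\<theta>. (c * d) * cis (of_int (n + m) * \<theta>))"
    by (simp add: fun_eq_iff cis_mult[symmetric] algebra_simps)
  then show ?case by (simp only: trig_poly.monom)
next
  case (add s t)
  then show ?case using trig_poly.add[OF add.IH] by (simp add: algebra_simps)
qed

lemma trig_poly_mult: "trig_poly s \<Longrightarrow> trig_poly t \<Longrightarrow> trig_poly (\<lambda>\<theta>. s \<theta> * t \<theta>)"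
proof (induction rule: trig_poly.induct)
  case (monom c n)
  then show ?case by (rule trig_poly_monom_mult)
next
  case (add s s')
  then show ?case using trig_poly.add[of "\<lambda>\<theta>. s \<theta> * t \<theta>" "\<lambda>\<theta>. s' \<theta> * t \<theta>"] by (simp add: algebra_simps)
qed

text \<open>Real polynomial functions on the plane are generated by constants and real-linear
  functionals. Such a functional restricted to the circle is a combination of cosine and sine, hence
  of \<open>cis \<theta>\<close> and \<open>cis (- \<theta>)\<close>.\<close>

lemma trig_poly_of_polynomial:
  assumes "real_polynomial_function (p :: complex \<Rightarrow> real)"
  shows "trig_poly (\<lambda>\<theta>. of_real (p (cis \<theta>)))"
  using assms
proof induction
  case (linear p)
  interpret bounded_linear p by fact
  have p: "of_real (p (cis \<theta>)) =
      (of_real (p 1) - \<i> * of_real (p \<i>)) / 2 * cis (of_int 1 * \<theta>) +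
      (of_real (p 1) + \<i> * of_real (p \<i>)) / 2 * cis (of_int (-1) * \<theta>)" for \<theta>
  proof -
    have "cis \<theta> = cos \<theta> *\<^sub>R 1 + sin \<theta> *\<^sub>R \<i>" by (simp add: complex_eq_iff)
    then have "p (cis \<theta>) = cos \<theta> * p 1 + sin \<theta> * p \<i>" by (simp add: add scaleR)
    then show ?thesis by (simp add: complex_eq_iff field_simps)
  qed
  show ?case unfolding p by (intro trig_poly.intros)
next
  case (const c)
  show ?case by (rule trig_poly_const)
next
  case (add f g)
  then show ?case using trig_poly.add[OF add.IH] by simp
next
  case (mult f g)
  then show ?case using trig_poly_mult[OF mult.IH] by simp
qed

lemma continuous_on_trig_poly: "trig_poly t \<Longrightarrow> continuous_on S t"
  by (induction rule: trig_poly.induct) (auto intro!: continuous_intros)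

lemma integral_trig_poly_0:
  assumes f: "continuous_on {0..2 * pi} f" "\<And>k. fourier_coeff f k = 0" and t: "trig_poly t"
  shows "integral {0..2 * pi} (\<lambda>\<theta>. f \<theta> * t \<theta>) = 0"
  using t
proof induction
  case (monom c n)
  have "integral {0..2 * pi} (\<lambda>\<theta>. f \<theta> * cis (of_int n * \<theta>)) = 0"
    using f(2)[of "- n"] by (simp add: fourier_coeff_def)
  moreover have "(\<lambda>\<theta>. f \<theta> * (c * cis (of_int n * \<theta>))) = (\<lambda>\<theta>. c * (f \<theta> * cis (of_int n * \<theta>)))"
    by (simp add: mult_ac)
  ultimately show ?case by simp
next
  case (add s t)
  have "integral {0..2 * pi} (\<lambda>\<theta>. f \<theta> * s \<theta> + f \<theta> * t \<theta>) = 0"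
    using add by (subst integral_add)
      (auto intro!: integrable_continuous_real continuous_on_mult f
        continuous_on_trig_poly[OF add.hyps(1)] continuous_on_trig_poly[OF add.hyps(2)])
  then show ?case by (simp add: algebra_simps)
qed

text \<open>\<open>Arg\<close> jumps across the negative axis. Near \<open>z0\<close> it is replaced
  by \<open>Arg z0 + Arg (z / z0)\<close>, continuous there because \<open>z / z0\<close> is near 1;
  the two differ by a multiple of \<open>2 * pi\<close>, invisible to \<open>f\<close>.\<close>

lemma continuous_on_circle_lift:
  assumes f: "continuous_on UNIV f" "\<And>\<theta>. f (\<theta> + 2 * pi) = f \<theta>"
  shows "continuous_on (sphere 0 1) (\<lambda>z. f (Arg z))"
  unfolding continuous_on_eq_continuous_within
proof
  fix z0 :: complex assume z0: "z0 \<in> sphere 0 1"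
  have eq: "f (Arg z) = f (Arg z0 + Arg (z / z0))" if "z \<in> sphere 0 1" for z
  proof -
    have "cis (Arg z0 + Arg (z / z0)) = z0 * (z / z0)"
      using that z0 unfolding cis_mult[symmetric] by (subst (1 2) cis_Arg) (auto simp: sgn_div_norm norm_divide)
    also have "\<dots> = cis (Arg z)"
      using that z0 by (subst cis_Arg) (auto simp: sgn_div_norm)
    finally have "sin (Arg z0 + Arg (z / z0)) = sin (Arg z) \<and> cos (Arg z0 + Arg (z / z0)) = cos (Arg z)"
      by (simp add: complex_eq_iff)
    then obtain n :: int where "Arg z0 + Arg (z / z0) = Arg z + 2 * pi * n"
      unfolding sin_cos_eq_iff by blast
    then show ?thesis using periodic_int[where f = f, OF f(2)] by metis
  qed
  have "z0 \<noteq> 0" using z0 by auto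
  have "continuous (at z0 within sphere 0 1) (\<lambda>z. z / z0)"
    by (intro continuous_intros) (use \<open>z0 \<noteq> 0\<close> in auto)
  moreover have "isCont Arg (z0 / z0)"
    using \<open>z0 \<noteq> 0\<close> by (intro continuous_at_Arg) auto
  ultimately have "continuous (at z0 within sphere 0 1) (\<lambda>z. Arg (z / z0))"
    by (rule continuous_within_compose3[rotated])
  then have "continuous (at z0 within sphere 0 1) (\<lambda>z. Arg z0 + Arg (z / z0))"
    by (intro continuous_intros)
  moreover have "isCont f (Arg z0 + Arg (z0 / z0))"
    using f(1) by (simp add: continuous_on_eq_continuous_at)
  ultimately have "continuous (at z0 within sphere 0 1) (\<lambda>z. f (Arg z0 + Arg (z / z0)))"
    by (rule continuous_within_compose3[rotated])
  then show "continuous (at z0 within sphere 0 1) (\<lambda>z. f (Arg z))"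
    by (rule continuous_transform_within[of _ _ _ 1]) (use z0 eq in auto)
qed

text \<open>Stone-Weierstrass on the unit circle, applied to \<open>f\<close> transported by
  \<open>Arg\<close>; real and imaginary part of the approximating polynomial become trigonometric
  polynomials in the angle.\<close>

lemma trig_poly_approx:
  assumes f: "continuous_on UNIV f" "\<And>\<theta>. f (\<theta> + 2 * pi) = f \<theta>" and "\<epsilon> > 0"
  obtains t where "trig_poly t" "\<And>\<theta>. cmod (f \<theta> - t \<theta>) < \<epsilon>"
proof -
  obtain g where g: "polynomial_function g" "\<forall>z\<in>sphere 0 1. cmod (f (Arg z) - g z) < \<epsilon>"
    using Stone_Weierstrass_polynomial_function[OF _ continuous_on_circle_lift[OF f] \<open>\<epsilon> > 0\<close>] by auto
  have "real_polynomial_function (Re \<circ> g)" "real_polynomial_function (Im \<circ> g)"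
    using g(1) unfolding polynomial_function_def by (auto intro: bounded_linear_Re bounded_linear_Im)
  from this[THEN trig_poly_of_polynomial]
  have "trig_poly (\<lambda>\<theta>. of_real ((Re \<circ> g) (cis \<theta>)) + \<i> * of_real ((Im \<circ> g) (cis \<theta>)))"
    by (intro trig_poly.add trig_poly_mult trig_poly_const)
  then have "trig_poly (\<lambda>\<theta>. g (cis \<theta>))" by (simp add: complex_eq[symmetric])
  moreover have "cmod (f \<theta> - g (cis \<theta>)) < \<epsilon>" for \<theta>
  proof -
    have "cis (Arg (cis \<theta>)) = cis \<theta>" by (subst cis_Arg) auto
    then have "sin (Arg (cis \<theta>)) = sin \<theta> \<and> cos (Arg (cis \<theta>)) = cos \<theta>" by (simp add: complex_eq_iff)
    then obtain n :: int where "Arg (cis \<theta>) = \<theta> + 2 * pi * n" unfolding sin_cos_eq_iff by blast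
    then have "f (Arg (cis \<theta>)) = f \<theta>" using periodic_int[where f = f, OF f(2)] by metis
    then show ?thesis using g(2)[rule_format, of "cis \<theta>"] by simp
  qed
  ultimately show ?thesis using that by blast
qed

text \<open>The integral of \<open>f\<close> against every trigonometric polynomial is 0, and the
  conjugate of \<open>f\<close> is a uniform limit of these, so the integral of
  \<open>(cmod (f \<theta>))\<^sup>2\<close> vanishes.\<close>

lemma fourier_coeff_inj:
  assumes f: "continuous_on UNIV f" "\<And>\<theta>. f (\<theta> + 2 * pi) = f \<theta>" "\<And>k. fourier_coeff f k = 0"
  shows "f = (\<lambda>\<theta>. 0)"
proof -
  have fS: "continuous_on {0..2 * pi} f" using f(1) continuous_on_subset by blast
  define S where "S = integral {0..2 * pi} (\<lambda>\<theta>. f \<theta> * cnj (f \<theta>))"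
  obtain B where B: "\<forall>z\<in>f ` {0..2 * pi}. cmod z \<le> B"
    using compact_imp_bounded[OF compact_continuous_image[OF fS]] bounded_iff by (metis compact_Icc)
  then have B0: "B \<ge> 0" using order_trans[OF norm_ge_zero] by fastforce
  have c': "continuous_on UNIV (\<lambda>\<theta>. cnj (f \<theta>))" by (intro continuous_intros f)
  have "cmod S \<le> 0 + \<epsilon>" if "\<epsilon> > 0" for \<epsilon>
  proof -
    \<comment> \<open>Error budget: the interval has length \<open>2 * pi\<close> and
      \<open>cmod (f \<theta>) \<le> B\<close> on it; the added 1 excludes division by zero.\<close>
    define \<delta> where "\<delta> = \<epsilon> / (2 * pi * (B + 1))"
    have "\<delta> > 0" unfolding \<delta>_def using that B0 by (intro divide_pos_pos mult_pos_pos) auto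
    obtain t where t: "trig_poly t" "\<And>\<theta>. cmod (cnj (f \<theta>) - t \<theta>) < \<delta>"
      using trig_poly_approx[OF c' _ \<open>\<delta> > 0\<close>] f(2) by metis
    have "S - 0 = integral {0..2 * pi} (\<lambda>\<theta>. f \<theta> * cnj (f \<theta>) - f \<theta> * t \<theta>)"
      unfolding S_def integral_trig_poly_0[OF fS f(3) t(1), symmetric]
      by (rule integral_diff[symmetric])
        (auto intro!: integrable_continuous_real continuous_intros fS continuous_on_trig_poly[OF t(1)])
    also have "\<dots> = integral {0..2 * pi} (\<lambda>\<theta>. f \<theta> * (cnj (f \<theta>) - t \<theta>))" by (simp add: algebra_simps)
    finally have "cmod S = cmod (integral {0..2 * pi} (\<lambda>\<theta>. f \<theta> * (cnj (f \<theta>) - t \<theta>)))" by simp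
    also have "\<dots> \<le> (B * \<delta>) * (2 * pi - 0)"
    proof (rule integral_bound)
      fix \<theta> :: real assume "\<theta> \<in> {0..2 * pi}"
      then show "cmod (f \<theta> * (cnj (f \<theta>) - t \<theta>)) \<le> B * \<delta>"
        unfolding norm_mult using B B0 t(2)[of \<theta>] by (intro mult_mono) auto
    qed (auto intro!: continuous_intros fS continuous_on_trig_poly[OF t(1)])
    also have "\<dots> \<le> \<epsilon>"
    proof -
      have "2 * pi * (B + 1) > 0" using B0 by (intro mult_pos_pos) auto
      then have "\<delta> * (2 * pi * (B + 1)) = \<epsilon>" using B0 by (simp add: \<delta>_def)
      moreover have "\<delta> * (2 * pi) \<ge> 0" using \<open>\<delta> > 0\<close> by simp
      ultimately show ?thesis by (simp add: algebra_simps)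
    qed
    finally show ?thesis by simp
  qed
  then have "S = 0" using field_le_epsilon[of "cmod S" 0] by simp
  moreover have i: "(\<lambda>\<theta>. (cmod (f \<theta>))\<^sup>2) integrable_on {0..2 * pi}"
    by (intro integrable_continuous_real continuous_intros fS)
  moreover have "S = of_real (integral {0..2 * pi} (\<lambda>\<theta>. (cmod (f \<theta>))\<^sup>2))"
    unfolding S_def complex_norm_square[symmetric]
    using integral_linear[OF i, of complex_of_real] by (simp add: o_def bounded_linear_of_real)
  ultimately have "integral {0..2 * pi} (\<lambda>\<theta>. (cmod (f \<theta>))\<^sup>2) = 0" by simp
  then have z: "\<forall>\<theta>\<in>{0..2 * pi}. f \<theta> = 0"
    by (subst (asm) integral_eq_0_iff) (auto intro!: continuous_intros fS)
  show ?thesis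
  proof
    fix \<theta>
    obtain \<theta>' where "\<theta>' \<in> {0..2 * pi}" "f \<theta> = f \<theta>'" by (rule periodic_reduce[of f, OF f(2)])
    then show "f \<theta> = 0" using z by simp
  qed
qed

text \<open>For \<open>k \<noteq> n\<close> no integral is computed. Differentiation multiplies the
  function by \<open>\<i> * n\<close> and its coefficient by \<open>\<i> * k\<close>, so the
  coefficient is 0.\<close>

lemma fourier_coeff_cis: "fourier_coeff (\<lambda>\<theta>. cis (of_int n * \<theta>)) k = (if k = n then 1 else 0)"
proof (cases "k = n")
  case True
  then show ?thesis by (simp add: fourier_coeff_def cis_mult scaleR_conv_of_real)
next
  case False
  have s: "(\<lambda>\<theta>. 1 * cis (of_int n * \<theta>)) \<in> smooth_circle_set" by (rule smooth_cis)
  have "circle_deriv (\<lambda>\<theta>. 1 * cis (of_int n * \<theta>)) = (\<lambda>\<theta>. \<i> * of_int n * (1 * cis (of_int n * \<theta>)))"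
    using cis_int_has_deriv[of 1 n] by (auto intro: vector_derivative_at)
  then have "\<i> * of_int n * fourier_coeff (\<lambda>\<theta>. 1 * cis (of_int n * \<theta>)) k = \<i> * of_int k * fourier_coeff (\<lambda>\<theta>. 1 * cis (of_int n * \<theta>)) k"
    using fourier_coeff_deriv[OF s, of k] by (simp only: fourier_coeff_scale)
  then show ?thesis using False by simp
qed

section \<open>Uniform convergence of Fourier series and the convolution formula\<close>

lemma summable_inverse_square: "(\<lambda>n::nat. inverse ((1 + real n)\<^sup>2)) summable_on UNIV"
proof (rule norm_summable_imp_summable_on)
  have "summable (\<lambda>n. inverse ((real n)\<^sup>2))"
    by (rule inverse_power_summable) simp
  then have "summable (\<lambda>n. inverse ((real (Suc n))\<^sup>2))" by (subst summable_Suc_iff)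
  then show "summable (\<lambda>n. norm (inverse ((1 + real n)\<^sup>2)))" by simp
qed

lemma summable_inverse_square_int: "(\<lambda>k::int. inverse ((1 + real_of_int \<bar>k\<bar>)\<^sup>2)) summable_on UNIV"
proof -
  have "(\<lambda>k::int. inverse ((1 + real_of_int \<bar>k\<bar>)\<^sup>2)) summable_on (range int)"
    by (subst summable_on_reindex) (auto simp: o_def summable_inverse_square)
  moreover have "(\<lambda>k::int. inverse ((1 + real_of_int \<bar>k\<bar>)\<^sup>2)) summable_on ((\<lambda>n. - int n) ` UNIV)"
    by (subst summable_on_reindex) (auto simp: o_def summable_inverse_square inj_on_def)
  ultimately have "(\<lambda>k::int. inverse ((1 + real_of_int \<bar>k\<bar>)\<^sup>2)) summable_on (range int \<union> (\<lambda>n. - int n) ` UNIV)"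
    by (rule summable_on_union)
  moreover have "range int \<union> (\<lambda>n. - int n) ` UNIV = (UNIV :: int set)"
  proof -
    have "x \<in> range int \<union> (\<lambda>n. - int n) ` UNIV" for x :: int
      by (cases x rule: int_cases2) auto
    then show ?thesis by blast
  qed
  ultimately show ?thesis by simp
qed

lemma fourier_summable:
  assumes "f \<in> smooth_circle_set"
  shows "(\<lambda>k. cmod (fourier_coeff f k)) summable_on UNIV"
proof (rule summable_on_comparison_test)
  show "(\<lambda>k. 2 ^ Suc 2 * (\<Sum>l\<le>2. circle_seminorm l f) * inverse ((1 + real_of_int \<bar>k\<bar>)\<^sup>2)) summable_on UNIV"
    by (intro summable_on_cmult_right summable_inverse_square_int)
  fix k
  have "(1 + real_of_int \<bar>k\<bar>)\<^sup>2 > 0" by (auto intro!: zero_less_power)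
  then show "cmod (fourier_coeff f k) \<le> 2 ^ Suc 2 * (\<Sum>l\<le>2. circle_seminorm l f) * inverse ((1 + real_of_int \<bar>k\<bar>)\<^sup>2)"
    using fourier_coeff_decay[OF assms, of k 2] by (simp add: field_simps)
qed auto

abbreviation fourier_partial :: "(real \<Rightarrow> complex) \<Rightarrow> int set \<Rightarrow> real \<Rightarrow> complex" where
  "fourier_partial f F \<equiv> (\<lambda>\<theta>. \<Sum>k\<in>F. fourier_coeff f k * cis (of_int k * \<theta>))"

lemma fourier_coeff_partial_mult:
  assumes "finite F" "continuous_on {0..2 * pi} g"
  shows "fourier_coeff (\<lambda>\<theta>. fourier_partial f F \<theta> * g \<theta>) n = (\<Sum>k\<in>F. fourier_coeff f k * fourier_coeff g (n - k))"
  using assms(1)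
proof induction
  case empty
  show ?case by (simp add: fourier_coeff_def)
next
  case (insert k F)
  have c: "continuous_on {0..2 * pi} (\<lambda>\<theta>. cis (of_int k * \<theta>) * g \<theta>)"
    by (intro continuous_intros assms)
  have e1: "(\<lambda>\<theta>. fourier_partial f (insert k F) \<theta> * g \<theta>) =
    (\<lambda>\<theta>. fourier_coeff f k * (cis (of_int k * \<theta>) * g \<theta>) + fourier_partial f F \<theta> * g \<theta>)"
    using insert.hyps by (simp add: algebra_simps)
  have e2: "fourier_coeff (\<lambda>\<theta>. cis (of_int k * \<theta>) * g \<theta>) n = fourier_coeff g (n - k)"
  proof -
    have "cis (of_int k * \<theta>) * g \<theta> * cis (- (of_int n * \<theta>)) = g \<theta> * cis (- (of_int (n - k) * \<theta>))" for \<theta>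
      by (simp add: mult.commute[of _ "g \<theta>"] mult.assoc cis_mult algebra_simps)
    then show ?thesis unfolding fourier_coeff_def by (simp only:)
  qed
  have "fourier_coeff (\<lambda>\<theta>. fourier_partial f (insert k F) \<theta> * g \<theta>) n =
    fourier_coeff (\<lambda>\<theta>. fourier_coeff f k * (cis (of_int k * \<theta>) * g \<theta>)) n + fourier_coeff (\<lambda>\<theta>. fourier_partial f F \<theta> * g \<theta>) n"
    unfolding e1 by (rule fourier_coeff_add) (intro continuous_intros assms c)+
  also have "\<dots> = fourier_coeff f k * fourier_coeff g (n - k) + (\<Sum>k\<in>F. fourier_coeff f k * fourier_coeff g (n - k))"
    by (simp only: fourier_coeff_scale e2 insert.IH)
  finally show ?case using insert.hyps by simp
qed

text \<open>The uniform limit of the Fourier series has the same Fourier coefficients as \<open>f\<close>, hence equals \<open>f\<close>.\<close>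

lemma fourier_expansion:
  assumes f: "f \<in> smooth_circle_set" and "\<epsilon> > 0"
  shows "\<forall>\<^sub>F F in finite_subsets_at_top UNIV. \<forall>\<theta>. cmod (f \<theta> - fourier_partial f F \<theta>) < \<epsilon>"
proof -
  define s where "s \<theta> = (\<Sum>\<^sub>\<infinity>k. fourier_coeff f k * cis (of_int k * \<theta>))" for \<theta>
  have u: "uniform_limit UNIV (\<lambda>F. fourier_partial f F) s (finite_subsets_at_top UNIV)"
    unfolding s_def
    by (rule Weierstrass_m_test_general[OF _ fourier_summable[OF f]]) (simp add: norm_mult)
  have cs: "continuous_on UNIV s"
    by (rule uniform_limit_theorem[OF _ u]) (auto intro!: always_eventually continuous_intros)
  have ps: "s (\<theta> + 2 * pi) = s \<theta>" for \<theta> unfolding s_def by (simp only: cis_int_periodic)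
  have fc: "fourier_coeff s n = fourier_coeff f n" for n
  proof -
    have "cmod (fourier_coeff s n - fourier_coeff f n) \<le> 0 + \<delta>" if "\<delta> > 0" for \<delta>
    proof -
      have "\<forall>\<^sub>F F in finite_subsets_at_top UNIV. \<forall>\<theta>\<in>UNIV. dist (fourier_partial f F \<theta>) (s \<theta>) < \<delta>"
        using u that by (rule uniform_limitD)
      moreover have "\<forall>\<^sub>F F in finite_subsets_at_top UNIV. finite F \<and> {n} \<subseteq> F"
        by (auto simp: eventually_finite_subsets_at_top)
      ultimately have "\<forall>\<^sub>F F in finite_subsets_at_top UNIV.
          (\<forall>\<theta>\<in>UNIV. dist (fourier_partial f F \<theta>) (s \<theta>) < \<delta>) \<and> finite F \<and> {n} \<subseteq> F"
        by (rule eventually_conj)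
      then obtain F where "(\<forall>\<theta>\<in>UNIV. dist (fourier_partial f F \<theta>) (s \<theta>) < \<delta>) \<and> finite F \<and> {n} \<subseteq> F"
        using eventually_happens'[OF finite_subsets_at_top_neq_bot] by blast
      then have F: "\<forall>\<theta>\<in>UNIV. dist (fourier_partial f F \<theta>) (s \<theta>) < \<delta>" "finite F" "n \<in> F"
        by auto
      have "fourier_coeff (fourier_partial f F) n = (\<Sum>k\<in>F. fourier_coeff f k * fourier_coeff (\<lambda>\<theta>. cis (of_int 0 * \<theta>)) (n - k))"
        using fourier_coeff_partial_mult[OF F(2), of "\<lambda>\<theta>. cis (of_int 0 * \<theta>)" f n] by (simp add: continuous_intros)
      also have "\<dots> = (\<Sum>k\<in>F. if n = k then fourier_coeff f k else 0)"
        unfolding fourier_coeff_cis by (rule sum.cong) auto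
      also have "\<dots> = fourier_coeff f n" using F by (simp add: sum.delta)
      finally have p: "fourier_coeff (fourier_partial f F) n = fourier_coeff f n" .
      have "fourier_coeff s n = fourier_coeff (\<lambda>\<theta>. (s \<theta> + (-1) * fourier_partial f F \<theta>) + fourier_partial f F \<theta>) n"
        by simp
      also have "\<dots> = fourier_coeff (\<lambda>\<theta>. s \<theta> + (-1) * fourier_partial f F \<theta>) n + fourier_coeff f n"
        by (subst fourier_coeff_add) (auto simp: p intro!: continuous_intros continuous_on_subset[OF cs])
      finally have "cmod (fourier_coeff s n - fourier_coeff f n) = cmod (fourier_coeff (\<lambda>\<theta>. s \<theta> + (-1) * fourier_partial f F \<theta>) n)"
        by simp
      also have "\<dots> \<le> \<delta>"
      proof (rule fourier_coeff_bound)
        fix \<theta> show "cmod (s \<theta> + (-1) * fourier_partial f F \<theta>) \<le> \<delta>"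
          using F(1) by (simp add: dist_norm norm_minus_commute less_imp_le)
      qed (auto intro!: continuous_intros continuous_on_subset[OF cs])
      finally show ?thesis by simp
    qed
    then show ?thesis using field_le_epsilon[of "cmod (fourier_coeff s n - fourier_coeff f n)" 0] by simp
  qed
  have "(\<lambda>\<theta>. f \<theta> + (-1) * s \<theta>) = (\<lambda>\<theta>. 0)"
  proof (rule fourier_coeff_inj)
    show "continuous_on UNIV (\<lambda>\<theta>. f \<theta> + (-1) * s \<theta>)" by (intro continuous_intros smooth_continuous f cs)
    show "f (\<theta> + 2 * pi) + (-1) * s (\<theta> + 2 * pi) = f \<theta> + (-1) * s \<theta>" for \<theta>
      by (simp add: ps smooth_periodic[OF f])
    show "fourier_coeff (\<lambda>\<theta>. f \<theta> + (-1) * s \<theta>) k = 0" for k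
    proof -
      have "fourier_coeff (\<lambda>\<theta>. f \<theta> + (-1) * s \<theta>) k = fourier_coeff f k + fourier_coeff (\<lambda>\<theta>. (-1) * s \<theta>) k"
        by (rule fourier_coeff_add[OF smooth_continuous[OF f]])
          (intro continuous_intros continuous_on_subset[OF cs], simp)
      also have "\<dots> = fourier_coeff f k + (-1) * fourier_coeff f k" by (simp only: fourier_coeff_scale fc)
      finally show ?thesis by simp
    qed
  qed
  then have "s = f" by (auto simp: fun_eq_iff)
  then show ?thesis
    using uniform_limitD[OF u \<open>\<epsilon> > 0\<close>] by (simp add: dist_norm norm_minus_commute)
qed

text \<open>The partial sums of the Fourier series of \<open>f\<close> approximate it uniformly. For
  them the convolution formula is a finite computation, and the error in the coefficient is at most
  \<open>\<delta>\<close> times the supremum of \<open>g\<close>.\<close>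

lemma fourier_coeff_mult:
  assumes f: "f \<in> smooth_circle_set" and g: "g \<in> smooth_circle_set"
  shows "((\<lambda>k. fourier_coeff f k * fourier_coeff g (n - k)) has_sum fourier_coeff (\<lambda>\<theta>. f \<theta> * g \<theta>) n) UNIV"
  unfolding has_sum_def
proof (rule tendstoI)
  fix \<epsilon> :: real assume "\<epsilon> > 0"
  let ?B = "circle_seminorm 0 g"
  have B: "cmod (g \<theta>) \<le> ?B" for \<theta> using le_circle_seminorm[OF g, of 0] by simp
  have B0: "?B \<ge> 0" by (rule circle_seminorm_nonneg[OF g])
  define \<delta> where "\<delta> = \<epsilon> / (?B + 1)"
  have "\<delta> > 0" using B0 \<open>\<epsilon> > 0\<close> by (simp add: \<delta>_def)
  have "\<delta> * ?B < \<epsilon>" using B0 \<open>\<epsilon> > 0\<close> by (simp add: \<delta>_def field_simps)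
  have ev: "\<forall>\<^sub>F F in finite_subsets_at_top UNIV. finite F \<and> (\<forall>\<theta>. cmod (f \<theta> - fourier_partial f F \<theta>) < \<delta>)"
    by (intro eventually_conj fourier_expansion[OF f \<open>\<delta> > 0\<close>] eventually_finite_subsets_at_top_weakI)
  show "\<forall>\<^sub>F F in finite_subsets_at_top UNIV.
    dist (\<Sum>k\<in>F. fourier_coeff f k * fourier_coeff g (n - k)) (fourier_coeff (\<lambda>\<theta>. f \<theta> * g \<theta>) n) < \<epsilon>"
    using ev
  proof (rule eventually_mono)
    fix F assume F: "finite F \<and> (\<forall>\<theta>. cmod (f \<theta> - fourier_partial f F \<theta>) < \<delta>)"
    have c: "continuous_on {0..2 * pi} (\<lambda>\<theta>. (f \<theta> - fourier_partial f F \<theta>) * g \<theta>)"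
      "continuous_on {0..2 * pi} (\<lambda>\<theta>. fourier_partial f F \<theta> * g \<theta>)"
      by (intro continuous_intros smooth_continuous f g)+
    have "fourier_coeff (\<lambda>\<theta>. f \<theta> * g \<theta>) n =
      fourier_coeff (\<lambda>\<theta>. (f \<theta> - fourier_partial f F \<theta>) * g \<theta> + fourier_partial f F \<theta> * g \<theta>) n"
      by (simp add: algebra_simps)
    also have "\<dots> = fourier_coeff (\<lambda>\<theta>. (f \<theta> - fourier_partial f F \<theta>) * g \<theta>) n +
      (\<Sum>k\<in>F. fourier_coeff f k * fourier_coeff g (n - k))"
      by (subst fourier_coeff_add[OF c]) (use F in \<open>simp add: fourier_coeff_partial_mult smooth_continuous g\<close>)
    finally have "dist (\<Sum>k\<in>F. fourier_coeff f k * fourier_coeff g (n - k)) (fourier_coeff (\<lambda>\<theta>. f \<theta> * g \<theta>) n) =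
      cmod (fourier_coeff (\<lambda>\<theta>. (f \<theta> - fourier_partial f F \<theta>) * g \<theta>) n)"
      by (simp add: dist_norm)
    also have "\<dots> \<le> \<delta> * ?B"
    proof (rule fourier_coeff_bound[OF c(1)])
      fix \<theta> show "cmod ((f \<theta> - fourier_partial f F \<theta>) * g \<theta>) \<le> \<delta> * ?B"
        unfolding norm_mult using F B B0 \<open>\<delta> > 0\<close> by (intro mult_mono) (auto intro: less_imp_le)
    qed
    finally show "dist (\<Sum>k\<in>F. fourier_coeff f k * fourier_coeff g (n - k)) (fourier_coeff (\<lambda>\<theta>. f \<theta> * g \<theta>) n) < \<epsilon>"
      using \<open>\<delta> * ?B < \<epsilon>\<close> by simp
  qed
qed


section \<open>The smooth quantum disc\<close>

text \<open>Displacements must form a group, so the points are integers; the labels correspond to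
  the nonnegative ones, read through \<open>nat\<close>.\<close>

interpretation disc: shift_lattice "UNIV :: nat set" "{0::int..}" nat
  by unfold_locales (rule bij_betwI[where g = int], auto)

text \<open>\<open>u ^ k\<close> acts as the \<open>k\<close>-th power of the shift, which lowers
  the index by \<open>k\<close>; row \<open>x\<close> and column \<open>y\<close> thus meet the
  Fourier coefficient of order \<open>y - x\<close>.\<close>

definition disc_mat :: "(real \<Rightarrow> complex) \<Rightarrow> (nat \<Rightarrow> nat \<Rightarrow> complex) \<Rightarrow> nat \<Rightarrow> nat \<Rightarrow> complex" where
  "disc_mat f R x y = fourier_coeff f (int y - int x) + R x y"

definition disc_op :: "(real \<Rightarrow> complex) \<Rightarrow> (nat \<Rightarrow> nat \<Rightarrow> complex) \<Rightarrow> nat opr" where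
  "disc_op f R = mat_op UNIV (disc_mat f R)"

lemma le_matrix_seminorm:
  assumes "rapid_decay R"
  shows "(1 + real x + real y) ^ k * cmod (R x y) \<le> matrix_seminorm k R"
proof -
  have "bdd_above (range (\<lambda>(x, y). (1 + real x + real y) ^ k * cmod (R x y)))"
    using assms by (simp add: rapid_decay_def)
  from cSUP_upper[OF UNIV_I this, of "(x, y)"] show ?thesis
    by (simp add: matrix_seminorm_def)
qed

lemma rapid_decayI:
  assumes "\<And>k. \<exists>B. \<forall>x y. (1 + real x + real y) ^ k * cmod (R x y) \<le> B"
  shows "rapid_decay R"
  unfolding rapid_decay_def
proof
  fix k
  obtain B where "\<forall>x y. (1 + real x + real y) ^ k * cmod (R x y) \<le> B" using assms by blast
  then show "bdd_above (range (\<lambda>(x, y). (1 + real x + real y) ^ k * cmod (R x y)))"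
    by (intro bdd_aboveI[of _ B]) auto
qed

lemma matrix_seminorm_le:
  assumes "\<And>x y. (1 + real x + real y) ^ k * cmod (R x y) \<le> B"
  shows "matrix_seminorm k R \<le> B"
  unfolding matrix_seminorm_def by (rule cSUP_least) (use assms in auto)

lemma matrix_seminorm_nonneg: "rapid_decay R \<Longrightarrow> 0 \<le> matrix_seminorm k R"
  by (rule order_trans[OF _ le_matrix_seminorm[of R 0 0]]) auto

lemma rapid_decay_add:
  assumes "rapid_decay R" "rapid_decay Q"
  shows "rapid_decay (\<lambda>x y. R x y + Q x y)"
proof (rule rapid_decayI, intro exI allI)
  fix k x y
  have "(1 + real x + real y) ^ k * cmod (R x y + Q x y) \<le> (1 + real x + real y) ^ k * (cmod (R x y) + cmod (Q x y))"
    by (intro mult_left_mono norm_triangle_ineq) auto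
  also have "\<dots> \<le> matrix_seminorm k R + matrix_seminorm k Q"
    unfolding distrib_left by (intro add_mono le_matrix_seminorm assms)
  finally show "(1 + real x + real y) ^ k * cmod (R x y + Q x y) \<le> matrix_seminorm k R + matrix_seminorm k Q" .
qed

lemma rapid_decay_scale:
  assumes "rapid_decay R"
  shows "rapid_decay (\<lambda>x y. c * R x y)"
proof (rule rapid_decayI, intro exI allI)
  fix k x y
  have "cmod c * ((1 + real x + real y) ^ k * cmod (R x y)) \<le> cmod c * matrix_seminorm k R"
    by (intro mult_left_mono le_matrix_seminorm assms) auto
  then show "(1 + real x + real y) ^ k * cmod (c * R x y) \<le> cmod c * matrix_seminorm k R"
    by (simp add: norm_mult mult_ac)
qed

lemma rapid_decay_zero: "rapid_decay (\<lambda>x y. 0)"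
  by (rule rapid_decayI) auto

lemma rapid_decay_star: "rapid_decay R \<Longrightarrow> rapid_decay (\<lambda>x y. cnj (R y x))"
  by (rule rapid_decayI) (metis le_matrix_seminorm complex_mod_cnj add.commute add.left_commute)

lemma matrix_seminorm_star:
  assumes "rapid_decay R"
  shows "matrix_seminorm k (\<lambda>x y. cnj (R y x)) \<le> matrix_seminorm k R"
proof (rule matrix_seminorm_le)
  fix x y
  show "(1 + real x + real y) ^ k * cmod (cnj (R y x)) \<le> matrix_seminorm k R"
    using le_matrix_seminorm[OF assms, of y x k] by (simp add: ac_simps)
qed

text \<open>Along a row or a column the diagonal index \<open>y - x\<close> takes each integer at
  most once, so both kinds of sums are bounded by subsums of one convergent series over the
  integers.\<close>

lemma schur_off_diagonal:
  fixes K :: "nat \<Rightarrow> nat \<Rightarrow> complex"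
  assumes K: "\<And>x y. cmod (K x y) \<le> C * inverse ((1 + real_of_int \<bar>int y - int x\<bar>)\<^sup>2)"
  shows "schur UNIV K"
proof -
  let ?g = "\<lambda>k::int. C * inverse ((1 + real_of_int \<bar>k\<bar>)\<^sup>2)"
  have s: "?g summable_on A" for A
    by (rule summable_on_subset[OF summable_on_cmult_right[OF summable_inverse_square_int]]) simp
  have C: "C \<ge> 0" using order_trans[OF norm_ge_zero K[of 0 0]] by simp
  have main: "h summable_on UNIV \<and> infsum h UNIV \<le> infsum ?g UNIV"
    if "inj r" "\<And>y. h y \<le> ?g (r y)" "\<And>y. 0 \<le> h y" for h :: "nat \<Rightarrow> real" and r
  proof -
    have gr: "(\<lambda>y. ?g (r y)) summable_on UNIV"
      using s[of "range r"] summable_on_reindex[OF that(1), of ?g] by (simp add: o_def)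
    then have h: "h summable_on UNIV" by (rule summable_on_comparison_test) (use that in auto)
    have "infsum h UNIV \<le> infsum (\<lambda>y. ?g (r y)) UNIV" by (rule infsum_mono[OF h gr that(2)])
    also have "\<dots> = infsum ?g (range r)" using infsum_reindex[OF that(1), of ?g] by (simp add: o_def)
    also have "\<dots> \<le> infsum ?g UNIV" by (rule infsum_mono2[OF s s]) (use C in auto)
    finally show ?thesis using h by blast
  qed
  have "schur_bound UNIV K (infsum ?g UNIV)"
    unfolding schur_bound_def
  proof (intro conjI ballI)
    fix x
    have "inj (\<lambda>y. int y - int x)" by (auto simp: inj_on_def)
    from main[where h = "\<lambda>y. cmod (K x y)", OF this K norm_ge_zero]
    show "(\<lambda>y. cmod (K x y)) summable_on UNIV" "(\<Sum>\<^sub>\<infinity>y. cmod (K x y)) \<le> infsum ?g UNIV" by blast+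
  next
    fix y
    have "inj (\<lambda>x. int y - int x)" by (auto simp: inj_on_def)
    from main[where h = "\<lambda>x. cmod (K x y)", OF this K norm_ge_zero]
    show "(\<lambda>x. cmod (K x y)) summable_on UNIV" "(\<Sum>\<^sub>\<infinity>x. cmod (K x y)) \<le> infsum ?g UNIV" by blast+
  qed
  then show ?thesis unfolding schur_def by blast
qed

lemma le_mult_inverse: "0 < w \<Longrightarrow> w * a \<le> b \<Longrightarrow> a \<le> b * inverse (w::real)"
  by (simp add: field_simps)

text \<open>Both parts decay like the inverse square of the distance from the diagonal: the symbol
  by the Fourier estimate of order 2, the matrix because
  \<open>\<bar>y - x\<bar> \<le> x + y\<close>.\<close>

lemma schur_disc_mat:
  assumes f: "f \<in> smooth_circle_set" and R: "rapid_decay R"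
  shows "schur UNIV (disc_mat f R)"
proof (rule schur_off_diagonal)
  fix x y
  let ?w = "(1 + real_of_int \<bar>int y - int x\<bar>)\<^sup>2"
  have w: "?w > 0" by (intro zero_less_power) auto
  have "?w \<le> (1 + real x + real y)\<^sup>2" by (intro power_mono) auto
  then have "?w * cmod (R x y) \<le> matrix_seminorm 2 R"
    by (intro order_trans[OF mult_right_mono le_matrix_seminorm[OF R]]) auto
  then have "?w * cmod (disc_mat f R x y) \<le> 2 ^ Suc 2 * (\<Sum>l\<le>2. circle_seminorm l f) + matrix_seminorm 2 R"
    using fourier_coeff_decay[OF f, of "int y - int x" 2]
      mult_left_mono[OF norm_triangle_ineq[of "fourier_coeff f (int y - int x)" "R x y"] less_imp_le[OF w]]
    unfolding disc_mat_def distrib_left by linarith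
  then show "cmod (disc_mat f R x y) \<le> (2 ^ Suc 2 * (\<Sum>l\<le>2. circle_seminorm l f) + matrix_seminorm 2 R) * inverse ?w"
    by (rule le_mult_inverse[OF w])
qed

lemma fourier_coeff_zero: "fourier_coeff (\<lambda>\<theta>. 0) k = 0"
  by (simp add: fourier_coeff_def)

lemma matrix_op_eq: "matrix_op R = mat_op UNIV R"
  by (rule ext) (simp add: matrix_op_def mat_op_def)

section \<open>Toeplitz operators in matrix form, and their symbols\<close>

lemma wshift_shift: "disc.wshift shift (\<lambda>p. if p \<ge> 1 then 1 else 0) (- 1)"
  unfolding shift_def
proof (rule disc.wshift_op_of_basis)
  show "disc.weight (\<lambda>p. if p \<ge> 1 then 1 else 0) (- 1)"
    unfolding disc.weight_def by (auto intro!: exI[of _ 1])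
  fix p :: int assume "p \<in> {0..}"
  then show "(if nat p = 0 then \<lambda>v. 0 else basis_vec (nat p - 1)) =
      (\<lambda>v. complex_of_real (if p \<ge> 1 then 1 else 0) * basis_vec (nat (p + - 1)) v)"
    by (auto simp: nat_diff_distrib)
qed

lemma shift_apply: "\<xi> \<in> l2 UNIV \<Longrightarrow> shift \<xi> x = \<xi> (Suc x)"
  using disc.wshiftD(5)[OF wshift_shift, of \<xi> "int x"] by (simp add: nat_add_distrib)

lemma shift_power:
  assumes "\<xi> \<in> l2 UNIV"
  shows "(shift ^^ k) \<xi> \<in> l2 UNIV \<and> (\<forall>x. (shift ^^ k) \<xi> x = \<xi> (x + k))"
  using bounded_opD(1)[OF disc.wshiftD(1)[OF wshift_shift]]
  by (induction k) (auto simp: assms shift_apply)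

lemma adj_shift_apply:
  obtains "bounded_op UNIV (adj UNIV shift)"
    "\<And>\<xi> x. \<xi> \<in> l2 UNIV \<Longrightarrow> adj UNIV shift \<xi> x = (if x \<ge> 1 then \<xi> (x - 1) else 0)"
proof -
  obtain S where S: "is_adj UNIV shift S" "disc.wshift S (\<lambda>p. if p - - 1 \<ge> 1 then 1 else 0) (- (- 1))"
    using disc.wshift_adj[OF wshift_shift] by blast
  have "S \<xi> x = (if x \<ge> 1 then \<xi> (x - 1) else 0)" if "\<xi> \<in> l2 UNIV" for \<xi> x
    using disc.wshiftD(5)[OF S(2) that, of "int x"] by (auto simp: nat_diff_distrib)
  then show ?thesis using that disc.wshiftD(1)[OF S(2)] is_adj_adj[OF S(1)] by simp
qed

lemma adj_shift_power:
  assumes "\<xi> \<in> l2 UNIV"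
  shows "(adj UNIV shift ^^ k) \<xi> \<in> l2 UNIV \<and> (\<forall>x. (adj UNIV shift ^^ k) \<xi> x = (if k \<le> x then \<xi> (x - k) else 0))"
proof -
  obtain b: "bounded_op UNIV (adj UNIV shift)" and
    a: "\<And>\<xi> x. \<xi> \<in> l2 UNIV \<Longrightarrow> adj UNIV shift \<xi> x = (if x \<ge> 1 then \<xi> (x - 1) else 0)"
    by (rule adj_shift_apply) blast
  show ?thesis
  proof (induction k)
    case (Suc k)
    then have m: "(adj UNIV shift ^^ k) \<xi> \<in> l2 UNIV" by blast
    have "(adj UNIV shift ^^ Suc k) \<xi> \<in> l2 UNIV"
      unfolding funpow.simps o_apply by (rule bounded_opD(1)[OF b m])
    moreover have "(adj UNIV shift ^^ Suc k) \<xi> x = (if Suc k \<le> x then \<xi> (x - Suc k) else 0)" for x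
      unfolding funpow.simps o_apply a[OF m] using Suc by auto
    ultimately show ?case by blast
  qed (use assms in simp)
qed

text \<open>In row \<open>x\<close> the power \<open>k\<close> of the shift reads position
  \<open>x + k\<close>, that of its adjoint position \<open>x - k\<close> and only for
  \<open>k \<le> x\<close>. The two sets of positions, from \<open>x\<close> on and below
  \<open>x\<close>, partition the naturals.\<close>

lemma toeplitz_eq:
  assumes f: "f \<in> smooth_circle_set"
  shows "toeplitz f = mat_op UNIV (disc_mat f (\<lambda>x y. 0))"
proof (intro ext)
  fix \<xi> x
  show "toeplitz f \<xi> x = mat_op UNIV (disc_mat f (\<lambda>x y. 0)) \<xi> x"
  proof (cases "\<xi> \<in> l2 UNIV")
    case True
    let ?t = "\<lambda>y. fourier_coeff f (int y - int x) * \<xi> y"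
    have sm: "?t summable_on A" for A
      using summable_on_subset[OF abs_summable_summable[OF
            schur_row_abs_summable[OF schur_disc_mat[OF f rapid_decay_zero] True, of x]], of A]
      by (simp add: disc_mat_def)
    have "(\<Sum>\<^sub>\<infinity>k\<in>{0..}. fourier_coeff f (int k) * (shift ^^ k) \<xi> x) = (\<Sum>\<^sub>\<infinity>k\<in>{0..}. ?t (x + k))"
      using shift_power[OF True] by (intro infsum_cong) simp
    also have "\<dots> = infsum ?t {x..}"
      by (rule infsum_reindex_bij_betw, rule bij_betwI[where g = "\<lambda>y. y - x"]) auto
    finally have 1: "(\<Sum>\<^sub>\<infinity>k\<in>{0..}. fourier_coeff f (int k) * (shift ^^ k) \<xi> x) = infsum ?t {x..}" .
    have "(\<Sum>\<^sub>\<infinity>k\<in>{1..}. fourier_coeff f (- int k) * (adj UNIV shift ^^ k) \<xi> x) = (\<Sum>\<^sub>\<infinity>k\<in>{1..x}. ?t (x - k))"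
      using adj_shift_power[OF True] by (intro infsum_cong_neutral) (auto simp: of_nat_diff)
    also have "\<dots> = infsum ?t {..<x}"
      by (rule infsum_reindex_bij_betw, rule bij_betwI[where g = "\<lambda>y. x - y"]) auto
    finally have 2: "(\<Sum>\<^sub>\<infinity>k\<in>{1..}. fourier_coeff f (- int k) * (adj UNIV shift ^^ k) \<xi> x) = infsum ?t {..<x}" .
    have "toeplitz f \<xi> x = infsum ?t {x..} + infsum ?t {..<x}"
      using True unfolding toeplitz_def by (simp only: if_True 1 2)
    also have "infsum ?t {x..} + infsum ?t {..<x} = infsum ?t ({x..} \<union> {..<x})"
      by (rule infsum_Un_disjoint[symmetric, OF sm sm]) auto
    also have "{x..} \<union> {..<x} = UNIV" by auto
    finally show ?thesis using True by (simp add: mat_op_def disc_mat_def)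
  qed (simp add: toeplitz_def mat_op_def)
qed

lemma bounded_disc_op:
  "f \<in> smooth_circle_set \<Longrightarrow> rapid_decay R \<Longrightarrow> bounded_op UNIV (disc_op f R)"
  unfolding disc_op_def by (intro bounded_mat_op schur_disc_mat)

lemma disc_op_basis: "disc_op f R (basis_vec y) x = disc_mat f R x y"
  unfolding disc_op_def by (simp add: mat_op_basis)

lemma disc_op_eqI:
  assumes "f \<in> smooth_circle_set" "rapid_decay R" "bounded_op UNIV T"
    "\<And>x y. T (basis_vec y) x = disc_mat f R x y"
  shows "T = disc_op f R"
  by (rule bounded_op_eqI[OF assms(3) bounded_disc_op[OF assms(1,2)]]) (simp add: assms(4) disc_op_basis)

lemma toeplitz_plus_matrix:
  assumes f: "f \<in> smooth_circle_set" and R: "rapid_decay R"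
  shows "op_add (toeplitz f) (matrix_op R) = disc_op f R"
proof (rule disc_op_eqI[OF f R])
  have eq: "matrix_op R = mat_op UNIV (disc_mat (\<lambda>\<theta>. 0) R)"
    by (simp add: matrix_op_eq disc_mat_def[abs_def] fourier_coeff_zero)
  show "bounded_op UNIV (op_add (toeplitz f) (matrix_op R))"
    unfolding toeplitz_eq[OF f] eq
    by (intro bounded_op_add bounded_mat_op schur_disc_mat f R smooth_const rapid_decay_zero)
  show "op_add (toeplitz f) (matrix_op R) (basis_vec y) x = disc_mat f R x y" for x y
    by (simp add: toeplitz_eq[OF f] matrix_op_eq op_add_def mat_op_basis) (simp add: disc_mat_def)
qed

lemma smooth_disc_set_eq: "smooth_disc_set = {disc_op f R | f R. f \<in> smooth_circle_set \<and> rapid_decay R}"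
  unfolding smooth_disc_set_def by (intro Collect_cong ex_cong1) (auto simp: toeplitz_plus_matrix)

lemma smooth_disc_cases:
  assumes "T \<in> smooth_disc_set"
  obtains f R where "f \<in> smooth_circle_set" "rapid_decay R" "T = disc_op f R"
  using assms that unfolding smooth_disc_set_eq by blast

lemma smooth_disc_setI: "f \<in> smooth_circle_set \<Longrightarrow> rapid_decay R \<Longrightarrow> disc_op f R \<in> smooth_disc_set"
  using smooth_disc_set_eq by blast

lemma rapid_decay_tendsto:
  assumes "rapid_decay R" "\<And>n. x n \<ge> n"
  shows "(\<lambda>n. R (x n) (y n)) \<longlonglongrightarrow> 0"
proof (rule Lim_null_comparison)
  show "\<forall>\<^sub>F n in sequentially. norm (R (x n) (y n)) \<le> matrix_seminorm 1 R * inverse (real (Suc n))"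
  proof (intro always_eventually allI le_mult_inverse)
    fix n
    have "real (Suc n) * norm (R (x n) (y n)) \<le> (1 + real (x n) + real (y n)) ^ 1 * norm (R (x n) (y n))"
      using assms(2)[of n] by (intro mult_right_mono) auto
    then show "real (Suc n) * norm (R (x n) (y n)) \<le> matrix_seminorm 1 R"
      using le_matrix_seminorm[OF assms(1)] by (rule order_trans)
  qed simp
  show "(\<lambda>n. matrix_seminorm 1 R * inverse (real (Suc n))) \<longlonglongrightarrow> 0"
    using tendsto_mult_right[OF LIMSEQ_inverse_real_of_nat, of "matrix_seminorm 1 R"] by (simp add: mult.commute)
qed

text \<open>The symbol is recovered from the limits of the matrix entries along the diagonals.\<close>

lemma disc_op_inj:
  assumes f: "f \<in> smooth_circle_set" "rapid_decay R" and g: "g \<in> smooth_circle_set" "rapid_decay Q"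
    and eq: "disc_op f R = disc_op g Q"
  shows "f = g" "R = Q"
proof -
  have e: "disc_mat f R x y = disc_mat g Q x y" for x y using eq disc_op_basis by metis
  have fc: "fourier_coeff f k = fourier_coeff g k" for k
  proof -
    \<comment> \<open>At least one of \<open>nat k\<close> and \<open>nat (- k)\<close> is 0, so
      \<open>(x n, y n)\<close> runs along the diagonal of index \<open>k\<close> inside the
      naturals for either sign.\<close>
    define x where "x n = n + nat (- k)" for n
    define y where "y n = n + nat k" for n
    have k: "int (y n) - int (x n) = k" for n by (auto simp: x_def y_def)
    have "(\<lambda>n. Q (x n) (y n) - R (x n) (y n)) \<longlonglongrightarrow> 0 - 0"
      by (intro tendsto_diff rapid_decay_tendsto f g) (auto simp: x_def)
    moreover have "Q (x n) (y n) - R (x n) (y n) = fourier_coeff f k - fourier_coeff g k" for n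
      using e[of "x n" "y n"] k[of n] by (simp add: disc_mat_def algebra_simps)
    ultimately have "(\<lambda>n. fourier_coeff f k - fourier_coeff g k) \<longlonglongrightarrow> 0" by simp
    then show ?thesis by (simp add: LIMSEQ_const_iff)
  qed
  have "(\<lambda>\<theta>. f \<theta> + (-1) * g \<theta>) = (\<lambda>\<theta>. 0)"
  proof (rule fourier_coeff_inj)
    show "continuous_on UNIV (\<lambda>\<theta>. f \<theta> + (-1) * g \<theta>)"
      by (rule smooth_continuous[OF smooth_add[OF f(1) smooth_scale[OF g(1)]]])
    show "f (\<theta> + 2 * pi) + (-1) * g (\<theta> + 2 * pi) = f \<theta> + (-1) * g \<theta>" for \<theta>
      by (simp add: smooth_periodic f g)
    show "fourier_coeff (\<lambda>\<theta>. f \<theta> + (-1) * g \<theta>) k = 0" for k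
      using fourier_coeff_add[OF smooth_continuous[OF f(1)] smooth_continuous[OF smooth_scale[OF g(1), of "-1"]], of k]
      unfolding fourier_coeff_scale fc by simp
  qed
  then show fg: "f = g" by (simp add: fun_eq_iff)
  show "R = Q" using e by (simp add: fg disc_mat_def fun_eq_iff)
qed

text \<open>Injectivity of the map from pairs \<open>(f, R)\<close> to operators reduces the set
  under the infimum to one value, so later estimates treat symbol and matrix separately.\<close>

lemma disc_seminorm_eq:
  assumes "f \<in> smooth_circle_set" "rapid_decay R"
  shows "disc_seminorm k (disc_op f R) = circle_seminorm k f + matrix_seminorm k R"
proof -
  have "{circle_seminorm k g + matrix_seminorm k Q | g Q.
      g \<in> smooth_circle_set \<and> rapid_decay Q \<and> disc_op f R = op_add (toeplitz g) (matrix_op Q)} =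
    {circle_seminorm k f + matrix_seminorm k R}" (is "?L = _")
  proof -
    have "s = circle_seminorm k f + matrix_seminorm k R" if "s \<in> ?L" for s
    proof -
      from that obtain g Q where gQ: "s = circle_seminorm k g + matrix_seminorm k Q"
        "g \<in> smooth_circle_set" "rapid_decay Q" "disc_op f R = op_add (toeplitz g) (matrix_op Q)" by blast
      then have "disc_op f R = disc_op g Q" using toeplitz_plus_matrix by simp
      then show ?thesis using disc_op_inj[OF assms gQ(2,3)] gQ(1) by simp
    qed
    moreover have "circle_seminorm k f + matrix_seminorm k R \<in> ?L"
      using assms toeplitz_plus_matrix by force
    ultimately show ?thesis by blast
  qed
  then show ?thesis by (simp add: disc_seminorm_def)
qed

lemma disc_op_add:
  assumes f: "f \<in> smooth_circle_set" "rapid_decay R" and g: "g \<in> smooth_circle_set" "rapid_decay Q"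
  shows "op_add (disc_op f R) (disc_op g Q) = disc_op (\<lambda>\<theta>. f \<theta> + g \<theta>) (\<lambda>x y. R x y + Q x y)"
proof (rule disc_op_eqI)
  show "op_add (disc_op f R) (disc_op g Q) (basis_vec y) x = disc_mat (\<lambda>\<theta>. f \<theta> + g \<theta>) (\<lambda>x y. R x y + Q x y) x y" for x y
    using fourier_coeff_add[OF smooth_continuous[OF f(1)] smooth_continuous[OF g(1)]]
    by (simp add: op_add_def disc_op_basis disc_mat_def)
qed (use assms in \<open>auto intro!: smooth_add rapid_decay_add bounded_op_add bounded_disc_op\<close>)

lemma disc_op_scale:
  assumes "f \<in> smooth_circle_set" "rapid_decay R"
  shows "op_scale c (disc_op f R) = disc_op (\<lambda>\<theta>. c * f \<theta>) (\<lambda>x y. c * R x y)"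
proof (rule disc_op_eqI)
  show "op_scale c (disc_op f R) (basis_vec y) x = disc_mat (\<lambda>\<theta>. c * f \<theta>) (\<lambda>x y. c * R x y) x y" for x y
    by (simp add: op_scale_def disc_op_basis disc_mat_def fourier_coeff_scale algebra_simps)
qed (use assms in \<open>auto intro!: smooth_scale rapid_decay_scale bounded_op_scale bounded_disc_op\<close>)

lemma disc_op_is_adj:
  assumes "f \<in> smooth_circle_set" "rapid_decay R"
  shows "is_adj UNIV (disc_op f R) (disc_op (\<lambda>\<theta>. cnj (f \<theta>)) (\<lambda>x y. cnj (R y x)))"
proof -
  have "(\<lambda>x y. cnj (disc_mat f R y x)) = disc_mat (\<lambda>\<theta>. cnj (f \<theta>)) (\<lambda>x y. cnj (R y x))"
    by (simp add: fun_eq_iff disc_mat_def fourier_coeff_cnj)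
  then show ?thesis unfolding disc_op_def using is_adj_mat_op[OF schur_disc_mat[OF assms]] by simp
qed

lemma op_id_disc: "op_id UNIV = disc_op (\<lambda>\<theta>. 1) (\<lambda>x y. 0)"
proof (rule disc_op_eqI[OF smooth_const rapid_decay_zero bounded_op_id])
  show "op_id UNIV (basis_vec y) x = disc_mat (\<lambda>\<theta>. 1) (\<lambda>x y. 0) x y" for x y
    using fourier_coeff_cis[of 0 "int y - int x"] by (simp add: op_id_def disc_mat_def) (auto simp: basis_vec_def)
qed


subsection \<open>Products\<close>

definition inv_sq_sum :: real where
  "inv_sq_sum = (\<Sum>\<^sub>\<infinity>n::nat. inverse ((1 + real n)\<^sup>2))"

text \<open>Since \<open>1 + u + v \<le> (1 + u) * (1 + v)\<close>, decay of order
  \<open>k + 2\<close> in both factors pays for two weights at once: \<open>k\<close> powers for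
  \<open>1 + x + y\<close>, the other two for \<open>1 + z\<close>, which makes the sum over
  \<open>z\<close> converge.\<close>

lemma weighted_sum_bound:
  fixes s t :: "nat \<Rightarrow> complex"
  assumes uv: "\<And>z. real x + real y \<le> u z + v z" "\<And>z. real z \<le> u z + v z"
    and u: "\<And>z. 0 \<le> u z" "\<And>z. (1 + u z) ^ (k + 2) * cmod (s z) \<le> A"
    and v: "\<And>z. 0 \<le> v z" "\<And>z. (1 + v z) ^ (k + 2) * cmod (t z) \<le> B"
  shows "(\<lambda>z. s z * t z) summable_on UNIV"
    and "(1 + real x + real y) ^ k * cmod (\<Sum>\<^sub>\<infinity>z. s z * t z) \<le> A * B * inv_sq_sum"
proof -
  let ?W = "(1 + real x + real y) ^ k"
  have b: "?W * cmod (s z * t z) \<le> A * B * inverse ((1 + real z)\<^sup>2)" for z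
  proof (rule le_mult_inverse)
    define m where "m = (1 + u z) * (1 + v z)"
    have "1 + u z + v z \<le> m"
      using mult_nonneg_nonneg[OF u(1) v(1), of z z] by (simp add: m_def algebra_simps)
    then have m: "1 + real x + real y \<le> m" "1 + real z \<le> m" "0 \<le> m"
      using uv[of z] u(1)[of z] v(1)[of z] by linarith+
    have A: "0 \<le> A" by (rule order_trans[OF _ u(2)]) (simp add: u(1))
    have "(1 + real z)\<^sup>2 * (?W * cmod (s z * t z)) \<le> m\<^sup>2 * (m ^ k * cmod (s z * t z))"
      using m by (intro mult_mono power_mono mult_nonneg_nonneg) auto
    also have "\<dots> = ((1 + u z) ^ (k + 2) * cmod (s z)) * ((1 + v z) ^ (k + 2) * cmod (t z))"
      by (simp only: m_def norm_mult power_add power_mult_distrib mult_ac)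
    also have "\<dots> \<le> A * B"
      by (intro mult_mono u v A mult_nonneg_nonneg) (simp_all add: v(1))
    finally show "(1 + real z)\<^sup>2 * (?W * cmod (s z * t z)) \<le> A * B" .
  qed (auto intro!: zero_less_power)
  have W: "1 \<le> ?W" by (rule one_le_power) auto
  have sm: "(\<lambda>z. A * B * inverse ((1 + real z)\<^sup>2)) summable_on UNIV"
    by (intro summable_on_cmult_right summable_inverse_square)
  have "cmod (s z * t z) \<le> ?W * cmod (s z * t z)" for z using mult_right_mono[OF W, of "cmod (s z * t z)"] by simp
  then have abs: "(\<lambda>z. cmod (s z * t z)) summable_on UNIV"
    by (intro summable_on_comparison_test[OF sm]) (auto intro: order_trans[OF _ b])
  then show "(\<lambda>z. s z * t z) summable_on UNIV" by (rule abs_summable_summable)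
  have "?W * cmod (\<Sum>\<^sub>\<infinity>z. s z * t z) \<le> ?W * (\<Sum>\<^sub>\<infinity>z. cmod (s z * t z))"
    using W by (intro mult_left_mono norm_infsum_bound abs) auto
  also have "\<dots> = (\<Sum>\<^sub>\<infinity>z. ?W * cmod (s z * t z))" by (simp add: infsum_cmult_right abs)
  also have "\<dots> \<le> (\<Sum>\<^sub>\<infinity>z. A * B * inverse ((1 + real z)\<^sup>2))"
    by (intro infsum_mono b sm summable_on_cmult_right abs)
  also have "\<dots> = A * B * inv_sq_sum"
    unfolding inv_sq_sum_def by (simp add: infsum_cmult_right summable_inverse_square)
  finally show "?W * cmod (\<Sum>\<^sub>\<infinity>z. s z * t z) \<le> A * B * inv_sq_sum" .
qed

text \<open>The failure of \<open>f \<mapsto> T\<^sub>f\<close> to be multiplicative is a product of two Hankel matrices.\<close>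

lemma toeplitz_product_entry:
  assumes f: "f \<in> smooth_circle_set" and g: "g \<in> smooth_circle_set"
    and h: "(\<lambda>z. fourier_coeff f (- 1 - int z - int x) * fourier_coeff g (int y + 1 + int z)) summable_on UNIV"
  shows "((\<lambda>z. fourier_coeff f (int z - int x) * fourier_coeff g (int y - int z)) has_sum
    fourier_coeff (\<lambda>\<theta>. f \<theta> * g \<theta>) (int y - int x) -
      (\<Sum>\<^sub>\<infinity>z. fourier_coeff f (- 1 - int z - int x) * fourier_coeff g (int y + 1 + int z))) UNIV"
proof -
  let ?n = "int y - int x"
  let ?c = "\<lambda>k. fourier_coeff f k * fourier_coeff g (?n - k)"
  \<comment> \<open>The convolution runs over all integers \<open>k\<close>, the matrix product only
    over \<open>k = z - x\<close> with \<open>z \<ge> 0\<close>. The missing \<open>k < - x\<close>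
    are written as \<open>- 1 - z - x\<close>, so that they too are indexed from 0; they form the
    Hankel part.\<close>
  let ?A = "range (\<lambda>z::nat. int z - int x)" and ?B = "range (\<lambda>z::nat. - 1 - int z - int x)"
  have hs: "(?c has_sum fourier_coeff (\<lambda>\<theta>. f \<theta> * g \<theta>) ?n) UNIV" by (rule fourier_coeff_mult[OF f g])
  have "k \<in> ?A \<union> ?B" for k
  proof (cases "k + int x \<ge> 0")
    case True
    then show ?thesis by (intro UnI1 image_eqI[of _ _ "nat (k + int x)"]) auto
  next
    case False
    then show ?thesis by (intro UnI2 image_eqI[of _ _ "nat (- 1 - k - int x)"]) auto
  qed
  then have U: "UNIV = ?A \<union> ?B" by blast
  have D: "?A \<inter> ?B = {}" by auto
  have iB: "inj (\<lambda>z::nat. - 1 - int z - int x)" and iA: "inj (\<lambda>z::nat. int z - int x)" by (auto simp: inj_on_def)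
  have B: "(?c has_sum (\<Sum>\<^sub>\<infinity>z. fourier_coeff f (- 1 - int z - int x) * fourier_coeff g (int y + 1 + int z))) ?B"
    unfolding has_sum_reindex[OF iB] using has_sum_infsum[OF h] by (simp add: o_def algebra_simps)
  have "?c summable_on ?A" using has_sum_imp_summable[OF hs] by (rule summable_on_subset) simp
  then obtain a where a: "(?c has_sum a) ?A" using summable_on_def by blast
  have "(?c has_sum a + (\<Sum>\<^sub>\<infinity>z. fourier_coeff f (- 1 - int z - int x) * fourier_coeff g (int y + 1 + int z))) UNIV"
    unfolding U by (rule has_sum_Un_disjoint[OF a B D])
  then have "fourier_coeff (\<lambda>\<theta>. f \<theta> * g \<theta>) ?n = a + (\<Sum>\<^sub>\<infinity>z. fourier_coeff f (- 1 - int z - int x) * fourier_coeff g (int y + 1 + int z))"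
    using hs has_sum_unique by blast
  then have "(?c has_sum fourier_coeff (\<lambda>\<theta>. f \<theta> * g \<theta>) ?n - (\<Sum>\<^sub>\<infinity>z. fourier_coeff f (- 1 - int z - int x) * fourier_coeff g (int y + 1 + int z))) ?A"
    using a by simp
  then show ?thesis unfolding has_sum_reindex[OF iA] by (simp add: o_def algebra_simps)
qed

text \<open>The product differs from the Toeplitz operator of \<open>f * g\<close> by four
  corrections: \<open>T1\<close>, \<open>T2\<close>, \<open>T3\<close> from the products with a
  matrix factor, and the Hankel term \<open>T4\<close> with a minus sign. All have the same bound,
  hence the factor 4; \<open>2 ^ (k + 3)\<close> is the Fourier decay constant of order
  \<open>k + 2\<close>, once for each operator.\<close>

lemma disc_op_mult:
  assumes f: "f \<in> smooth_circle_set" and R: "rapid_decay R" and g: "g \<in> smooth_circle_set" and Q: "rapid_decay Q"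
  obtains P where "rapid_decay P" "disc_op f R \<circ> disc_op g Q = disc_op (\<lambda>\<theta>. f \<theta> * g \<theta>) P"
    "\<And>k. matrix_seminorm k P \<le> 4 * (2 ^ (k + 3)) ^ 2 * inv_sq_sum *
      (\<Sum>l\<le>k+2. circle_seminorm l f + matrix_seminorm l R) * (\<Sum>l\<le>k+2. circle_seminorm l g + matrix_seminorm l Q)"
proof -
  \<comment> \<open>One constant bounds both Fourier coefficients and matrix entries at order
    \<open>k + 2\<close>, so that a single estimate serves all four corrections.\<close>
  define a where "a f R k = 2 ^ (k + 3) * (\<Sum>l\<le>k+2. circle_seminorm l f + matrix_seminorm l R)" for f R k
  have fc: "(1 + real_of_int \<bar>n\<bar>) ^ (k + 2) * cmod (fourier_coeff f n) \<le> a f R k"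
    if "f \<in> smooth_circle_set" "rapid_decay R" for f R n k
  proof -
    have "(1 + real_of_int \<bar>n\<bar>) ^ (k + 2) * cmod (fourier_coeff f n) \<le> 2 ^ (k + 3) * (\<Sum>l\<le>k+2. circle_seminorm l f)"
      using fourier_coeff_decay[OF that(1), of n "k + 2"] by (simp add: eval_nat_numeral)
    also have "\<dots> \<le> a f R k"
      unfolding a_def using that by (intro mult_left_mono sum_mono) (auto intro: matrix_seminorm_nonneg)
    finally show ?thesis .
  qed
  have Rb: "(1 + real x + real y) ^ (k + 2) * cmod (R x y) \<le> a f R k"
    if "f \<in> smooth_circle_set" "rapid_decay R" for f R x y k
  proof -
    let ?S = "\<Sum>l\<le>k+2. circle_seminorm l f + matrix_seminorm l R"
    have "matrix_seminorm (k + 2) R \<le> circle_seminorm (k + 2) f + matrix_seminorm (k + 2) R"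
      using that by (simp add: circle_seminorm_nonneg)
    also have "\<dots> \<le> ?S"
      by (rule member_le_sum) (use that in \<open>auto intro!: add_nonneg_nonneg circle_seminorm_nonneg matrix_seminorm_nonneg\<close>)
    finally have 1: "matrix_seminorm (k + 2) R \<le> ?S" .
    have "1 \<le> (2::real) ^ (k + 3)" by (rule one_le_power) simp
    moreover have "0 \<le> ?S"
      by (rule sum_nonneg) (use that in \<open>auto intro!: add_nonneg_nonneg circle_seminorm_nonneg matrix_seminorm_nonneg\<close>)
    ultimately have "?S \<le> a f R k" unfolding a_def using mult_right_mono[of 1 "2 ^ (k + 3)" ?S] by linarith
    with 1 show ?thesis using le_matrix_seminorm[OF that(2), of x y "k + 2"] by linarith
  qed
  define T1 where "T1 x y z = fourier_coeff f (int z - int x) * Q z y" for x y z :: nat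
  define T2 where "T2 x y z = R x z * fourier_coeff g (int y - int z)" for x y z :: nat
  define T3 where "T3 x y z = R x z * Q z y" for x y z :: nat
  define T4 where "T4 x y z = fourier_coeff f (- 1 - int z - int x) * fourier_coeff g (int y + 1 + int z)" for x y z :: nat
  \<comment> \<open>\<open>u\<close> and \<open>v\<close> are the quantities in which the two
    factors decay. Together they must dominate \<open>x + y\<close> and \<open>z\<close>; here this
    is the triangle inequality \<open>x \<le> z + \<bar>z - x\<bar>\<close>.\<close>
  have t1: "T1 x y summable_on UNIV" "(1 + real x + real y) ^ k * cmod (\<Sum>\<^sub>\<infinity>z. T1 x y z) \<le> a f R k * a g Q k * inv_sq_sum" for x y k
    unfolding T1_def
    by (rule weighted_sum_bound[where u = "\<lambda>z. real_of_int \<bar>int z - int x\<bar>" and v = "\<lambda>z. real z + real y" and x = x and y = y and k = k];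
        (rule fc[OF f R] fc[OF g Q] Rb[OF f R, unfolded add.assoc] Rb[OF g Q, unfolded add.assoc] | simp))+
  have t2: "T2 x y summable_on UNIV" "(1 + real x + real y) ^ k * cmod (\<Sum>\<^sub>\<infinity>z. T2 x y z) \<le> a f R k * a g Q k * inv_sq_sum" for x y k
    unfolding T2_def
    by (rule weighted_sum_bound[where u = "\<lambda>z. real x + real z" and v = "\<lambda>z. real_of_int \<bar>int y - int z\<bar>" and x = x and y = y and k = k];
        (rule fc[OF f R] fc[OF g Q] Rb[OF f R, unfolded add.assoc] Rb[OF g Q, unfolded add.assoc] | simp))+
  have t3: "T3 x y summable_on UNIV" "(1 + real x + real y) ^ k * cmod (\<Sum>\<^sub>\<infinity>z. T3 x y z) \<le> a f R k * a g Q k * inv_sq_sum" for x y k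
    unfolding T3_def
    by (rule weighted_sum_bound[where u = "\<lambda>z. real x + real z" and v = "\<lambda>z. real z + real y" and x = x and y = y and k = k];
        (rule fc[OF f R] fc[OF g Q] Rb[OF f R, unfolded add.assoc] Rb[OF g Q, unfolded add.assoc] | simp))+
  have t4: "T4 x y summable_on UNIV" "(1 + real x + real y) ^ k * cmod (\<Sum>\<^sub>\<infinity>z. T4 x y z) \<le> a f R k * a g Q k * inv_sq_sum" for x y k
    unfolding T4_def
    by (rule weighted_sum_bound[where u = "\<lambda>z. real_of_int \<bar>- 1 - int z - int x\<bar>" and v = "\<lambda>z. real_of_int \<bar>int y + 1 + int z\<bar>" and x = x and y = y and k = k];
        (rule fc[OF f R] fc[OF g Q] Rb[OF f R, unfolded add.assoc] Rb[OF g Q, unfolded add.assoc] | simp))+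
  define P where "P x y = infsum (T1 x y) UNIV + infsum (T2 x y) UNIV + infsum (T3 x y) UNIV - infsum (T4 x y) UNIV" for x y
  have Pb: "(1 + real x + real y) ^ k * cmod (P x y) \<le> 4 * (a f R k * a g Q k * inv_sq_sum)" for x y k
  proof -
    have "cmod (P x y) \<le> cmod (infsum (T1 x y) UNIV) + cmod (infsum (T2 x y) UNIV) + cmod (infsum (T3 x y) UNIV) + cmod (infsum (T4 x y) UNIV)"
      unfolding P_def by (intro order_trans[OF norm_triangle_ineq4] add_mono order_trans[OF norm_triangle_ineq] order_refl)
    then have "(1 + real x + real y) ^ k * cmod (P x y) \<le> (1 + real x + real y) ^ k * \<dots>"
      by (rule mult_left_mono) auto
    then show ?thesis using t1(2)[of x y k] t2(2)[of x y k] t3(2)[of x y k] t4(2)[of x y k]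
      unfolding distrib_left by linarith
  qed
  have P: "rapid_decay P" by (rule rapid_decayI) (use Pb in blast)
  have "disc_op f R \<circ> disc_op g Q = disc_op (\<lambda>\<theta>. f \<theta> * g \<theta>) P"
  proof (rule disc_op_eqI[OF smooth_mult[OF f g] P bounded_op_comp[OF bounded_disc_op[OF f R] bounded_disc_op[OF g Q]]])
    fix x y
    have "(disc_op f R \<circ> disc_op g Q) (basis_vec y) x = (\<Sum>\<^sub>\<infinity>z. disc_mat f R x z * disc_mat g Q z y)"
      using mat_op_comp_basis[OF bounded_disc_op[OF g Q], of x y "disc_mat f R"]
      by (simp add: disc_op_def[of f R, symmetric] disc_op_basis)
    also have "\<dots> = (\<Sum>\<^sub>\<infinity>z. fourier_coeff f (int z - int x) * fourier_coeff g (int y - int z) + (T1 x y z + (T2 x y z + T3 x y z)))"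
      by (simp add: disc_mat_def T1_def T2_def T3_def algebra_simps)
    also have "\<dots> = disc_mat (\<lambda>\<theta>. f \<theta> * g \<theta>) P x y"
    proof (rule infsumI)
      have T4: "infsum (T4 x y) UNIV = (\<Sum>\<^sub>\<infinity>z. fourier_coeff f (- 1 - int z - int x) * fourier_coeff g (int y + 1 + int z))"
        by (simp add: T4_def[abs_def])
      have "((\<lambda>z. fourier_coeff f (int z - int x) * fourier_coeff g (int y - int z) + (T1 x y z + (T2 x y z + T3 x y z))) has_sum
          (fourier_coeff (\<lambda>\<theta>. f \<theta> * g \<theta>) (int y - int x) - infsum (T4 x y) UNIV) +
          (infsum (T1 x y) UNIV + (infsum (T2 x y) UNIV + infsum (T3 x y) UNIV))) UNIV"
        unfolding T4
        by (intro has_sum_add has_sum_infsum toeplitz_product_entry[OF f g t4(1)[unfolded T4_def]] t1(1) t2(1) t3(1))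
      then show "((\<lambda>z. fourier_coeff f (int z - int x) * fourier_coeff g (int y - int z) + (T1 x y z + (T2 x y z + T3 x y z))) has_sum
          disc_mat (\<lambda>\<theta>. f \<theta> * g \<theta>) P x y) UNIV"
        by (simp add: disc_mat_def P_def algebra_simps)
    qed
    finally show "(disc_op f R \<circ> disc_op g Q) (basis_vec y) x = disc_mat (\<lambda>\<theta>. f \<theta> * g \<theta>) P x y" .
  qed
  moreover have "matrix_seminorm k P \<le> 4 * (2 ^ (k + 3)) ^ 2 * inv_sq_sum *
      (\<Sum>l\<le>k+2. circle_seminorm l f + matrix_seminorm l R) * (\<Sum>l\<le>k+2. circle_seminorm l g + matrix_seminorm l Q)" for k
    using matrix_seminorm_le[OF Pb, of k] unfolding a_def by (simp only: power2_eq_square mult_ac)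
  ultimately show ?thesis using that P by blast
qed


section \<open>Finite sums of elementary tensors\<close>

text \<open>The given seminorms need not increase with the order, their partial sums do; bounds
  obtained at different orders can then be merged at the maximum.\<close>

definition total_seminorm :: "'a frechet_alg \<Rightarrow> nat \<Rightarrow> 'a \<Rightarrow> real" where
  "total_seminorm A k x = (\<Sum>l\<le>k. seminorm A l x)"

lemma linear_form_onD:
  assumes "linear_form_on A \<phi>"
  shows "x \<in> alg_set A \<Longrightarrow> y \<in> alg_set A \<Longrightarrow> \<phi> (alg_add A x y) = \<phi> x + \<phi> y"
    and "x \<in> alg_set A \<Longrightarrow> \<phi> (alg_scale A c x) = c * \<phi> x"
  using assms by (auto simp: linear_form_on_def)

text \<open>The order \<open>k'\<close> in \<open>seminorm_mult\<close> may exceed \<open>k\<close>,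
  as it does for the disc. \<open>seminorm_zero\<close> serves to pad a finite sum of tensors to an
  absolutely convergent series.\<close>

locale frechet_star_alg =
  fixes A :: "'a frechet_alg"
  assumes add_in: "x \<in> alg_set A \<Longrightarrow> y \<in> alg_set A \<Longrightarrow> alg_add A x y \<in> alg_set A"
    and scale_in: "x \<in> alg_set A \<Longrightarrow> alg_scale A c x \<in> alg_set A"
    and mult_in: "x \<in> alg_set A \<Longrightarrow> y \<in> alg_set A \<Longrightarrow> alg_mult A x y \<in> alg_set A"
    and star_in: "x \<in> alg_set A \<Longrightarrow> alg_star A x \<in> alg_set A"
    and one_in: "alg_one A \<in> alg_set A"
    and mult_add_right: "x \<in> alg_set A \<Longrightarrow> y \<in> alg_set A \<Longrightarrow> z \<in> alg_set A \<Longrightarrow>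
      alg_mult A x (alg_add A y z) = alg_add A (alg_mult A x y) (alg_mult A x z)"
    and mult_add_left: "x \<in> alg_set A \<Longrightarrow> y \<in> alg_set A \<Longrightarrow> z \<in> alg_set A \<Longrightarrow>
      alg_mult A (alg_add A y z) x = alg_add A (alg_mult A y x) (alg_mult A z x)"
    and mult_scale_right: "x \<in> alg_set A \<Longrightarrow> y \<in> alg_set A \<Longrightarrow>
      alg_mult A x (alg_scale A c y) = alg_scale A c (alg_mult A x y)"
    and mult_scale_left: "x \<in> alg_set A \<Longrightarrow> y \<in> alg_set A \<Longrightarrow>
      alg_mult A (alg_scale A c x) y = alg_scale A c (alg_mult A x y)"
    and star_add: "x \<in> alg_set A \<Longrightarrow> y \<in> alg_set A \<Longrightarrow>
      alg_star A (alg_add A x y) = alg_add A (alg_star A x) (alg_star A y)"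
    and star_scale: "x \<in> alg_set A \<Longrightarrow> alg_star A (alg_scale A c x) = alg_scale A (cnj c) (alg_star A x)"
    and seminorm_nonneg: "x \<in> alg_set A \<Longrightarrow> 0 \<le> seminorm A k x"
    and seminorm_zero: "x \<in> alg_set A \<Longrightarrow> seminorm A k (alg_scale A 0 x) = 0"
    and seminorm_mult: "\<exists>D k'. \<forall>x\<in>alg_set A. \<forall>y\<in>alg_set A.
      seminorm A k (alg_mult A x y) \<le> D * total_seminorm A k' x * total_seminorm A k' y"
    and seminorm_star: "x \<in> alg_set A \<Longrightarrow> seminorm A k (alg_star A x) \<le> seminorm A k x"
begin

lemma total_seminorm_nonneg: "x \<in> alg_set A \<Longrightarrow> 0 \<le> total_seminorm A k x"
  by (simp add: total_seminorm_def sum_nonneg seminorm_nonneg)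

lemma total_seminorm_mono: "x \<in> alg_set A \<Longrightarrow> k \<le> k' \<Longrightarrow> total_seminorm A k x \<le> total_seminorm A k' x"
  unfolding total_seminorm_def by (rule sum_mono2) (auto simp: seminorm_nonneg)

lemma total_seminorm_mult:
  "\<exists>D k'. 0 \<le> D \<and> (\<forall>x\<in>alg_set A. \<forall>y\<in>alg_set A.
     total_seminorm A k (alg_mult A x y) \<le> D * total_seminorm A k' x * total_seminorm A k' y)"
proof (induction k)
  have *: "\<exists>D k'. 0 \<le> D \<and> (\<forall>x\<in>alg_set A. \<forall>y\<in>alg_set A.
      seminorm A k (alg_mult A x y) \<le> D * total_seminorm A k' x * total_seminorm A k' y)" for k
  proof -
    obtain D k' where D: "\<forall>x\<in>alg_set A. \<forall>y\<in>alg_set A.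
        seminorm A k (alg_mult A x y) \<le> D * total_seminorm A k' x * total_seminorm A k' y"
      using seminorm_mult by blast
    have "seminorm A k (alg_mult A x y) \<le> \<bar>D\<bar> * total_seminorm A k' x * total_seminorm A k' y"
      if "x \<in> alg_set A" "y \<in> alg_set A" for x y
      by (rule order_trans[OF D[rule_format, OF that]])
        (intro mult_right_mono total_seminorm_nonneg that, simp)
    then show ?thesis by (intro exI[of _ "\<bar>D\<bar>"] exI[of _ k']) auto
  qed
  case 0
  show ?case using *[of 0] by (simp add: total_seminorm_def[of A 0])
  case (Suc k)
  obtain D k' where D: "0 \<le> D" "\<forall>x\<in>alg_set A. \<forall>y\<in>alg_set A.
      total_seminorm A k (alg_mult A x y) \<le> D * total_seminorm A k' x * total_seminorm A k' y"
    using Suc by blast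
  obtain E l where E: "0 \<le> E" "\<forall>x\<in>alg_set A. \<forall>y\<in>alg_set A.
      seminorm A (Suc k) (alg_mult A x y) \<le> E * total_seminorm A l x * total_seminorm A l y"
    using * by blast
  let ?m = "max k' l"
  have "total_seminorm A (Suc k) (alg_mult A x y) \<le> (D + E) * total_seminorm A ?m x * total_seminorm A ?m y"
    if x: "x \<in> alg_set A" and y: "y \<in> alg_set A" for x y
  proof -
    have "total_seminorm A (Suc k) (alg_mult A x y) \<le>
        D * total_seminorm A k' x * total_seminorm A k' y + E * total_seminorm A l x * total_seminorm A l y"
      using bspec[OF bspec[OF D(2) x] y] bspec[OF bspec[OF E(2) x] y] by (simp add: total_seminorm_def)
    also have "\<dots> \<le> D * total_seminorm A ?m x * total_seminorm A ?m y + E * total_seminorm A ?m x * total_seminorm A ?m y"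
      using D(1) E(1) x y
      by (intro add_mono mult_mono order_refl total_seminorm_mono total_seminorm_nonneg mult_nonneg_nonneg) auto
    finally show ?thesis by (simp add: algebra_simps)
  qed
  then show ?case using D(1) E(1) by (intro exI[of _ "D + E"] exI[of _ ?m]) auto
qed

text \<open>Continuous maps that are linear (\<open>\<kappa> = id\<close>) or antilinear (\<open>\<kappa> = cnj\<close>).\<close>

definition cont_map :: "(complex \<Rightarrow> complex) \<Rightarrow> ('a \<Rightarrow> 'a) \<Rightarrow> bool" where
  "cont_map \<kappa> F \<longleftrightarrow> (\<forall>x\<in>alg_set A. F x \<in> alg_set A) \<and>
     (\<forall>x\<in>alg_set A. \<forall>y\<in>alg_set A. F (alg_add A x y) = alg_add A (F x) (F y)) \<and>
     (\<forall>c. \<forall>x\<in>alg_set A. F (alg_scale A c x) = alg_scale A (\<kappa> c) (F x)) \<and>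
     (\<forall>k. \<exists>D k'. 0 \<le> D \<and> (\<forall>x\<in>alg_set A. total_seminorm A k (F x) \<le> D * total_seminorm A k' x))"

lemma cont_mapD:
  assumes "cont_map \<kappa> F"
  shows "x \<in> alg_set A \<Longrightarrow> F x \<in> alg_set A"
    and "\<exists>D k'. 0 \<le> D \<and> (\<forall>x\<in>alg_set A. total_seminorm A k (F x) \<le> D * total_seminorm A k' x)"
  using assms by (simp_all add: cont_map_def)

lemma cont_map_mult_left:
  assumes x: "x \<in> alg_set A"
  shows "cont_map id (alg_mult A x)"
proof -
  have "\<exists>D k'. 0 \<le> D \<and> (\<forall>y\<in>alg_set A. total_seminorm A k (alg_mult A x y) \<le> D * total_seminorm A k' y)" for k
  proof -
    obtain D k' where "0 \<le> D" "\<forall>x\<in>alg_set A. \<forall>y\<in>alg_set A.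
        total_seminorm A k (alg_mult A x y) \<le> D * total_seminorm A k' x * total_seminorm A k' y"
      using total_seminorm_mult by blast
    then show ?thesis using x total_seminorm_nonneg[OF x]
      by (intro exI[of _ "D * total_seminorm A k' x"] exI[of _ k']) auto
  qed
  then show ?thesis using x by (simp add: cont_map_def mult_in mult_add_right mult_scale_right)
qed

lemma cont_map_mult_right:
  assumes y: "y \<in> alg_set A"
  shows "cont_map id (\<lambda>x. alg_mult A x y)"
proof -
  have "\<exists>D k'. 0 \<le> D \<and> (\<forall>x\<in>alg_set A. total_seminorm A k (alg_mult A x y) \<le> D * total_seminorm A k' x)" for k
  proof -
    obtain D k' where "0 \<le> D" "\<forall>x\<in>alg_set A. \<forall>y\<in>alg_set A.
        total_seminorm A k (alg_mult A x y) \<le> D * total_seminorm A k' x * total_seminorm A k' y"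
      using total_seminorm_mult by blast
    then show ?thesis using y total_seminorm_nonneg[OF y]
      by (intro exI[of _ "D * total_seminorm A k' y"] exI[of _ k']) (auto simp: mult_ac)
  qed
  then show ?thesis using y by (simp add: cont_map_def mult_in mult_add_left mult_scale_left)
qed

lemma cont_map_star: "cont_map cnj (alg_star A)"
proof -
  have "total_seminorm A k (alg_star A x) \<le> 1 * total_seminorm A k x" if "x \<in> alg_set A" for k x
    unfolding total_seminorm_def using seminorm_star[OF that] by (simp add: sum_mono)
  then have "\<forall>k. \<exists>D k'. 0 \<le> D \<and> (\<forall>x\<in>alg_set A. total_seminorm A k (alg_star A x) \<le> D * total_seminorm A k' x)"
    by (meson zero_le_one)
  then show ?thesis by (simp add: cont_map_def star_in star_add star_scale)
qed

lemma cont_map_linear_form: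
  assumes "cont_map \<kappa> F" "linear_form_on A \<phi>" "\<kappa> = id \<or> \<kappa> = cnj"
  shows "linear_form_on A (\<lambda>x. \<kappa> (\<phi> (F x)))"
  using assms unfolding cont_map_def linear_form_on_def by auto

end

type_synonym ('x, 'y, 'z) tensor_list = "(complex \<times> 'x \<times> 'y \<times> 'z) list"

locale tensor_factors =
  A: frechet_star_alg A + B: frechet_star_alg B + C: frechet_star_alg C
  for A :: "'a frechet_alg" and B :: "'b frechet_alg" and C :: "'c frechet_alg"
begin

abbreviation trilinear :: "('a \<Rightarrow> 'b \<Rightarrow> 'c \<Rightarrow> complex) set" where
  "trilinear \<equiv> cont_trilinear A B C"

definition bounded_by :: "('a \<Rightarrow> 'b \<Rightarrow> 'c \<Rightarrow> complex) \<Rightarrow> real \<Rightarrow> nat \<Rightarrow> bool" where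
  "bounded_by \<phi> M k \<longleftrightarrow> 0 \<le> M \<and> (\<forall>a\<in>alg_set A. \<forall>b\<in>alg_set B. \<forall>c\<in>alg_set C.
     cmod (\<phi> a b c) \<le> M * (total_seminorm A k a * total_seminorm B k b * total_seminorm C k c))"

lemma bounded_by_mono:
  assumes "bounded_by \<phi> M k" "k \<le> k'"
  shows "bounded_by \<phi> M k'"
proof -
  have "cmod (\<phi> a b c) \<le> M * (total_seminorm A k' a * total_seminorm B k' b * total_seminorm C k' c)"
    if "a \<in> alg_set A" "b \<in> alg_set B" "c \<in> alg_set C" for a b c
  proof -
    have "cmod (\<phi> a b c) \<le> M * (total_seminorm A k a * total_seminorm B k b * total_seminorm C k c)"
      using assms(1) that unfolding bounded_by_def by blast
    also have "\<dots> \<le> M * (total_seminorm A k' a * total_seminorm B k' b * total_seminorm C k' c)"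
      using assms that unfolding bounded_by_def
      by (intro mult_left_mono mult_mono A.total_seminorm_mono B.total_seminorm_mono C.total_seminorm_mono
          A.total_seminorm_nonneg B.total_seminorm_nonneg C.total_seminorm_nonneg mult_nonneg_nonneg) auto
    finally show ?thesis .
  qed
  then show ?thesis using assms(1) unfolding bounded_by_def by blast
qed

lemma trilinear_iff:
  "\<phi> \<in> trilinear \<longleftrightarrow>
     (\<forall>b\<in>alg_set B. \<forall>c\<in>alg_set C. linear_form_on A (\<lambda>a. \<phi> a b c)) \<and>
     (\<forall>a\<in>alg_set A. \<forall>c\<in>alg_set C. linear_form_on B (\<lambda>b. \<phi> a b c)) \<and>
     (\<forall>a\<in>alg_set A. \<forall>b\<in>alg_set B. linear_form_on C (\<lambda>c. \<phi> a b c)) \<and> (\<exists>M k. bounded_by \<phi> M k)"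
proof -
  have "(\<exists>M k. \<forall>a\<in>alg_set A. \<forall>b\<in>alg_set B. \<forall>c\<in>alg_set C. cmod (\<phi> a b c) \<le>
      M * (\<Sum>l\<le>k. seminorm A l a) * (\<Sum>l\<le>k. seminorm B l b) * (\<Sum>l\<le>k. seminorm C l c)) \<longleftrightarrow>
    (\<exists>M k. bounded_by \<phi> M k)" (is "?L \<longleftrightarrow> ?R")
  proof
    assume ?L
    then obtain M k where M: "\<forall>a\<in>alg_set A. \<forall>b\<in>alg_set B. \<forall>c\<in>alg_set C.
      cmod (\<phi> a b c) \<le> M * (total_seminorm A k a * total_seminorm B k b * total_seminorm C k c)"
      unfolding total_seminorm_def mult.assoc by blast
    have "cmod (\<phi> a b c) \<le> \<bar>M\<bar> * (total_seminorm A k a * total_seminorm B k b * total_seminorm C k c)"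
      if "a \<in> alg_set A" "b \<in> alg_set B" "c \<in> alg_set C" for a b c
      by (rule order_trans[OF M[rule_format, OF that]])
        (intro mult_right_mono mult_nonneg_nonneg A.total_seminorm_nonneg B.total_seminorm_nonneg
          C.total_seminorm_nonneg that, simp)
    then have "bounded_by \<phi> \<bar>M\<bar> k" unfolding bounded_by_def by auto
    then show ?R by blast
  next
    assume ?R
    then obtain M k where "bounded_by \<phi> M k" by blast
    then have "\<forall>a\<in>alg_set A. \<forall>b\<in>alg_set B. \<forall>c\<in>alg_set C. cmod (\<phi> a b c) \<le>
      M * (\<Sum>l\<le>k. seminorm A l a) * (\<Sum>l\<le>k. seminorm B l b) * (\<Sum>l\<le>k. seminorm C l c)"
      unfolding bounded_by_def total_seminorm_def mult.assoc by blast
    then show ?L by blast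
  qed
  then show ?thesis unfolding cont_trilinear_def by simp
qed

lemma trilinearD:
  assumes "\<phi> \<in> trilinear"
  shows "b \<in> alg_set B \<Longrightarrow> c \<in> alg_set C \<Longrightarrow> linear_form_on A (\<lambda>a. \<phi> a b c)"
    and "a \<in> alg_set A \<Longrightarrow> c \<in> alg_set C \<Longrightarrow> linear_form_on B (\<lambda>b. \<phi> a b c)"
    and "a \<in> alg_set A \<Longrightarrow> b \<in> alg_set B \<Longrightarrow> linear_form_on C (\<lambda>c. \<phi> a b c)"
    and "\<exists>M k. bounded_by \<phi> M k"
  using assms unfolding trilinear_iff by blast+

text \<open>Forms are total functions, with junk values off the algebras. Membership in
  \<open>trilinear\<close> does not see these values, so a form may be exchanged for a more
  convenient one.\<close>

lemma trilinear_cong: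
  assumes "\<And>a b c. a \<in> alg_set A \<Longrightarrow> b \<in> alg_set B \<Longrightarrow> c \<in> alg_set C \<Longrightarrow> \<phi> a b c = \<psi> a b c"
    and "\<phi> \<in> trilinear"
  shows "\<psi> \<in> trilinear"
proof -
  have "\<exists>M k. bounded_by \<psi> M k"
    using trilinearD(4)[OF assms(2)] assms(1) unfolding bounded_by_def by auto
  then show ?thesis
    using trilinearD(1-3)[OF assms(2)] assms(1) unfolding trilinear_iff linear_form_on_def
    by (simp add: A.add_in B.add_in C.add_in A.scale_in B.scale_in C.scale_in)
qed

lemma trilinear_zero: "(\<lambda>a b c. 0) \<in> trilinear"
  unfolding trilinear_iff by (auto simp: linear_form_on_def bounded_by_def intro!: exI[of _ 0])

lemma trilinear_add_scale:
  assumes "\<phi> \<in> trilinear" "\<psi> \<in> trilinear"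
  shows "(\<lambda>a b c. z * \<phi> a b c + \<psi> a b c) \<in> trilinear"
proof -
  obtain M k M' k' where "bounded_by \<phi> M k" "bounded_by \<psi> M' k'"
    using trilinearD(4)[OF assms(1)] trilinearD(4)[OF assms(2)] by blast
  then have b: "bounded_by \<phi> M (max k k')" "bounded_by \<psi> M' (max k k')"
    by (auto intro: bounded_by_mono)
  have "bounded_by (\<lambda>a b c. z * \<phi> a b c + \<psi> a b c) (cmod z * M + M') (max k k')"
    unfolding bounded_by_def
  proof (intro conjI ballI)
    fix a b' c assume in_: "a \<in> alg_set A" "b' \<in> alg_set B" "c \<in> alg_set C"
    let ?N = "total_seminorm A (max k k') a * total_seminorm B (max k k') b' * total_seminorm C (max k k') c"
    have "cmod (\<phi> a b' c) \<le> M * ?N" "cmod (\<psi> a b' c) \<le> M' * ?N"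
      using b in_ unfolding bounded_by_def by blast+
    then have "cmod z * cmod (\<phi> a b' c) + cmod (\<psi> a b' c) \<le> cmod z * (M * ?N) + M' * ?N"
      by (intro add_mono mult_left_mono) auto
    then show "cmod (z * \<phi> a b' c + \<psi> a b' c) \<le> (cmod z * M + M') * ?N"
      using norm_triangle_ineq[of "z * \<phi> a b' c" "\<psi> a b' c"] by (simp add: norm_mult algebra_simps)
  qed (use b in \<open>auto simp: bounded_by_def\<close>)
  then show ?thesis
    using trilinearD(1-3)[OF assms(1)] trilinearD(1-3)[OF assms(2)]
    unfolding trilinear_iff linear_form_on_def by (auto simp: algebra_simps)
qed

lemma trilinear_sum_list:
  assumes "\<And>p. p \<in> set L \<Longrightarrow> \<phi> p \<in> trilinear"
  shows "(\<lambda>a b c. \<Sum>p\<leftarrow>L. z p * \<phi> p a b c) \<in> trilinear"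
  using assms
  by (induction L) (auto intro: trilinear_zero trilinear_add_scale)

text \<open>One statement covers multiplications (\<open>\<kappa> = id\<close>) and involutions
  (\<open>\<kappa> = cnj\<close>, where the outer conjugation compensates the antilinearity of the
  maps).\<close>

lemma trilinear_comp:
  assumes \<phi>: "\<phi> \<in> trilinear" and \<kappa>: "\<kappa> = id \<or> \<kappa> = cnj"
    and F: "A.cont_map \<kappa> F" and G: "B.cont_map \<kappa> G" and H: "C.cont_map \<kappa> H"
  shows "(\<lambda>a b c. \<kappa> (\<phi> (F a) (G b) (H c))) \<in> trilinear"
proof -
  have in_: "a \<in> alg_set A \<Longrightarrow> F a \<in> alg_set A" "b \<in> alg_set B \<Longrightarrow> G b \<in> alg_set B"
    "c \<in> alg_set C \<Longrightarrow> H c \<in> alg_set C" for a b c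
    using A.cont_mapD(1)[OF F] B.cont_mapD(1)[OF G] C.cont_mapD(1)[OF H] by auto
  obtain M k where M: "bounded_by \<phi> M k" using trilinearD(4)[OF \<phi>] by blast
  obtain D1 k1 where D1: "0 \<le> D1" "\<forall>x\<in>alg_set A. total_seminorm A k (F x) \<le> D1 * total_seminorm A k1 x"
    using A.cont_mapD(2)[OF F, of k] by blast
  obtain D2 k2 where D2: "0 \<le> D2" "\<forall>x\<in>alg_set B. total_seminorm B k (G x) \<le> D2 * total_seminorm B k2 x"
    using B.cont_mapD(2)[OF G, of k] by blast
  obtain D3 k3 where D3: "0 \<le> D3" "\<forall>x\<in>alg_set C. total_seminorm C k (H x) \<le> D3 * total_seminorm C k3 x"
    using C.cont_mapD(2)[OF H, of k] by blast
  define m where "m = max k1 (max k2 k3)"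
  have "bounded_by (\<lambda>a b c. \<kappa> (\<phi> (F a) (G b) (H c))) (M * (D1 * D2 * D3)) m"
    unfolding bounded_by_def
  proof (intro conjI ballI)
    show "0 \<le> M * (D1 * D2 * D3)" using M D1 D2 D3 by (auto simp: bounded_by_def)
    fix a b c assume abc: "a \<in> alg_set A" "b \<in> alg_set B" "c \<in> alg_set C"
    have 1: "total_seminorm A k (F a) \<le> D1 * total_seminorm A m a"
      by (rule order_trans[OF bspec[OF D1(2) abc(1)]])
        (intro mult_left_mono A.total_seminorm_mono abc D1(1), simp add: m_def)
    have 2: "total_seminorm B k (G b) \<le> D2 * total_seminorm B m b"
      by (rule order_trans[OF bspec[OF D2(2) abc(2)]])
        (intro mult_left_mono B.total_seminorm_mono abc D2(1), simp add: m_def)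
    have 3: "total_seminorm C k (H c) \<le> D3 * total_seminorm C m c"
      by (rule order_trans[OF bspec[OF D3(2) abc(3)]])
        (intro mult_left_mono C.total_seminorm_mono abc D3(1), simp add: m_def)
    note nn = A.total_seminorm_nonneg B.total_seminorm_nonneg C.total_seminorm_nonneg
    have "cmod (\<kappa> (\<phi> (F a) (G b) (H c))) = cmod (\<phi> (F a) (G b) (H c))" using \<kappa> by auto
    also have "\<dots> \<le> M * (total_seminorm A k (F a) * total_seminorm B k (G b) * total_seminorm C k (H c))"
      using M in_ abc unfolding bounded_by_def by blast
    also have "\<dots> \<le> M * ((D1 * total_seminorm A m a) * (D2 * total_seminorm B m b) * (D3 * total_seminorm C m c))"
      using M D1(1) D2(1) D3(1) abc
      by (intro mult_left_mono mult_mono 1 2 3 nn in_ mult_nonneg_nonneg) (auto simp: bounded_by_def)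
    finally show "cmod (\<kappa> (\<phi> (F a) (G b) (H c))) \<le> M * (D1 * D2 * D3) *
        (total_seminorm A m a * total_seminorm B m b * total_seminorm C m c)"
      by (simp add: mult_ac)
  qed
  then show ?thesis
    unfolding trilinear_iff
    using A.cont_map_linear_form[OF F trilinearD(1)[OF \<phi>] \<kappa>] B.cont_map_linear_form[OF G trilinearD(2)[OF \<phi>] \<kappa>]
      C.cont_map_linear_form[OF H trilinearD(3)[OF \<phi>] \<kappa>] in_ by blast
qed

lemma trilinear_mult_left:
  assumes "\<phi> \<in> trilinear" "a \<in> alg_set A" "b \<in> alg_set B" "c \<in> alg_set C"
  shows "(\<lambda>a' b' c'. \<phi> (alg_mult A a a') (alg_mult B b b') (alg_mult C c c')) \<in> trilinear"
  using trilinear_comp[OF assms(1) _ A.cont_map_mult_left[OF assms(2)] B.cont_map_mult_left[OF assms(3)]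
      C.cont_map_mult_left[OF assms(4)]] by simp

lemma trilinear_mult_right:
  assumes "\<phi> \<in> trilinear" "a' \<in> alg_set A" "b' \<in> alg_set B" "c' \<in> alg_set C"
  shows "(\<lambda>a b c. \<phi> (alg_mult A a a') (alg_mult B b b') (alg_mult C c c')) \<in> trilinear"
  using trilinear_comp[OF assms(1) _ A.cont_map_mult_right[OF assms(2)] B.cont_map_mult_right[OF assms(3)]
      C.cont_map_mult_right[OF assms(4)]] by simp

lemma trilinear_star:
  assumes "\<phi> \<in> trilinear"
  shows "(\<lambda>a b c. cnj (\<phi> (alg_star A a) (alg_star B b) (alg_star C c))) \<in> trilinear"
  using trilinear_comp[OF assms _ A.cont_map_star B.cont_map_star C.cont_map_star] by simp

definition terms_in :: "('a, 'b, 'c) tensor_list \<Rightarrow> bool" where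
  "terms_in L \<longleftrightarrow> (\<forall>(z, a, b, c)\<in>set L. a \<in> alg_set A \<and> b \<in> alg_set B \<and> c \<in> alg_set C)"

definition tensor_sum :: "('a, 'b, 'c) tensor_list \<Rightarrow> ('a, 'b, 'c) tensor" where
  "tensor_sum L = (\<lambda>\<phi>. \<Sum>(z, a, b, c)\<leftarrow>L. z * elem_tensor A B C a b c \<phi>)"

lemma tensor_sum_eq:
  "tensor_sum L \<phi> = (if \<phi> \<in> trilinear then (\<Sum>(z, a, b, c)\<leftarrow>L. z * \<phi> a b c) else 0)"
  by (induction L) (auto simp: tensor_sum_def elem_tensor_def)

lemma tensor_sum_append: "tensor_sum (L @ L') = alg_add (tensor_alg A B C) (tensor_sum L) (tensor_sum L')"
  by (simp add: tensor_alg_def fun_eq_iff tensor_sum_def)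

lemma tensor_sum_scale:
  "tensor_sum (map (\<lambda>(z, t). (w * z, t)) L) = alg_scale (tensor_alg A B C) w (tensor_sum L)"
proof
  fix \<phi>
  show "tensor_sum (map (\<lambda>(z, t). (w * z, t)) L) \<phi> = alg_scale (tensor_alg A B C) w (tensor_sum L) \<phi>"
    by (induction L) (auto simp: tensor_alg_def tensor_sum_def algebra_simps)
qed

definition terms_mult :: "('a, 'b, 'c) tensor_list \<Rightarrow> ('a, 'b, 'c) tensor_list \<Rightarrow> ('a, 'b, 'c) tensor_list" where
  "terms_mult L L' = concat (map (\<lambda>(z, a, b, c). map (\<lambda>(z', a', b', c').
     (z * z', alg_mult A a a', alg_mult B b b', alg_mult C c c')) L') L)"

definition terms_star :: "('a, 'b, 'c) tensor_list \<Rightarrow> ('a, 'b, 'c) tensor_list" where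
  "terms_star L = map (\<lambda>(z, a, b, c). (cnj z, alg_star A a, alg_star B b, alg_star C c)) L"

lemma sum_list_cong_on: "(\<And>x. x \<in> set L \<Longrightarrow> f x = g x) \<Longrightarrow> (\<Sum>x\<leftarrow>L. f x) = (\<Sum>x\<leftarrow>L. (g x :: complex))"
  by (metis map_cong)

lemma sum_terms_mult:
  "(\<Sum>(z, a, b, c)\<leftarrow>terms_mult L L'. z * \<phi> a b c) =
    (\<Sum>(z, a, b, c)\<leftarrow>L. z * (\<Sum>(z', a', b', c')\<leftarrow>L'. z' * \<phi> (alg_mult A a a') (alg_mult B b b') (alg_mult C c c')))"
proof (induction L)
  case (Cons p L)
  obtain z a b c where p: "p = (z, a, b, c)" by (cases p)
  have "(\<Sum>(z, a, b, c)\<leftarrow>map (\<lambda>(z', a', b', c').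
     (z * z', alg_mult A a a', alg_mult B b b', alg_mult C c c')) L'. z * \<phi> a b c) =
    z * (\<Sum>(z', a', b', c')\<leftarrow>L'. z' * \<phi> (alg_mult A a a') (alg_mult B b b') (alg_mult C c c'))"
    by (induction L') (auto simp: algebra_simps)
  then show ?case using Cons by (simp add: p terms_mult_def)
qed (simp add: terms_mult_def)

text \<open>The outer tensor is 0 off \<open>trilinear\<close>, so the point is that applying the
  inner tensor yields a continuous trilinear form again. On the algebras it is a finite sum of
  \<open>\<phi>\<close> composed with right multiplications, which are continuous.\<close>

lemma tensor_mult_sum:
  assumes L: "terms_in L" and L': "terms_in L'"
  shows "tensor_mult A B C (tensor_sum L) (tensor_sum L') = tensor_sum (terms_mult L L')"
proof
  fix \<phi>
  show "tensor_mult A B C (tensor_sum L) (tensor_sum L') \<phi> = tensor_sum (terms_mult L L') \<phi>"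
  proof (cases "\<phi> \<in> trilinear")
    case True
    define \<eta> where "\<eta> a b c = tensor_sum L' (\<lambda>a' b' c'. \<phi> (alg_mult A a a') (alg_mult B b b') (alg_mult C c c'))" for a b c
    \<comment> \<open>\<open>\<eta>\<close> is what the definition of the product produces and may
      take the default value 0 off the algebras; \<open>\<eta>'\<close> is the plain sum, whose
      trilinearity can be seen directly. They agree on the algebras.\<close>
    define \<eta>' where "\<eta>' a b c = (\<Sum>(z', a', b', c')\<leftarrow>L'. z' * \<phi> (alg_mult A a a') (alg_mult B b b') (alg_mult C c c'))" for a b c
    have eq: "\<eta>' a b c = \<eta> a b c" if "a \<in> alg_set A" "b \<in> alg_set B" "c \<in> alg_set C" for a b c
      using trilinear_mult_left[OF True that] by (simp add: \<eta>_def \<eta>'_def tensor_sum_eq)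
    have "(\<lambda>a b c. \<Sum>p\<leftarrow>L'. fst p * (case p of (z', a', b', c') \<Rightarrow> \<lambda>a b c.
        \<phi> (alg_mult A a a') (alg_mult B b b') (alg_mult C c c')) a b c) \<in> trilinear"
      by (rule trilinear_sum_list) (use L' True in \<open>auto simp: terms_in_def intro!: trilinear_mult_right\<close>)
    then have "\<eta>' \<in> trilinear" by (simp add: \<eta>'_def[abs_def] case_prod_unfold)
    then have \<eta>: "\<eta> \<in> trilinear" by (rule trilinear_cong[rotated]) (rule eq)
    have "tensor_mult A B C (tensor_sum L) (tensor_sum L') \<phi> = tensor_sum L \<eta>"
      using True by (simp add: tensor_mult_def \<eta>_def[abs_def])
    also have "\<dots> = (\<Sum>(z, a, b, c)\<leftarrow>L. z * \<eta>' a b c)"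
      using \<eta> L eq by (auto simp: tensor_sum_eq terms_in_def intro!: sum_list_cong_on)
    also have "\<dots> = tensor_sum (terms_mult L L') \<phi>"
      unfolding \<eta>'_def sum_terms_mult[symmetric] using True by (simp add: tensor_sum_eq)
    finally show ?thesis .
  qed (simp add: tensor_mult_def tensor_sum_eq)
qed

lemma tensor_star_sum: "tensor_star A B C (tensor_sum L) = tensor_sum (terms_star L)"
proof
  fix \<phi>
  show "tensor_star A B C (tensor_sum L) \<phi> = tensor_sum (terms_star L) \<phi>"
  proof (cases "\<phi> \<in> trilinear")
    case True
    have "cnj (\<Sum>(z, a, b, c)\<leftarrow>L. z * cnj (\<phi> (alg_star A a) (alg_star B b) (alg_star C c))) =
      (\<Sum>(z, a, b, c)\<leftarrow>terms_star L. z * \<phi> a b c)"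
      by (induction L) (auto simp: terms_star_def)
    then show ?thesis using True trilinear_star[OF True] by (simp add: tensor_star_def tensor_sum_eq)
  qed (simp add: tensor_star_def tensor_sum_eq)
qed

text \<open>The list is continued by units with scalar 0, and the scalar is moved into the first
  factor. From index \<open>n\<close> on that factor has seminorm 0, so all the series are
  finite.\<close>

lemma tensor_sum_in:
  assumes L: "terms_in L"
  shows "tensor_sum L \<in> alg_set (tensor_alg A B C)"
proof -
  define n where "n = length L"
  define z where "z m = (if m < n then fst (L ! m) else 0)" for m
  define a where "a m = (if m < n then fst (snd (L ! m)) else alg_one A)" for m
  define b where "b m = (if m < n then fst (snd (snd (L ! m))) else alg_one B)" for m
  define c where "c m = (if m < n then snd (snd (snd (L ! m))) else alg_one C)" for m
  have in_: "a m \<in> alg_set A" "b m \<in> alg_set B" "c m \<in> alg_set C" for m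
    using L nth_mem[of m L] by (auto simp: a_def b_def c_def n_def terms_in_def A.one_in B.one_in C.one_in case_prod_unfold)
  define a' where "a' m = alg_scale A (z m) (a m)" for m
  have a'0: "seminorm A k (a' m) = 0" if "m \<ge> n" for m k
    using that in_ by (simp add: a'_def z_def A.seminorm_zero)
  have "tensor_sum L \<phi> = (\<Sum>m. elem_tensor A B C (a' m) (b m) (c m) \<phi>)" for \<phi>
  proof (cases "\<phi> \<in> trilinear")
    case True
    have e: "elem_tensor A B C (a' m) (b m) (c m) \<phi> = z m * \<phi> (a m) (b m) (c m)" for m
      using True linear_form_onD(2)[OF trilinearD(1)[OF True in_(2,3)] in_(1)]
      by (simp add: elem_tensor_def a'_def)
    have "tensor_sum L \<phi> = (\<Sum>m<n. z m * \<phi> (a m) (b m) (c m))"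
      using True by (simp add: tensor_sum_eq sum_list_sum_nth n_def z_def a_def b_def c_def case_prod_unfold atLeast0LessThan)
    also have "\<dots> = (\<Sum>m. z m * \<phi> (a m) (b m) (c m))"
      by (rule suminf_finite[symmetric]) (auto simp: z_def)
    finally show ?thesis by (simp add: e)
  qed (simp add: tensor_sum_eq elem_tensor_def)
  moreover have "summable (\<lambda>m. seminorm A k (a' m) * seminorm B l (b m) * seminorm C r (c m))" for k l r
    by (rule summable_finite[of "{..<n}"]) (use a'0 in auto)
  ultimately show ?thesis
    unfolding tensor_alg_def tensor_set_def using in_ A.scale_in[OF in_(1)]
    by (auto simp: a'_def intro!: exI[of _ a'] exI[of _ b] exI[of _ c])
qed

end


section \<open>Separating coordinates\<close>

lemma sum_list_swap:
  fixes f :: "'x \<Rightarrow> 'y \<Rightarrow> complex"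
  shows "(\<Sum>x\<leftarrow>L. \<Sum>y\<leftarrow>P. f x y) = (\<Sum>y\<leftarrow>P. \<Sum>x\<leftarrow>L. f x y)"
  by (induction L) (simp_all add: sum_list_addf)

text \<open>The coordinates are to be matrix entries for the disc and point evaluations for the
  circle.\<close>

locale separated =
  fixes A :: "'a frechet_alg" and E :: "'i \<Rightarrow> 'a \<Rightarrow> complex"
  assumes sep_add_in: "x \<in> alg_set A \<Longrightarrow> y \<in> alg_set A \<Longrightarrow> alg_add A x y \<in> alg_set A"
    and sep_scale_in: "x \<in> alg_set A \<Longrightarrow> alg_scale A c x \<in> alg_set A"
    and linear_E: "linear_form_on A (E i)"
    and separating: "x \<in> alg_set A \<Longrightarrow> y \<in> alg_set A \<Longrightarrow> (\<And>i. E i x = E i y) \<Longrightarrow> x = y"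
begin

text \<open>The locale carries no vector space laws, so a linear combination is specified by its
  values under all linear forms.\<close>

lemma exists_lincomb:
  assumes "a \<in> alg_set A" "\<And>p. p \<in> set P \<Longrightarrow> e p \<in> alg_set A"
  shows "\<exists>r\<in>alg_set A. \<forall>\<eta>. linear_form_on A \<eta> \<longrightarrow> \<eta> r = \<eta> a - (\<Sum>p\<leftarrow>P. c p * \<eta> (e p))"
  using assms(2)
proof (induction P)
  case (Cons p P)
  then obtain r where r: "r \<in> alg_set A"
    "\<And>\<eta>. linear_form_on A \<eta> \<Longrightarrow> \<eta> r = \<eta> a - (\<Sum>p\<leftarrow>P. c p * \<eta> (e p))" by auto
  have e: "e p \<in> alg_set A" using Cons.prems by simp
  show ?case
    by (rule bexI[of _ "alg_add A r (alg_scale A (- c p) (e p))"])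
      (use r e in \<open>auto simp: linear_form_onD sep_add_in sep_scale_in\<close>)
qed (use assms(1) in auto)

text \<open>Gaussian elimination: each \<open>x\<close> in \<open>S\<close> is recovered from the
  vectors \<open>snd p\<close> with coefficients \<open>E (fst p) x\<close>. A new element
  \<open>a\<close> leaves a residue \<open>r\<close> after expansion. If all coordinates of
  \<open>r\<close> vanish, \<open>r\<close> is 0 by separation; otherwise a coordinate
  \<open>j\<close> that detects it joins the list.\<close>

lemma dual_basis:
  assumes "finite S" "S \<subseteq> alg_set A"
  shows "\<exists>P. (\<forall>p\<in>set P. snd p \<in> alg_set A) \<and>
    (\<forall>x\<in>S. \<forall>\<eta>. linear_form_on A \<eta> \<longrightarrow> \<eta> x = (\<Sum>p\<leftarrow>P. E (fst p) x * \<eta> (snd p)))"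
  using assms
proof (induction S)
  case (insert a S)
  then obtain P where P': "\<forall>p\<in>set P. snd p \<in> alg_set A"
    "\<forall>x\<in>S. \<forall>\<eta>. linear_form_on A \<eta> \<longrightarrow> \<eta> x = (\<Sum>p\<leftarrow>P. E (fst p) x * \<eta> (snd p))"
    by blast
  have P: "snd p \<in> alg_set A" if "p \<in> set P" for p
    using P'(1) that by blast
  have P2: "\<eta> x = (\<Sum>p\<leftarrow>P. E (fst p) x * \<eta> (snd p))" if "x \<in> S" "linear_form_on A \<eta>" for x \<eta>
    using P'(2) that by blast
  have a: "a \<in> alg_set A" using insert.prems by simp
  obtain r where r: "r \<in> alg_set A"
    and r': "\<forall>\<eta>. linear_form_on A \<eta> \<longrightarrow> \<eta> r = \<eta> a - (\<Sum>p\<leftarrow>P. E (fst p) a * \<eta> (snd p))"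
    using exists_lincomb[where P = P and e = snd, OF a P, of "\<lambda>p. E (fst p) a"] by auto
  have r2: "\<eta> r = \<eta> a - (\<Sum>p\<leftarrow>P. E (fst p) a * \<eta> (snd p))" if "linear_form_on A \<eta>" for \<eta>
    using r' that by blast
  show ?case
  proof (cases "\<forall>j. E j r = 0")
    case True
    have "r = alg_scale A 0 r"
      by (rule separating) (use r True in \<open>auto simp: sep_scale_in linear_form_onD(2)[OF linear_E]\<close>)
    then have "\<eta> r = 0" if "linear_form_on A \<eta>" for \<eta>
      using linear_form_onD(2)[OF that r, of 0] by simp
    then have "\<eta> a = (\<Sum>p\<leftarrow>P. E (fst p) a * \<eta> (snd p))" if "linear_form_on A \<eta>" for \<eta>
      using r2[OF that] that by (metis eq_iff_diff_eq_0)
    then show ?thesis using P'(1) P2 by (intro exI[of _ P]) auto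
  next
    case False
    then obtain j where j: "E j r \<noteq> 0" by blast
    define e where "e = alg_scale A (1 / E j r) r"
    have e: "e \<in> alg_set A" unfolding e_def by (rule sep_scale_in[OF r])
    \<comment> \<open>As \<open>E j e = 1\<close>, this correction of the old vectors gives them
      \<open>j\<close>-th coordinate 0.\<close>
    define g where "g p = alg_add A (snd p) (alg_scale A (- E j (snd p)) e)" for p :: "'i \<times> 'a"
    have g: "g p \<in> alg_set A" if "p \<in> set P" for p
      unfolding g_def by (intro sep_add_in sep_scale_in P e that)
    define P' where "P' = (j, e) # map (\<lambda>p. (fst p, g p)) P"
    \<comment> \<open>The new expansion is the old one plus the \<open>j\<close>-th coordinate of
      its error times \<open>e\<close>. On \<open>S\<close> the error is 0; at \<open>a\<close> it
      is \<open>r\<close>, and \<open>E j r * \<eta> e = \<eta> r\<close>.\<close>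
    have eq: "(\<Sum>p\<leftarrow>P'. E (fst p) x * \<eta> (snd p)) =
        (\<Sum>p\<leftarrow>P. E (fst p) x * \<eta> (snd p)) + (E j x - (\<Sum>p\<leftarrow>P. E (fst p) x * E j (snd p))) * \<eta> e"
      if \<eta>: "linear_form_on A \<eta>" for \<eta> x
    proof -
      have g\<eta>: "\<eta> (g p) = \<eta> (snd p) - E j (snd p) * \<eta> e" if "p \<in> set P" for p
        using \<eta> P[OF that] e by (simp add: g_def linear_form_onD sep_scale_in)
      have "(\<Sum>p\<leftarrow>P. E (fst p) x * \<eta> (g p)) =
          (\<Sum>p\<leftarrow>P. E (fst p) x * (\<eta> (snd p) - E j (snd p) * \<eta> e))"
        using g\<eta> by (intro arg_cong[where f = sum_list] map_cong refl) simp
      also have "\<dots> = (\<Sum>p\<leftarrow>P. E (fst p) x * \<eta> (snd p)) - (\<Sum>p\<leftarrow>P. E (fst p) x * E j (snd p)) * \<eta> e"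
        by (induction P) (auto simp: algebra_simps)
      finally show ?thesis by (simp add: P'_def o_def algebra_simps)
    qed
    have "\<eta> x = (\<Sum>p\<leftarrow>P'. E (fst p) x * \<eta> (snd p))" if "x \<in> insert a S" and \<eta>: "linear_form_on A \<eta>" for x \<eta>
    proof (cases "x \<in> S")
      case True
      then show ?thesis unfolding eq[OF \<eta>] using P2[OF True \<eta>] P2[OF True linear_E[of j]] by simp
    next
      case False
      then have x: "x = a" using that by simp
      have "\<eta> e = \<eta> r / E j r" unfolding e_def using linear_form_onD(2)[OF \<eta> r] by simp
      then show ?thesis unfolding eq[OF \<eta>] x using r2[OF \<eta>] r2[OF linear_E[of j]] j by simp
    qed
    moreover have "\<forall>p\<in>set P'. snd p \<in> alg_set A" using g e by (auto simp: P'_def)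
    ultimately show ?thesis by blast
  qed
qed (auto intro: exI[of _ "[]"])

text \<open>Expanding each \<open>c m\<close> in a dual basis of the finitely many elements that
  occur leaves coordinates of \<open>c m\<close> and values of \<open>\<psi> m\<close> at fixed
  vectors. Used once for each tensor factor, this trades the arguments of a trilinear form for
  coordinates.\<close>

lemma sum_vanishes:
  assumes c: "\<And>m. m \<in> set L \<Longrightarrow> c m \<in> alg_set A" and \<psi>: "\<And>m. m \<in> set L \<Longrightarrow> linear_form_on A (\<psi> m)"
    and 0: "\<And>i e. e \<in> alg_set A \<Longrightarrow> (\<Sum>m\<leftarrow>L. w m * E i (c m) * \<psi> m e) = 0"
  shows "(\<Sum>m\<leftarrow>L. w m * \<psi> m (c m)) = 0"
proof -
  have "finite (c ` set L)" "c ` set L \<subseteq> alg_set A" using c by auto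
  from dual_basis[OF this] obtain P where P: "\<forall>p\<in>set P. snd p \<in> alg_set A"
    "\<forall>x\<in>c ` set L. \<forall>\<eta>. linear_form_on A \<eta> \<longrightarrow> \<eta> x = (\<Sum>p\<leftarrow>P. E (fst p) x * \<eta> (snd p))"
    by blast
  have "(\<Sum>m\<leftarrow>L. w m * \<psi> m (c m)) = (\<Sum>m\<leftarrow>L. \<Sum>p\<leftarrow>P. w m * E (fst p) (c m) * \<psi> m (snd p))"
  proof (intro arg_cong[where f = sum_list] map_cong refl)
    fix m assume m: "m \<in> set L"
    have "\<psi> m (c m) = (\<Sum>p\<leftarrow>P. E (fst p) (c m) * \<psi> m (snd p))"
      by (rule P(2)[rule_format, OF imageI[OF m] \<psi>[OF m]])
    then show "w m * \<psi> m (c m) = (\<Sum>p\<leftarrow>P. w m * E (fst p) (c m) * \<psi> m (snd p))"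
      by (simp add: sum_list_const_mult[symmetric] mult.assoc)
  qed
  also have "\<dots> = (\<Sum>p\<leftarrow>P. \<Sum>m\<leftarrow>L. w m * E (fst p) (c m) * \<psi> m (snd p))" by (rule sum_list_swap)
  also have "\<dots> = (\<Sum>p\<leftarrow>P. 0)"
    using P(1) by (intro arg_cong[where f = sum_list] map_cong refl 0) auto
  finally show ?thesis by simp
qed

end

locale separated_tensor_factors =
  tensor_factors A B C + sA: separated A E + sB: separated B F + sC: separated C G
  for A :: "'a frechet_alg" and B :: "'b frechet_alg" and C :: "'c frechet_alg"
    and E :: "'i \<Rightarrow> 'a \<Rightarrow> complex" and F :: "'j \<Rightarrow> 'b \<Rightarrow> complex" and G :: "'k \<Rightarrow> 'c \<Rightarrow> complex"
begin

text \<open>Expanding the three factors of every term in finite dual bases turns the value at a trilinear form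
  into a linear combination of the coordinate sums that vanish by assumption.\<close>

lemma tensor_sum_zero:
  assumes L: "terms_in L"
    and 0: "\<And>i j k. (\<Sum>(z, a, b, c)\<leftarrow>L. z * E i a * F j b * G k c) = 0"
  shows "tensor_sum L = (\<lambda>\<phi>. 0)"
proof
  fix \<phi>
  show "tensor_sum L \<phi> = 0"
  proof (cases "\<phi> \<in> trilinear")
    case True
    let ?z = "\<lambda>m :: complex \<times> 'a \<times> 'b \<times> 'c. fst m" and ?a = "\<lambda>m :: complex \<times> 'a \<times> 'b \<times> 'c. fst (snd m)"
      and ?b = "\<lambda>m :: complex \<times> 'a \<times> 'b \<times> 'c. fst (snd (snd m))" and ?c = "\<lambda>m :: complex \<times> 'a \<times> 'b \<times> 'c. snd (snd (snd m))"
    have in_: "?a m \<in> alg_set A" "?b m \<in> alg_set B" "?c m \<in> alg_set C" if "m \<in> set L" for m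
      using L that by (auto simp: terms_in_def case_prod_unfold)
    note lin = trilinearD[OF True]
    have "(\<Sum>m\<leftarrow>L. ?z m * \<phi> (?a m) (?b m) (?c m)) = 0"
    proof (rule sC.sum_vanishes[where \<psi> = "\<lambda>m. \<phi> (?a m) (?b m)"])
      fix k g assume g: "g \<in> alg_set C"
      show "(\<Sum>m\<leftarrow>L. ?z m * G k (?c m) * \<phi> (?a m) (?b m) g) = 0"
      proof (rule sB.sum_vanishes[where \<psi> = "\<lambda>m b. \<phi> (?a m) b g"])
        fix j f assume f: "f \<in> alg_set B"
        show "(\<Sum>m\<leftarrow>L. ?z m * G k (?c m) * F j (?b m) * \<phi> (?a m) f g) = 0"
        proof (rule sA.sum_vanishes[where \<psi> = "\<lambda>m a. \<phi> a f g"])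
          fix i e
          have "(\<Sum>m\<leftarrow>L. ?z m * G k (?c m) * F j (?b m) * E i (?a m) * \<phi> e f g) =
            (\<Sum>m\<leftarrow>L. ?z m * E i (?a m) * F j (?b m) * G k (?c m)) * \<phi> e f g"
            unfolding sum_list_mult_const[symmetric] by (simp add: mult_ac)
          then show "(\<Sum>m\<leftarrow>L. ?z m * G k (?c m) * F j (?b m) * E i (?a m) * \<phi> e f g) = 0"
            using 0[of i j k] by (simp add: case_prod_unfold)
        qed (use in_ lin f g in auto)
      qed (use in_ lin g in auto)
    qed (use in_ lin in auto)
    then show ?thesis using True by (simp add: tensor_sum_eq case_prod_unfold)
  qed (simp add: tensor_sum_eq)
qed

end


section \<open>The disc and the circle as topological star algebras with separating
  coordinates\<close>

lemma smooth_disc_simps [simp]: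
  "alg_set smooth_disc = smooth_disc_set" "alg_add smooth_disc = op_add" "alg_scale smooth_disc = op_scale"
  "alg_mult smooth_disc = (\<circ>)" "alg_one smooth_disc = op_id UNIV" "alg_star smooth_disc = adj UNIV"
  "seminorm smooth_disc = disc_seminorm"
  by (simp_all add: smooth_disc_def)

lemma smooth_circle_simps [simp]:
  "alg_set smooth_circle = smooth_circle_set" "alg_add smooth_circle = (\<lambda>f g \<theta>. f \<theta> + g \<theta>)"
  "alg_scale smooth_circle = (\<lambda>c f \<theta>. c * f \<theta>)" "alg_mult smooth_circle = (\<lambda>f g \<theta>. f \<theta> * g \<theta>)"
  "alg_one smooth_circle = (\<lambda>\<theta>. 1)" "alg_star smooth_circle = (\<lambda>f \<theta>. cnj (f \<theta>))"
  "seminorm smooth_circle = circle_seminorm"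
  by (simp_all add: smooth_circle_def)

lemma smooth_disc_bounded: "T \<in> smooth_disc_set \<Longrightarrow> bounded_op UNIV T"
  by (erule smooth_disc_cases) (simp add: bounded_disc_op)

lemma bounded_op_in_l2: "bounded_op I T \<Longrightarrow> T \<xi> \<in> l2 I"
  by (cases "\<xi> \<in> l2 I") (simp_all add: bounded_opD(1) bounded_opD(3))

lemma comp_op_add: "bounded_op I S \<Longrightarrow> bounded_op I T \<Longrightarrow> bounded_op I U \<Longrightarrow>
  S \<circ> op_add T U = op_add (S \<circ> T) (S \<circ> U)"
  by (rule ext) (simp add: op_add_def bounded_op_addD bounded_op_in_l2)

lemma comp_op_scale: "bounded_op I S \<Longrightarrow> bounded_op I T \<Longrightarrow> S \<circ> op_scale c T = op_scale c (S \<circ> T)"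
  by (rule ext) (simp add: op_scale_def bounded_op_scaleD bounded_op_in_l2)

lemma op_add_comp: "op_add T U \<circ> S = op_add (T \<circ> S) (U \<circ> S)"
  by (rule ext) (simp add: op_add_def)

lemma op_scale_comp: "op_scale c T \<circ> S = op_scale c (T \<circ> S)"
  by (rule ext) (simp add: op_scale_def)

lemma smooth_disc_adj:
  assumes "T \<in> smooth_disc_set"
  shows "is_adj UNIV T (adj UNIV T)"
  using assms by (rule smooth_disc_cases) (metis disc_op_is_adj is_adj_adj)

lemma adj_disc_op:
  "f \<in> smooth_circle_set \<Longrightarrow> rapid_decay R \<Longrightarrow>
    adj UNIV (disc_op f R) = disc_op (\<lambda>\<theta>. cnj (f \<theta>)) (\<lambda>x y. cnj (R y x))"
  by (rule is_adj_adj[OF disc_op_is_adj])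

lemma disc_total_seminorm:
  assumes "f \<in> smooth_circle_set" "rapid_decay R"
  shows "total_seminorm smooth_disc k (disc_op f R) = (\<Sum>l\<le>k. circle_seminorm l f + matrix_seminorm l R)"
  by (simp add: total_seminorm_def disc_seminorm_eq assms)

interpretation disc_alg: frechet_star_alg smooth_disc
proof (unfold_locales, goal_cases)
  case (1 x y)
  then show ?case
    unfolding smooth_disc_simps
    by (elim smooth_disc_cases) (simp add: disc_op_add smooth_disc_setI smooth_add rapid_decay_add)
next
  case (2 x c)
  then show ?case
    unfolding smooth_disc_simps
    by (elim smooth_disc_cases) (simp add: disc_op_scale smooth_disc_setI smooth_scale rapid_decay_scale)
next
  case (3 x y)
  then obtain f R g Q where *: "f \<in> smooth_circle_set" "rapid_decay R" "x = disc_op f R"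
    "g \<in> smooth_circle_set" "rapid_decay Q" "y = disc_op g Q"
    unfolding smooth_disc_simps by (elim smooth_disc_cases)
  obtain P where "rapid_decay P" "disc_op f R \<circ> disc_op g Q = disc_op (\<lambda>\<theta>. f \<theta> * g \<theta>) P"
    by (rule disc_op_mult[OF *(1,2,4,5)])
  then show ?case using * by (simp add: smooth_disc_setI smooth_mult)
next
  case (4 x)
  then show ?case
    unfolding smooth_disc_simps
    by (elim smooth_disc_cases) (simp add: adj_disc_op smooth_disc_setI smooth_cnj rapid_decay_star)
next
  case 5
  show ?case by (simp add: op_id_disc smooth_disc_setI smooth_const rapid_decay_zero)
next
  case (6 x y z)
  then show ?case by (simp add: comp_op_add[of UNIV] smooth_disc_bounded)
next
  case (7 x y z)
  then show ?case by (simp add: op_add_comp)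
next
  case (8 x y c)
  then show ?case by (simp add: comp_op_scale[of UNIV] smooth_disc_bounded)
next
  case (9 x y c)
  then show ?case by (simp add: op_scale_comp)
next
  case (10 x y)
  then show ?case
    unfolding smooth_disc_simps by (intro is_adj_adj is_adj_add smooth_disc_adj)
next
  case (11 x c)
  then show ?case
    unfolding smooth_disc_simps by (intro is_adj_adj is_adj_scale smooth_disc_adj)
next
  case (12 x k)
  then show ?case
    unfolding smooth_disc_simps
    by (elim smooth_disc_cases)
      (simp add: disc_seminorm_eq circle_seminorm_nonneg matrix_seminorm_nonneg)
next
  case (13 x k)
  then obtain f R where f: "f \<in> smooth_circle_set" "rapid_decay R" "x = disc_op f R"
    unfolding smooth_disc_simps by (elim smooth_disc_cases)
  have "disc_seminorm k (op_scale 0 x) = circle_seminorm k (\<lambda>\<theta>. 0 * f \<theta>) + matrix_seminorm k (\<lambda>x y. 0 * R x y)"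
    unfolding f(3) disc_op_scale[OF f(1,2)] by (rule disc_seminorm_eq[OF smooth_scale[OF f(1)] rapid_decay_scale[OF f(2)]])
  also have "\<dots> = 0"
    unfolding circle_seminorm_def matrix_seminorm_def nth_deriv_scale[OF f(1)] by simp
  finally show ?case by simp
next
  \<comment> \<open>The order rises to \<open>k + 2\<close> because the matrix part of a product
    spends two powers of its weight on the convergence of sums. The constant adds
    \<open>2 ^ k\<close> for the symbol and the constant of the matrix part.\<close>
  case (14 k)
  show ?case unfolding smooth_disc_simps
  proof (intro exI ballI)
    fix x y assume "x \<in> smooth_disc_set" "y \<in> smooth_disc_set"
    then obtain f R g Q where f: "f \<in> smooth_circle_set" "rapid_decay R" "x = disc_op f R"
      and g: "g \<in> smooth_circle_set" "rapid_decay Q" "y = disc_op g Q"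
      by (elim smooth_disc_cases)
    obtain P where P: "rapid_decay P" "disc_op f R \<circ> disc_op g Q = disc_op (\<lambda>\<theta>. f \<theta> * g \<theta>) P"
      "\<And>k. matrix_seminorm k P \<le> 4 * (2 ^ (k + 3)) ^ 2 * inv_sq_sum *
      (\<Sum>l\<le>k+2. circle_seminorm l f + matrix_seminorm l R) * (\<Sum>l\<le>k+2. circle_seminorm l g + matrix_seminorm l Q)"
      by (rule disc_op_mult[OF f(1,2) g(1,2)]) blast
    let ?F = "\<Sum>l\<le>k+2. circle_seminorm l f + matrix_seminorm l R"
    let ?G = "\<Sum>l\<le>k+2. circle_seminorm l g + matrix_seminorm l Q"
    have le: "(\<Sum>l\<le>k. circle_seminorm l h) \<le> (\<Sum>l\<le>k+2. circle_seminorm l h + matrix_seminorm l S)"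
      if "h \<in> smooth_circle_set" "rapid_decay S" for h S
    proof -
      have "(\<Sum>l\<le>k. circle_seminorm l h) \<le> (\<Sum>l\<le>k. circle_seminorm l h + matrix_seminorm l S)"
        by (intro sum_mono) (simp add: matrix_seminorm_nonneg that)
      also have "\<dots> \<le> (\<Sum>l\<le>k+2. circle_seminorm l h + matrix_seminorm l S)"
        by (rule sum_mono2) (auto simp: matrix_seminorm_nonneg circle_seminorm_nonneg that)
      finally show ?thesis .
    qed
    have "circle_seminorm k (\<lambda>\<theta>. f \<theta> * g \<theta>) \<le> 2 ^ k * (\<Sum>l\<le>k. circle_seminorm l f) * (\<Sum>l\<le>k. circle_seminorm l g)"
      by (rule circle_seminorm_mult[OF f(1) g(1)])
    also have "\<dots> \<le> 2 ^ k * ?F * ?G"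
      by (intro mult_mono le f g mult_nonneg_nonneg sum_nonneg circle_seminorm_nonneg add_nonneg_nonneg
          matrix_seminorm_nonneg order_refl) auto
    finally have "disc_seminorm k (x \<circ> y) \<le> 2 ^ k * ?F * ?G + 4 * (2 ^ (k + 3)) ^ 2 * inv_sq_sum * ?F * ?G"
      using P(3)[of k] by (simp add: f(3) g(3) P(2) disc_seminorm_eq smooth_mult f g P(1))
    then show "disc_seminorm k (x \<circ> y) \<le> (2 ^ k + 4 * (2 ^ (k + 3)) ^ 2 * inv_sq_sum) *
        total_seminorm smooth_disc (k + 2) x * total_seminorm smooth_disc (k + 2) y"
      unfolding f(3) g(3) disc_total_seminorm[OF f(1,2)] disc_total_seminorm[OF g(1,2)]
      by (simp only: algebra_simps)
  qed
next
  case (15 x k)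
  then show ?case
    unfolding smooth_disc_simps
    by (elim smooth_disc_cases)
      (simp add: adj_disc_op disc_seminorm_eq smooth_cnj rapid_decay_star circle_seminorm_cnj matrix_seminorm_star)
qed

interpretation circle_alg: frechet_star_alg smooth_circle
proof (unfold_locales, goal_cases)
  case (13 x k)
  then show ?case
    by (simp add: circle_seminorm_def nth_deriv_scale[of _ _ 0, simplified])
next
  case (14 k)
  show ?case
    by (intro exI[of _ "2 ^ k"] exI[of _ k]) (simp add: total_seminorm_def circle_seminorm_mult)
qed (auto simp: smooth_add smooth_scale smooth_mult smooth_cnj smooth_const algebra_simps
    circle_seminorm_nonneg circle_seminorm_cnj)

definition disc_entry :: "nat \<times> nat \<Rightarrow> nat opr \<Rightarrow> complex" where
  "disc_entry p T = T (basis_vec (snd p)) (fst p)"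

interpretation disc_sep: separated smooth_disc disc_entry
proof (unfold_locales, goal_cases)
  case (3 i)
  show ?case by (simp add: linear_form_on_def disc_entry_def op_add_def op_scale_def)
next
  case (4 x y)
  show ?case
    by (rule bounded_op_eqI[of UNIV]) (use 4 in \<open>auto simp: smooth_disc_bounded disc_entry_def\<close>)
qed (use disc_alg.add_in disc_alg.scale_in in auto)

interpretation circle_sep: separated smooth_circle "\<lambda>\<theta> f. f \<theta>"
proof (unfold_locales, goal_cases)
  case (3 i)
  show ?case by (simp add: linear_form_on_def)
qed (use circle_alg.add_in circle_alg.scale_in in auto)

interpretation target: separated_tensor_factors smooth_disc smooth_disc smooth_circle
  disc_entry disc_entry "\<lambda>\<theta> f. f \<theta>"
  by unfold_locales


section \<open>The representations of the quantum disc\<close>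

text \<open>With \<open>q = r ^ Suc k\<close> the expression is at most the \<open>Suc k\<close>-th
  power of \<open>(1 + 2 * y) * r ^ y\<close>, a null sequence and therefore bounded.\<close>

lemma exp_decay_bounded:
  fixes q :: real
  assumes "0 < q" "q < 1"
  shows "\<exists>B. \<forall>y. (1 + 2 * real y) ^ k * q ^ y \<le> B"
proof -
  define r where "r = root (Suc k) q"
  have r: "0 < r" "r < 1" "r ^ Suc k = q"
    using assms by (auto simp: r_def real_root_pow_pos2 simp del: power_Suc)
  have "(\<lambda>y. r ^ y + 2 * (of_nat y * r ^ y)) \<longlonglongrightarrow> 0 + 2 * 0"
    using r by (intro tendsto_add tendsto_mult tendsto_const LIMSEQ_realpow_zero powser_times_n_limit_0) auto
  then have "Bseq (\<lambda>y. r ^ y + 2 * (of_nat y * r ^ y))" by (intro convergent_imp_Bseq convergentI)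
  then obtain B where B: "\<forall>y. norm (r ^ y + 2 * (of_nat y * r ^ y)) \<le> B" by (auto simp: Bseq_def)
  have "(1 + 2 * real y) ^ k * q ^ y \<le> B ^ Suc k" for y
  proof -
    have "(1 + 2 * real y) ^ k * q ^ y \<le> (1 + 2 * real y) ^ Suc k * q ^ y"
      using assms by (intro mult_right_mono power_increasing) auto
    also have "\<dots> = (1 + 2 * real y) ^ Suc k * (r ^ y) ^ Suc k"
      using r(3) by (metis power_mult mult.commute)
    also have "\<dots> = (r ^ y + 2 * (of_nat y * r ^ y)) ^ Suc k"
      unfolding power_mult_distrib[symmetric] by (simp add: algebra_simps)
    also have "\<dots> \<le> B ^ Suc k"
      using B r by (intro power_mono) (auto intro: order_trans[OF abs_ge_self])
    finally show ?thesis .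
  qed
  then show ?thesis by blast
qed

text \<open>On the support \<open>x \<le> y\<close>, so the weight is at most a power of
  \<open>1 + 2 * y\<close>, which the exponential decay in \<open>y\<close> beats.\<close>

lemma rapid_decay_near_diagonal:
  assumes q: "0 < q" "q < 1" and R: "\<And>x y. R x y \<noteq> 0 \<Longrightarrow> x \<le> y" "\<And>x y. cmod (R x y) \<le> q ^ y"
  shows "rapid_decay R"
proof (rule rapid_decayI)
  fix k
  obtain B where B: "\<forall>y. (1 + 2 * real y) ^ k * q ^ y \<le> B" using exp_decay_bounded[OF q] by blast
  have "(1 + real x + real y) ^ k * cmod (R x y) \<le> B" for x y
  proof (cases "R x y = 0")
    case True
    then show ?thesis using B[rule_format, of 0] by (auto intro: order_trans[OF zero_le_one])
  next
    case False
    then have "(1 + real x + real y) ^ k * cmod (R x y) \<le> (1 + 2 * real y) ^ k * q ^ y"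
      using R by (intro mult_mono power_mono) auto
    then show ?thesis using B order_trans by blast
  qed
  then show "\<exists>B. \<forall>x y. (1 + real x + real y) ^ k * cmod (R x y) \<le> B" by blast
qed

definition alpha_weight :: "real \<Rightarrow> int \<Rightarrow> real" where
  "alpha_weight q p = (if p \<ge> 1 then sqrt (1 - q ^ (2 * nat p)) else 0)"

definition beta_weight :: "real \<Rightarrow> real \<Rightarrow> int \<Rightarrow> real" where
  "beta_weight s q p = (if p \<ge> 0 then s * q ^ nat p else 0)"

lemma wshift_pi_alpha:
  assumes "0 < q" "q < 1"
  shows "disc.wshift (pi_alpha q) (alpha_weight q) (- 1)"
  unfolding pi_alpha_def
proof (rule disc.wshift_op_of_basis)
  have "\<bar>sqrt (1 - q ^ n)\<bar> \<le> 1" for n using assms by (simp add: power_le_one)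
  then show "disc.weight (alpha_weight q) (- 1)"
    unfolding disc.weight_def by (auto simp: alpha_weight_def intro!: exI[of _ 1])
  fix p :: int assume "p \<in> {0..}"
  then show "(\<lambda>v. complex_of_real (sqrt (1 - q ^ (2 * nat p))) * basis_vec (nat p - 1) v) =
    (\<lambda>v. complex_of_real (alpha_weight q p) * basis_vec (nat (p + - 1)) v)"
    \<comment> \<open>At \<open>p = 0\<close> truncated subtraction leaves
      \<open>basis_vec 0\<close>, but \<open>sqrt (1 - q ^ 0) = 0\<close>, in agreement with the
      cut-off in \<open>alpha_weight\<close>.\<close>
    by (cases "p = 0") (auto simp: alpha_weight_def nat_diff_distrib)
qed

lemma wshift_pi_beta:
  assumes "0 < q" "q < 1" "\<bar>s\<bar> \<le> 1"
  shows "disc.wshift (pi_beta s q) (beta_weight s q) 0"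
  unfolding pi_beta_def
proof (rule disc.wshift_op_of_basis)
  have "\<bar>s * q ^ n\<bar> \<le> 1" for n
    using assms by (simp add: abs_mult mult_le_one power_le_one)
  then show "disc.weight (beta_weight s q) 0"
    unfolding disc.weight_def by (auto simp: beta_weight_def intro!: exI[of _ 1])
  fix p :: int assume "p \<in> {0..}"
  then show "(\<lambda>v. complex_of_real (s * q ^ nat p) * basis_vec (nat p) v) =
    (\<lambda>v. complex_of_real (beta_weight s q p) * basis_vec (nat (p + 0)) v)"
    by (auto simp: beta_weight_def)
qed

lemma wshift_disc_entry:
  assumes "disc.wshift T c D"
  shows "T (basis_vec y) x = (if int x = int y + D then of_real (c (int y)) else 0)"
proof -
  have "T (basis_vec y) x = of_real (c (int y)) * basis_vec (nat (int y + D)) x"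
    using disc.wshift_basis[OF assms, of "int y"] by simp
  then show ?thesis using disc.wshiftD(4)[OF assms, of "int y"] by (auto simp: basis_vec_def)
qed

lemma pi_beta_in_smooth_disc:
  assumes q: "0 < q" "q < 1" and s: "\<bar>s\<bar> \<le> 1"
  shows "pi_beta s q \<in> smooth_disc_set"
proof -
  let ?R = "\<lambda>x y. if x = y then complex_of_real (s * q ^ y) else 0"
  have "\<bar>s\<bar> * q ^ y \<le> q ^ y" for y using q s mult_right_mono[OF s, of "q ^ y"] by simp
  then have R: "rapid_decay ?R"
    by (intro rapid_decay_near_diagonal[OF q]) (use q in \<open>auto simp: norm_mult norm_power split: if_splits\<close>)
  have "pi_beta s q = disc_op (\<lambda>\<theta>. 0) ?R"
    by (rule disc_op_eqI[OF smooth_const R disc.wshiftD(1)[OF wshift_pi_beta[OF q s]]])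
      (auto simp: wshift_disc_entry[OF wshift_pi_beta[OF q s]] disc_mat_def fourier_coeff_zero beta_weight_def)
  then show ?thesis using smooth_disc_setI[OF smooth_const R] by simp
qed

text \<open>The symbol is \<open>u\<close>; the correction lives on the superdiagonal and decays
  rapidly because \<open>1 - sqrt (1 - t) \<le> t\<close> for \<open>t\<close> in the unit
  interval.\<close>

lemma pi_alpha_in_smooth_disc:
  assumes q: "0 < q" "q < 1"
  shows "pi_alpha q \<in> smooth_disc_set"
proof -
  let ?R = "\<lambda>x y. if y = Suc x then complex_of_real (sqrt (1 - q ^ (2 * y)) - 1) else 0"
  have b: "cmod (complex_of_real (sqrt (1 - q ^ (2 * y)) - 1)) \<le> q ^ y" for y
  proof -
    let ?t = "q ^ (2 * y)"
    have t: "0 \<le> ?t" "?t \<le> 1" using q by (auto simp: power_le_one)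
    have "(1 - ?t)\<^sup>2 \<le> 1 - ?t"
      using t mult_left_le[of "1 - ?t" "1 - ?t"] by (simp add: power2_eq_square)
    then have "1 - ?t \<le> sqrt (1 - ?t)" by (rule real_le_rsqrt)
    moreover have "sqrt (1 - ?t) \<le> 1" using t by simp
    ultimately have "\<bar>sqrt (1 - ?t) - 1\<bar> \<le> ?t" by linarith
    also have "?t \<le> q ^ y" by (rule power_decreasing) (use q in auto)
    finally show ?thesis by (simp only: norm_of_real)
  qed
  have R: "rapid_decay ?R"
  proof (rule rapid_decay_near_diagonal[OF q])
    show "cmod (?R x y) \<le> q ^ y" for x y
      using b[of y] q by (cases "y = Suc x") simp_all
  qed (simp split: if_splits)
  have s: "(\<lambda>\<theta>. 1 * cis (of_int 1 * \<theta>)) \<in> smooth_circle_set" by (rule smooth_cis)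
  have "pi_alpha q (basis_vec y) x = disc_mat (\<lambda>\<theta>. 1 * cis (of_int 1 * \<theta>)) ?R x y" for x y
    unfolding wshift_disc_entry[OF wshift_pi_alpha[OF q]] disc_mat_def mult_1 fourier_coeff_cis
    by (auto simp: alpha_weight_def)
  then have "pi_alpha q = disc_op (\<lambda>\<theta>. 1 * cis (of_int 1 * \<theta>)) ?R"
    by (rule disc_op_eqI[OF s R disc.wshiftD(1)[OF wshift_pi_alpha[OF q]]])
  then show ?thesis using smooth_disc_setI[OF s R] by simp
qed


section \<open>Words of weighted shifts\<close>

fun word_op :: "'i set \<Rightarrow> ('l \<Rightarrow> 'i opr) \<Rightarrow> 'l list \<Rightarrow> 'i opr" where
  "word_op I f [] = op_id I"
| "word_op I f (l # w) = f l \<circ> word_op I f w"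

primrec word_disp :: "('l \<Rightarrow> 'p::ab_group_add) \<Rightarrow> 'l list \<Rightarrow> 'p" where
  "word_disp D [] = 0"
| "word_disp D (l # w) = D l + word_disp D w"

primrec word_weight :: "'p set \<Rightarrow> ('l \<Rightarrow> 'p \<Rightarrow> real) \<Rightarrow> ('l \<Rightarrow> 'p::ab_group_add) \<Rightarrow> 'l list \<Rightarrow> 'p \<Rightarrow> real" where
  "word_weight V c D [] = (\<lambda>p. if p \<in> V then 1 else 0)"
| "word_weight V c D (l # w) = (\<lambda>p. c l (p + word_disp D w) * word_weight V c D w p)"

lemma bounded_word_op: "(\<And>l. bounded_op I (f l)) \<Longrightarrow> bounded_op I (word_op I f w)"
  by (induction w) (simp_all add: bounded_op_id bounded_op_comp)

lemma word_op_append: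
  assumes "\<And>l. bounded_op I (f l)"
  shows "word_op I f (v @ w) = word_op I f v \<circ> word_op I f w"
  by (induction v) (simp_all add: o_assoc op_id_comp bounded_word_op assms)

lemma word_disp_append: "word_disp D (v @ w) = word_disp D v + word_disp D w"
  by (induction v) (simp_all add: ac_simps)

lemma (in shift_lattice) wshift_word:
  assumes "\<And>l. wshift (f l) (c l) (D l)"
  shows "wshift (word_op I f w) (word_weight V c D w) (word_disp D w)"
proof (induction w)
  case (Cons l w)
  show ?case using wshift_comp[OF assms Cons, of l] by (simp only: word_op.simps word_disp.simps word_weight.simps)
qed (simp add: wshift_id)

lemma is_adj_word_op:
  assumes "\<And>l. is_adj I (f l) (f (s l))"
  shows "is_adj I (word_op I f w) (word_op I f (rev (map s w)))"
proof (induction w)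
  case (Cons l w)
  have b: "bounded_op I (f l)" for l using assms by (simp add: is_adj_def)
  have "word_op I f (rev (map s w) @ [s l]) = word_op I f (rev (map s w)) \<circ> f (s l)"
    using b by (simp add: word_op_append comp_op_id)
  then show ?case using is_adj_comp[OF assms Cons, of l] by (simp only: list.map rev.simps word_op.simps)
qed (simp add: is_adj_id)

lemma word_disp_rev:
  assumes "\<And>l. D (s l) = - D l"
  shows "word_disp D (rev (map s w)) = - word_disp D w"
  by (induction w) (simp_all add: word_disp_append assms)


section \<open>The generators\<close>

datatype gen = AlphaPlus | AlphaMinus | BetaPlus | BetaMinus

text \<open>A letter is a generator together with a flag telling whether its adjoint is meant.\<close>

type_synonym letter = "gen \<times> bool"

definition flip :: "letter \<Rightarrow> letter" where "flip l = (fst l, \<not> snd l)"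

definition with_adj :: "'i set \<Rightarrow> (gen \<Rightarrow> 'i opr) \<Rightarrow> letter \<Rightarrow> 'i opr" where
  "with_adj I f l = (if snd l then adj I (f (fst l)) else f (fst l))"

definition letter_disp :: "(gen \<Rightarrow> 'p::ab_group_add) \<Rightarrow> letter \<Rightarrow> 'p" where
  "letter_disp D l = (if snd l then - D (fst l) else D (fst l))"

definition letter_weight :: "(gen \<Rightarrow> 'p \<Rightarrow> real) \<Rightarrow> (gen \<Rightarrow> 'p::ab_group_add) \<Rightarrow> letter \<Rightarrow> 'p \<Rightarrow> real" where
  "letter_weight c D l = (if snd l then (\<lambda>p. c (fst l) (p - D (fst l))) else c (fst l))"

lemma letter_disp_flip: "letter_disp D (flip l) = - letter_disp D l"
  by (simp add: letter_disp_def flip_def)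

lemma (in shift_lattice) wshift_letter:
  assumes "\<And>g. wshift (f g) (c g) (D g)"
  shows "wshift (with_adj I f l) (letter_weight c D l) (letter_disp D l)"
    and "is_adj I (with_adj I f l) (with_adj I f (flip l))"
proof -
  obtain S where S: "is_adj I (f (fst l)) S" "wshift S (\<lambda>p. c (fst l) (p - D (fst l))) (- D (fst l))"
    by (rule wshift_adj[OF assms])
  have S': "adj I (f (fst l)) = S" by (rule is_adj_adj[OF S(1)])
  show "wshift (with_adj I f l) (letter_weight c D l) (letter_disp D l)"
    using S(2) assms by (simp add: with_adj_def letter_weight_def letter_disp_def S')
  show "is_adj I (with_adj I f l) (with_adj I f (flip l))"
    using S(1) is_adj_sym[OF S(1)] by (simp add: with_adj_def flip_def S')
qed

definition hilbert_gen :: "real \<Rightarrow> gen \<Rightarrow> idx opr" where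
  "hilbert_gen q g = (case g of AlphaPlus \<Rightarrow> alpha_plus q | AlphaMinus \<Rightarrow> alpha_minus q
     | BetaPlus \<Rightarrow> beta_plus q | BetaMinus \<Rightarrow> beta_minus q)"

definition first_gen :: "real \<Rightarrow> gen \<Rightarrow> nat opr" where
  "first_gen q g = (case g of AlphaPlus \<Rightarrow> adj UNIV (pi_beta 1 q) | AlphaMinus \<Rightarrow> pi_alpha q
     | BetaPlus \<Rightarrow> adj UNIV (pi_alpha q) | BetaMinus \<Rightarrow> pi_beta 1 q)"

definition second_gen :: "real \<Rightarrow> gen \<Rightarrow> nat opr" where
  "second_gen q g = (case g of AlphaPlus \<Rightarrow> pi_beta (- 1) q | AlphaMinus \<Rightarrow> pi_alpha q
     | BetaPlus \<Rightarrow> pi_beta (- 1) q | BetaMinus \<Rightarrow> pi_alpha q)"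

definition circle_disp :: "gen \<Rightarrow> int" where
  "circle_disp g = (case g of AlphaPlus \<Rightarrow> 1 | AlphaMinus \<Rightarrow> - 1 | BetaPlus \<Rightarrow> 1 | BetaMinus \<Rightarrow> - 1)"

definition first_disp :: "gen \<Rightarrow> int" where
  "first_disp g = (case g of AlphaPlus \<Rightarrow> 0 | AlphaMinus \<Rightarrow> - 1 | BetaPlus \<Rightarrow> 1 | BetaMinus \<Rightarrow> 0)"

definition second_disp :: "gen \<Rightarrow> int" where
  "second_disp g = (case g of AlphaPlus \<Rightarrow> 0 | AlphaMinus \<Rightarrow> - 1 | BetaPlus \<Rightarrow> 0 | BetaMinus \<Rightarrow> - 1)"

text \<open>Together with the sign of \<open>\<pi>\<^sub>-\<close> this scalar matches the limit of
  the weight of \<open>\<alpha>\<^sub>+\<close>: the product of \<open>- q\<close>,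
  \<open>q ^ x\<close> and \<open>- (q ^ y)\<close> is \<open>q ^ (x + y + 1)\<close>.\<close>

definition gen_coeff :: "real \<Rightarrow> gen \<Rightarrow> real" where
  "gen_coeff q g = (case g of AlphaPlus \<Rightarrow> - q | _ \<Rightarrow> 1)"

definition first_weight :: "real \<Rightarrow> gen \<Rightarrow> int \<Rightarrow> real" where
  "first_weight q g p = (case g of AlphaPlus \<Rightarrow> beta_weight 1 q p | AlphaMinus \<Rightarrow> alpha_weight q p
     | BetaPlus \<Rightarrow> alpha_weight q (p + 1) | BetaMinus \<Rightarrow> beta_weight 1 q p)"

definition second_weight :: "real \<Rightarrow> gen \<Rightarrow> int \<Rightarrow> real" where
  "second_weight q g p = (case g of AlphaPlus \<Rightarrow> beta_weight (- 1) q p | AlphaMinus \<Rightarrow> alpha_weight q p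
     | BetaPlus \<Rightarrow> beta_weight (- 1) q p | BetaMinus \<Rightarrow> alpha_weight q p)"

lemma wshift_first_gen:
  assumes q: "0 < q" "q < 1"
  shows "disc.wshift (first_gen q g) (first_weight q g) (first_disp g)"
proof (cases g)
  case AlphaPlus
  obtain S where S: "is_adj UNIV (pi_beta 1 q) S" "disc.wshift S (\<lambda>p. beta_weight 1 q (p - 0)) (- 0)"
    by (rule disc.wshift_adj[OF wshift_pi_beta[OF q, of 1]]) auto
  then show ?thesis
    using AlphaPlus by (simp add: first_gen_def first_weight_def[abs_def] first_disp_def is_adj_adj[OF S(1)])
next
  case AlphaMinus
  then show ?thesis
    using wshift_pi_alpha[OF q] by (simp add: first_gen_def first_weight_def[abs_def] first_disp_def)
next
  case BetaPlus
  obtain S where S: "is_adj UNIV (pi_alpha q) S" "disc.wshift S (\<lambda>p. alpha_weight q (p - - 1)) (- (- 1))"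
    by (rule disc.wshift_adj[OF wshift_pi_alpha[OF q]])
  then show ?thesis
    using BetaPlus by (simp add: first_gen_def first_weight_def[abs_def] first_disp_def is_adj_adj[OF S(1)])
next
  case BetaMinus
  then show ?thesis
    using wshift_pi_beta[OF q, of 1] by (simp add: first_gen_def first_weight_def[abs_def] first_disp_def)
qed

lemma wshift_second_gen:
  assumes q: "0 < q" "q < 1"
  shows "disc.wshift (second_gen q g) (second_weight q g) (second_disp g)"
  using wshift_pi_beta[OF q, of "- 1"] wshift_pi_alpha[OF q]
  by (cases g) (simp_all add: second_gen_def second_weight_def[abs_def] second_disp_def)

lemma first_gen_in: "0 < q \<Longrightarrow> q < 1 \<Longrightarrow> first_gen q g \<in> smooth_disc_set"
  using disc_alg.star_in pi_beta_in_smooth_disc[of q 1] pi_alpha_in_smooth_disc[of q]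
  by (cases g) (auto simp: first_gen_def)

lemma second_gen_in: "0 < q \<Longrightarrow> q < 1 \<Longrightarrow> second_gen q g \<in> smooth_disc_set"
  using pi_beta_in_smooth_disc[of q "- 1"] pi_alpha_in_smooth_disc[of q]
  by (cases g) (auto simp: second_gen_def)


section \<open>The generators on the Hilbert space\<close>

definition idx_point :: "int \<times> int \<times> int \<Rightarrow> idx" where
  "idx_point = (\<lambda>(N, x, y). (of_int N / 2, of_int x - of_int N / 2, of_int y - of_int N / 2))"

definition idx_valid :: "(int \<times> int \<times> int) set" where
  "idx_valid = {(N, x, y). 0 \<le> x \<and> x \<le> N \<and> 0 \<le> y \<and> y \<le> N}"

text \<open>Injectivity holds on all integer triples, so matrix entries at
  \<open>idx_point (p + D)\<close> can be read off without knowing that \<open>p + D\<close> is a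
  valid label.\<close>

lemma idx_point_eq_iff: "idx_point p = idx_point p' \<longleftrightarrow> p = p'"
  by (auto simp: idx_point_def split: prod.splits)

lemma idx_bij: "bij_betw idx_point idx_valid idx_set"
proof (rule bij_betw_imageI)
  show "inj_on idx_point idx_valid" by (auto simp: inj_on_def idx_point_eq_iff)
  show "idx_point ` idx_valid = idx_set"
  proof
    show "idx_point ` idx_valid \<subseteq> idx_set"
    proof (rule image_subsetI)
      fix p assume "p \<in> idx_valid"
      moreover obtain N x y where p: "p = (N, x, y)" by (cases p)
      ultimately have v: "0 \<le> x" "x \<le> N" "0 \<le> y" "y \<le> N" by (auto simp: idx_valid_def)
      then have "0 \<le> N" by linarith
      obtain N' x' y' where [simp]: "N = int N'" "x = int x'" "y = int y'"
        using zero_le_imp_eq_int[OF \<open>0 \<le> N\<close>] zero_le_imp_eq_int[OF v(1)] zero_le_imp_eq_int[OF v(3)] by blast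
      have "x' \<le> N'" "y' \<le> N'" using v by simp_all
      then show "idx_point p \<in> idx_set"
        by (simp add: p idx_set_def idx_point_def) (intro exI[of _ "real N' / 2"] conjI exI[of _ N'] exI[of _ x'] exI[of _ y']; simp)
    qed
    show "idx_set \<subseteq> idx_point ` idx_valid"
    proof
      fix v assume "v \<in> idx_set"
      then obtain N x y :: nat where v: "x \<le> N" "y \<le> N" "v = (real N / 2, real x - real N / 2, real y - real N / 2)"
        unfolding idx_set_def by blast
      then have "v = idx_point (int N, int x, int y)" "(int N, int x, int y) \<in> idx_valid"
        by (auto simp: idx_point_def idx_valid_def)
      then show "v \<in> idx_point ` idx_valid" by blast
    qed
  qed
qed

interpretation idx: shift_lattice idx_set idx_valid idx_point
  by unfold_locales (rule idx_bij)

definition hilbert_disp :: "gen \<Rightarrow> int \<times> int \<times> int" where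
  "hilbert_disp g = (circle_disp g, first_disp g, second_disp g)"

definition raw_weight :: "real \<Rightarrow> gen \<Rightarrow> idx \<Rightarrow> real" where
  "raw_weight q g = (\<lambda>(n, i, j). case g of AlphaPlus \<Rightarrow> a_plus q n i j | AlphaMinus \<Rightarrow> a_minus q n i j
     | BetaPlus \<Rightarrow> b_plus q n i j | BetaMinus \<Rightarrow> b_minus q n i j)"

text \<open>The cut-off is what \<open>idx.weight\<close> demands; at valid labels it changes
  nothing, by \<open>raw_weight_eq_hilbert\<close>.\<close>

definition hilbert_weight :: "real \<Rightarrow> gen \<Rightarrow> int \<times> int \<times> int \<Rightarrow> real" where
  "hilbert_weight q g p =
     (if p \<in> idx_valid \<and> p + hilbert_disp g \<in> idx_valid then raw_weight q g (idx_point p) else 0)"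

lemma raw_weight_AlphaPlus: "raw_weight q AlphaPlus (idx_point (N, x, y)) =
    q powr (of_int x + of_int y + 1) *
     (sqrt (1 - q powr (2 * of_int N - 2 * of_int y + 2)) * sqrt (1 - q powr (2 * of_int N - 2 * of_int x + 2))) /
     (sqrt (1 - q powr (2 * of_int N + 2)) * sqrt (1 - q powr (2 * of_int N + 4)))"
  by (simp add: raw_weight_def idx_point_def a_plus_def algebra_simps)

lemma raw_weight_AlphaMinus: "raw_weight q AlphaMinus (idx_point (N, x, y)) =
    (if N = 0 then 0 else (sqrt (1 - q powr (2 * of_int y)) * sqrt (1 - q powr (2 * of_int x))) /
     (sqrt (1 - q powr (2 * of_int N)) * sqrt (1 - q powr (2 * of_int N + 2))))"
  by (simp add: raw_weight_def idx_point_def a_minus_def algebra_simps)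

lemma raw_weight_BetaPlus: "raw_weight q BetaPlus (idx_point (N, x, y)) =
    - (q powr of_int y) *
     (sqrt (1 - q powr (2 * of_int N - 2 * of_int y + 2)) * sqrt (1 - q powr (2 * of_int x + 2))) /
     (sqrt (1 - q powr (2 * of_int N + 2)) * sqrt (1 - q powr (2 * of_int N + 4)))"
  by (simp add: raw_weight_def idx_point_def b_plus_def algebra_simps)

lemma raw_weight_BetaMinus: "raw_weight q BetaMinus (idx_point (N, x, y)) =
    (if N = 0 then 0 else q powr of_int x *
     (sqrt (1 - q powr (2 * of_int y)) * sqrt (1 - q powr (2 * of_int N - 2 * of_int x))) /
     (sqrt (1 - q powr (2 * of_int N)) * sqrt (1 - q powr (2 * of_int N + 2))))"
  by (simp add: raw_weight_def idx_point_def b_minus_def algebra_simps)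

lemmas raw_weight_eqs = raw_weight_AlphaPlus raw_weight_AlphaMinus raw_weight_BetaPlus raw_weight_BetaMinus

lemma powr_bounds:
  fixes q :: real
  assumes "0 < q" "q < 1" "0 \<le> t"
  shows "0 \<le> q powr t" "q powr t \<le> 1"
  using assms powr_mono'[of 0 t q] by auto

text \<open>The numerator is a product of factors in the unit interval. The exponents in the
  denominator are at least 2, so each root there is at least
  \<open>sqrt (1 - q\<^sup>2)\<close>.\<close>

lemma quotient_bound:
  fixes q :: real
  assumes q: "0 < q" "q < 1" and t: "0 \<le> t1" "0 \<le> t2" "0 \<le> t3" "2 \<le> t4" "2 \<le> t5"
  shows "\<bar>q powr t1 * (sqrt (1 - q powr t2) * sqrt (1 - q powr t3)) / (sqrt (1 - q powr t4) * sqrt (1 - q powr t5))\<bar>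
    \<le> 1 / (1 - q\<^sup>2)"
proof -
  have d: "sqrt (1 - q\<^sup>2) \<le> sqrt (1 - q powr t)" if "2 \<le> t" for t
    using powr_mono'[OF that, of q] q by simp
  have q2: "0 < 1 - q\<^sup>2" using q by (simp add: power_less_one_iff abs_square_less_1)
  then have p: "0 < sqrt (1 - q\<^sup>2)" by simp
  have den: "1 - q\<^sup>2 \<le> sqrt (1 - q powr t4) * sqrt (1 - q powr t5)"
    using mult_mono[OF d[OF t(4)] d[OF t(5)]] p q2 less_le_trans[OF p d[OF t(4)]] by simp
  have s: "0 \<le> sqrt (1 - q powr t) \<and> sqrt (1 - q powr t) \<le> 1" if "0 \<le> t" for t
    using powr_bounds[OF q that] by simp
  have num: "\<bar>q powr t1 * (sqrt (1 - q powr t2) * sqrt (1 - q powr t3))\<bar> \<le> 1"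
    using powr_bounds[OF q t(1)] s[OF t(2)] s[OF t(3)] by (simp add: abs_mult mult_le_one)
  show ?thesis
    unfolding abs_divide using den num q2 by (intro frac_le) auto
qed

lemma hilbert_weight_bounded:
  assumes q: "0 < q" "q < 1"
  shows "\<bar>hilbert_weight q g p\<bar> \<le> 1 / (1 - q\<^sup>2)"
proof (cases "p \<in> idx_valid \<and> p + hilbert_disp g \<in> idx_valid")
  case True
  obtain N x y where p: "p = (N, x, y)" by (cases p)
  have v: "0 \<le> x" "x \<le> N" "0 \<le> y" "y \<le> N" using True by (auto simp: p idx_valid_def)
  have one: "q powr 0 = 1" using q by simp
  have "\<bar>raw_weight q g (idx_point (N, x, y))\<bar> \<le> 1 / (1 - q\<^sup>2)"
  proof (cases g)
    case AlphaPlus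
    show ?thesis
      unfolding AlphaPlus raw_weight_eqs by (rule quotient_bound[OF q]) (use v in auto)
  next
    case AlphaMinus
    \<comment> \<open>A valid target of a lowering generator forces \<open>N \<ge> 1\<close>. This
      avoids the special value at \<open>n = 0\<close> and gives the exponent
      \<open>2 * N \<ge> 2\<close> in the denominator.\<close>
    then have N: "1 \<le> N" using True by (auto simp: p idx_valid_def hilbert_disp_def circle_disp_def)
    then have "raw_weight q g (idx_point (N, x, y)) =
      q powr 0 * (sqrt (1 - q powr (2 * of_int y)) * sqrt (1 - q powr (2 * of_int x))) /
       (sqrt (1 - q powr (2 * of_int N)) * sqrt (1 - q powr (2 * of_int N + 2)))"
      using AlphaMinus q by (simp add: raw_weight_eqs one)
    then show ?thesis by (simp only:) (rule quotient_bound[OF q]; use v N in auto)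
  next
    case BetaPlus
    have "raw_weight q g (idx_point (N, x, y)) = - (q powr of_int y *
     (sqrt (1 - q powr (2 * of_int N - 2 * of_int y + 2)) * sqrt (1 - q powr (2 * of_int x + 2))) /
     (sqrt (1 - q powr (2 * of_int N + 2)) * sqrt (1 - q powr (2 * of_int N + 4))))"
      by (simp add: BetaPlus raw_weight_eqs)
    then show ?thesis by (simp only: abs_minus_cancel) (rule quotient_bound[OF q]; use v in auto)
  next
    case BetaMinus
    then have N: "1 \<le> N" using True by (auto simp: p idx_valid_def hilbert_disp_def circle_disp_def)
    then have "raw_weight q g (idx_point (N, x, y)) =
      q powr of_int x * (sqrt (1 - q powr (2 * of_int y)) * sqrt (1 - q powr (2 * of_int N - 2 * of_int x))) /
       (sqrt (1 - q powr (2 * of_int N)) * sqrt (1 - q powr (2 * of_int N + 2)))"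
      using BetaMinus by (simp add: raw_weight_eqs)
    then show ?thesis by (simp only:) (rule quotient_bound[OF q]; use v N in auto)
  qed
  then show ?thesis using True by (simp add: hilbert_weight_def p)
next
  case False
  have "0 < 1 - q\<^sup>2" using q by (simp add: power_less_one_iff abs_square_less_1)
  then show ?thesis using False by (auto simp: hilbert_weight_def)
qed

lemma weight_hilbert:
  assumes q: "0 < q" "q < 1"
  shows "idx.weight (hilbert_weight q g) (hilbert_disp g)"
  unfolding idx.weight_def
proof
  show "\<forall>p. hilbert_weight q g p \<noteq> 0 \<longrightarrow> p \<in> idx_valid \<and> p + hilbert_disp g \<in> idx_valid"
    by (auto simp: hilbert_weight_def)
  show "\<exists>K. \<forall>p. \<bar>hilbert_weight q g p\<bar> \<le> K" using hilbert_weight_bounded[OF q] by blast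
qed

text \<open>The coefficients vanish whenever the target label does not exist.\<close>

lemma raw_weight_eq_hilbert:
  assumes q: "0 < q" "q < 1" and p: "p \<in> idx_valid"
  shows "raw_weight q g (idx_point p) = hilbert_weight q g p"
proof (cases "p + hilbert_disp g \<in> idx_valid")
  case False
  obtain N x y where [simp]: "p = (N, x, y)" by (cases p)
  have v: "0 \<le> x" "x \<le> N" "0 \<le> y" "y \<le> N" using p by (auto simp: idx_valid_def)
  have one: "q powr 0 = 1" using q by simp
  have "raw_weight q g (idx_point p) = 0"
  \<comment> \<open>The targets of the raising generators are always valid. A lowering one leaves
    the labels only at \<open>x = 0\<close> or \<open>y = 0\<close>, respectively at
    \<open>x = N\<close> or \<open>y = 0\<close>, where a factor \<open>sqrt (1 - q powr 0)\<close>
    vanishes.\<close>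
  proof (cases g)
    case AlphaMinus
    then have "x = 0 \<or> y = 0"
      using False v by (auto simp: idx_valid_def hilbert_disp_def circle_disp_def first_disp_def second_disp_def)
    then show ?thesis using AlphaMinus one by (auto simp: raw_weight_AlphaMinus)
  next
    case BetaMinus
    then have "x = N \<or> y = 0"
      using False v by (auto simp: idx_valid_def hilbert_disp_def circle_disp_def first_disp_def second_disp_def)
    then show ?thesis using BetaMinus one by (auto simp: raw_weight_BetaMinus)
  qed (use False v in \<open>auto simp: idx_valid_def hilbert_disp_def circle_disp_def first_disp_def second_disp_def\<close>)
  then show ?thesis using False by (simp add: hilbert_weight_def)
qed (use p in \<open>simp add: hilbert_weight_def\<close>)

lemma wshift_hilbert_gen:
  assumes q: "0 < q" "q < 1"
  shows "idx.wshift (hilbert_gen q g) (hilbert_weight q g) (hilbert_disp g)"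
proof -
  \<comment> \<open>One formula for all four defining maps: as \<open>i = x - N / 2\<close>, the
    displacements of \<open>x\<close> and \<open>N\<close> move \<open>i\<close> by
    \<open>first_disp g - circle_disp g / 2\<close>, and likewise for \<open>j\<close>.\<close>
  define F where "F = (\<lambda>(n, i, j) v. complex_of_real (raw_weight q g (n, i, j)) *
    basis_vec (n + of_int (circle_disp g) / 2,
      i + (of_int (first_disp g) - of_int (circle_disp g) / 2),
      j + (of_int (second_disp g) - of_int (circle_disp g) / 2)) v)"
  have "hilbert_gen q g = op_of_basis idx_set F"
    by (cases g)
      (simp_all add: hilbert_gen_def F_def raw_weight_def circle_disp_def first_disp_def second_disp_def
        alpha_plus_def alpha_minus_def beta_plus_def beta_minus_def)
  moreover have "F (idx_point p) = (\<lambda>v. complex_of_real (hilbert_weight q g p) * basis_vec (idx_point (p + hilbert_disp g)) v)"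
    if "p \<in> idx_valid" for p
  proof -
    obtain N x y where p: "p = (N, x, y)" by (cases p)
    have "idx_point (p + hilbert_disp g) = (of_int N / 2 + of_int (circle_disp g) / 2,
      of_int x - of_int N / 2 + (of_int (first_disp g) - of_int (circle_disp g) / 2),
      of_int y - of_int N / 2 + (of_int (second_disp g) - of_int (circle_disp g) / 2))"
      by (simp add: p idx_point_def hilbert_disp_def add_divide_distrib)
    then show ?thesis
      using raw_weight_eq_hilbert[OF q that, of g] by (simp add: F_def p idx_point_def)
  qed
  ultimately show ?thesis using idx.wshift_op_of_basis[OF weight_hilbert[OF q]] by simp
qed


section \<open>The limit of the weights\<close>

lemma powr_int_tendsto_0:
  assumes q: "0 < q" "q < (1::real)"
  shows "((\<lambda>N. q powr (2 * of_int N + c)) \<longlongrightarrow> 0) at_top"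
proof -
  have "filterlim (\<lambda>N::int. c + real_of_int N * 2) at_top at_top"
    by (intro filterlim_tendsto_add_at_top[OF tendsto_const] filterlim_at_top_mult_tendsto_pos[OF tendsto_const]
        filterlim_real_of_int_at_top) auto
  then have "filterlim (\<lambda>N::int. ln q * (c + real_of_int N * 2)) at_bot at_top"
    by (rule filterlim_tendsto_neg_mult_at_bot[OF tendsto_const, rotated]) (use q in auto)
  from filterlim_compose[OF exp_at_bot this] show ?thesis
    using q by (simp add: powr_def algebra_simps)
qed

lemma sqrt_tendsto_1:
  assumes q: "0 < q" "q < (1::real)"
  shows "((\<lambda>N. sqrt (1 - q powr (2 * of_int N + c))) \<longlongrightarrow> 1) at_top"
  using tendsto_real_sqrt[OF tendsto_diff[OF tendsto_const[of 1] powr_int_tendsto_0[OF q, of c]]] by simp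

text \<open>Only the exponents containing \<open>N\<close> move, and their roots tend to 1. What
  remains is a power of \<open>q\<close> and roots in \<open>x\<close> and \<open>y\<close> alone,
  which factor into the two disc weights.\<close>

lemma raw_weight_tendsto:
  assumes q: "0 < q" "q < 1" and x: "0 \<le> x" "0 \<le> x + first_disp g" and y: "0 \<le> y" "0 \<le> y + second_disp g"
  shows "((\<lambda>N. raw_weight q g (idx_point (N, x, y))) \<longlongrightarrow>
    gen_coeff q g * first_weight q g x * second_weight q g y) at_top"
proof -
  have pw: "q powr (of_int p) = q ^ nat p" if "0 \<le> p" for p :: int
    using that q by (metis of_nat_nat of_int_of_nat_eq powr_realpow)
  have pw2: "q powr (2 * of_int p) = q ^ (2 * nat p)" if "0 \<le> p" for p :: int
    using pw[of "2 * p"] that by (simp add: nat_mult_distrib)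
  have den1: "((\<lambda>N. sqrt (1 - q powr (2 * of_int N + 2)) * sqrt (1 - q powr (2 * of_int N + 4))) \<longlongrightarrow> 1 * 1) at_top"
    by (intro tendsto_mult sqrt_tendsto_1 q)
  have den2: "((\<lambda>N. sqrt (1 - q powr (2 * of_int N)) * sqrt (1 - q powr (2 * of_int N + 2))) \<longlongrightarrow> 1 * 1) at_top"
    using tendsto_mult[OF sqrt_tendsto_1[OF q, of 0] sqrt_tendsto_1[OF q, of 2]] by simp
  \<comment> \<open>The limit passes over the value 0 assigned to the lowering weights at
    \<open>n = 0\<close>.\<close>
  have ev: "\<forall>\<^sub>F N in at_top. N \<noteq> (0::int)"
    using eventually_gt_at_top[of "0::int"] by eventually_elim simp
  have s1: "((\<lambda>N. sqrt (1 - q powr (2 * of_int N - 2 * of_int z + 2))) \<longlongrightarrow> 1) at_top" for z :: int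
    using sqrt_tendsto_1[OF q, of "2 - 2 * of_int z"] by (simp add: algebra_simps)
  have s2: "((\<lambda>N. sqrt (1 - q powr (2 * of_int N - 2 * of_int z))) \<longlongrightarrow> 1) at_top" for z :: int
    using sqrt_tendsto_1[OF q, of "- 2 * of_int z"] by (simp add: algebra_simps)
  show ?thesis
  proof (cases g)
    case AlphaPlus
    have "((\<lambda>N. raw_weight q g (idx_point (N, x, y))) \<longlongrightarrow> q powr (of_int x + of_int y + 1) * (1 * 1) / (1 * 1)) at_top"
      unfolding AlphaPlus raw_weight_eqs by (intro tendsto_divide den1 tendsto_mult tendsto_const s1) simp
    moreover have "q powr (of_int x + of_int y + 1) = q ^ nat x * q ^ nat y * q"
      using pw[OF x(1)] pw[OF y(1)] q by (simp add: powr_add)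
    ultimately show ?thesis
      using AlphaPlus x y by (simp add: gen_coeff_def first_weight_def second_weight_def beta_weight_def mult_ac)
  next
    case AlphaMinus
    have *: "1 \<le> x" "1 \<le> y" using x y AlphaMinus by (auto simp: first_disp_def second_disp_def)
    have "((\<lambda>N. (sqrt (1 - q powr (2 * of_int y)) * sqrt (1 - q powr (2 * of_int x))) /
      (sqrt (1 - q powr (2 * of_int N)) * sqrt (1 - q powr (2 * of_int N + 2)))) \<longlongrightarrow>
        (sqrt (1 - q powr (2 * of_int y)) * sqrt (1 - q powr (2 * of_int x))) / (1 * 1)) at_top"
      by (intro tendsto_divide den2 tendsto_const) simp
    then have "((\<lambda>N. raw_weight q g (idx_point (N, x, y))) \<longlongrightarrow>
        (sqrt (1 - q powr (2 * of_int y)) * sqrt (1 - q powr (2 * of_int x))) / (1 * 1)) at_top"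
      unfolding AlphaMinus raw_weight_eqs
      by (rule Lim_transform_eventually) (rule eventually_mono[OF ev], simp)
    then show ?thesis
      using AlphaMinus * pw2[of x] pw2[of y]
      by (simp add: gen_coeff_def first_weight_def second_weight_def alpha_weight_def mult_ac)
  next
    case BetaPlus
    have "((\<lambda>N. raw_weight q g (idx_point (N, x, y))) \<longlongrightarrow> - (q powr of_int y) * (1 * sqrt (1 - q powr (2 * of_int x + 2))) / (1 * 1)) at_top"
      unfolding BetaPlus raw_weight_eqs by (intro tendsto_divide den1 tendsto_mult tendsto_const s1) simp
    moreover have "q powr (2 * of_int x + 2) = q ^ (2 * nat (x + 1))"
      using pw2[of "x + 1"] x by (simp add: algebra_simps)
    ultimately show ?thesis
      using BetaPlus x y pw[OF y(1)] by (simp add: gen_coeff_def first_weight_def second_weight_def alpha_weight_def beta_weight_def mult_ac)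
  next
    case BetaMinus
    have *: "1 \<le> y" using x y BetaMinus by (auto simp: second_disp_def)
    have "((\<lambda>N. q powr of_int x * (sqrt (1 - q powr (2 * of_int y)) * sqrt (1 - q powr (2 * of_int N - 2 * of_int x))) /
      (sqrt (1 - q powr (2 * of_int N)) * sqrt (1 - q powr (2 * of_int N + 2)))) \<longlongrightarrow>
        q powr of_int x * (sqrt (1 - q powr (2 * of_int y)) * 1) / (1 * 1)) at_top"
      by (intro tendsto_divide den2 tendsto_mult tendsto_const s2) simp
    then have "((\<lambda>N. raw_weight q g (idx_point (N, x, y))) \<longlongrightarrow>
        q powr of_int x * (sqrt (1 - q powr (2 * of_int y)) * 1) / (1 * 1)) at_top"
      unfolding BetaMinus raw_weight_eqs
      by (rule Lim_transform_eventually) (rule eventually_mono[OF ev], simp)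
    then show ?thesis
      using BetaMinus * x pw[OF x(1)] pw2[of y]
      by (simp add: gen_coeff_def first_weight_def second_weight_def alpha_weight_def beta_weight_def mult_ac)
  qed
qed

lemma hilbert_weight_tendsto:
  assumes q: "0 < q" "q < 1"
  shows "((\<lambda>N. hilbert_weight q g (N, x, y)) \<longlongrightarrow>
    gen_coeff q g * first_weight q g x * second_weight q g y) at_top"
proof (cases "0 \<le> x \<and> 0 \<le> x + first_disp g \<and> 0 \<le> y \<and> 0 \<le> y + second_disp g")
  case True
  have "\<bar>circle_disp g\<bar> \<le> 1" "\<bar>first_disp g\<bar> \<le> 1" "\<bar>second_disp g\<bar> \<le> 1"
    by (cases g; simp add: circle_disp_def first_disp_def second_disp_def)+
  then have v: "(N, x, y) \<in> idx_valid \<and> (N, x, y) + hilbert_disp g \<in> idx_valid" if "x + y + 2 \<le> N" for N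
    using True that by (auto simp: idx_valid_def hilbert_disp_def)
  have "\<forall>\<^sub>F N in at_top. raw_weight q g (idx_point (N, x, y)) = hilbert_weight q g (N, x, y)"
    by (rule eventually_mono[OF eventually_ge_at_top[of "x + y + 2"]]) (use v in \<open>simp add: hilbert_weight_def\<close>)
  then show ?thesis
    by (rule Lim_transform_eventually[rotated]) (use True in \<open>auto intro!: raw_weight_tendsto q\<close>)
next
  case False
  \<comment> \<open>A negative coordinate at the source or the target persists for every
    \<open>N\<close>, and it also makes one of the disc weights vanish; both sides are 0.\<close>
  have "hilbert_weight q g (N, x, y) = 0" for N
    using False by (auto simp: hilbert_weight_def idx_valid_def hilbert_disp_def)
  moreover have "first_weight q g x = 0 \<or> second_weight q g y = 0"
    using False disc.wshiftD(3,4)[OF wshift_first_gen[OF q], of g x] disc.wshiftD(3,4)[OF wshift_second_gen[OF q], of g y]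
    by auto
  ultimately show ?thesis by auto
qed


section \<open>Comparing the two representations\<close>

lemma sum_list_group:
  fixes f :: "'x \<Rightarrow> complex"
  assumes "finite S" "k ` set L \<subseteq> S"
  shows "(\<Sum>x\<leftarrow>L. f x * c (k x)) = (\<Sum>d\<in>S. c d * (\<Sum>x\<leftarrow>L. if k x = d then f x else 0))"
  using assms(2)
proof (induction L)
  case (Cons a L)
  have "(\<Sum>d\<in>S. c d * (\<Sum>x\<leftarrow>a # L. if k x = d then f x else 0)) =
    (\<Sum>d\<in>S. if k a = d then c d * f a else 0) + (\<Sum>d\<in>S. c d * (\<Sum>x\<leftarrow>L. if k x = d then f x else 0))"
    unfolding sum.distrib[symmetric] by (rule sum.cong) (auto simp: algebra_simps)
  also have "(\<Sum>d\<in>S. if k a = d then c d * f a else 0) = f a * c (k a)"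
    using Cons.prems assms(1) by (simp add: sum.delta')
  finally show ?case using Cons by simp
qed simp

lemma tendsto_sum_list:
  fixes f :: "'x \<Rightarrow> 'y \<Rightarrow> complex"
  assumes "\<And>x. x \<in> set L \<Longrightarrow> (f x \<longlongrightarrow> l x) F"
  shows "((\<lambda>y. \<Sum>x\<leftarrow>L. f x y) \<longlongrightarrow> (\<Sum>x\<leftarrow>L. l x)) F"
  using assms by (induction L) (auto intro: tendsto_add)

lemma filterlim_int_add_at_top: "filterlim (\<lambda>N::int. N + c) at_top at_top"
  unfolding filterlim_at_top
proof
  fix Z
  show "\<forall>\<^sub>F N in at_top. Z \<le> N + c"
    by (rule eventually_mono[OF eventually_ge_at_top[of "Z - c"]]) simp
qed

text \<open>Noncommutative polynomials in the generators and their adjoints. Like terms are not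
  collected: only the values under \<open>eval_H\<close> and \<open>eval_T\<close> matter, and the
  operations stay simple list operations.\<close>

type_synonym free_elem = "(complex \<times> letter list) list"

definition free_mult :: "free_elem \<Rightarrow> free_elem \<Rightarrow> free_elem" where
  "free_mult p p' = concat (map (\<lambda>(z, w). map (\<lambda>(z', w'). (z * z', w @ w')) p') p)"

definition free_star :: "free_elem \<Rightarrow> free_elem" where
  "free_star p = map (\<lambda>(z, w). (cnj z, rev (map flip w))) p"

definition free_scale :: "complex \<Rightarrow> free_elem \<Rightarrow> free_elem" where
  "free_scale c p = map (\<lambda>(z, w). (c * z, w)) p"

locale quantum_parameter =
  fixes q :: real
  assumes q: "0 < q" "q < 1"
begin

abbreviation "letter_H \<equiv> with_adj idx_set (hilbert_gen q)"
abbreviation "letter_A \<equiv> with_adj UNIV (first_gen q)"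
abbreviation "letter_B \<equiv> with_adj UNIV (second_gen q)"

abbreviation "op_H \<equiv> word_op idx_set letter_H"
abbreviation "op_A \<equiv> word_op UNIV letter_A"
abbreviation "op_B \<equiv> word_op UNIV letter_B"

abbreviation "disp_H \<equiv> word_disp (letter_disp hilbert_disp)"
abbreviation "disp_A \<equiv> word_disp (letter_disp first_disp)"
abbreviation "disp_B \<equiv> word_disp (letter_disp second_disp)"
abbreviation "disp_C \<equiv> word_disp (letter_disp circle_disp)"

abbreviation "weight_H \<equiv> word_weight idx_valid (letter_weight (hilbert_weight q) hilbert_disp) (letter_disp hilbert_disp)"
abbreviation "weight_A \<equiv> word_weight {0..} (letter_weight (first_weight q) first_disp) (letter_disp first_disp)"
abbreviation "weight_B \<equiv> word_weight {0..} (letter_weight (second_weight q) second_disp) (letter_disp second_disp)"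

definition coeff :: "letter list \<Rightarrow> real" where
  "coeff w = (\<Prod>l\<leftarrow>w. gen_coeff q (fst l))"

lemma letter_H:
  "idx.wshift (letter_H l) (letter_weight (hilbert_weight q) hilbert_disp l) (letter_disp hilbert_disp l)"
  "is_adj idx_set (letter_H l) (letter_H (flip l))"
  by (rule idx.wshift_letter[where f = "hilbert_gen q" and D = hilbert_disp, OF wshift_hilbert_gen[OF q]])+

lemma letter_A:
  "disc.wshift (letter_A l) (letter_weight (first_weight q) first_disp l) (letter_disp first_disp l)"
  "is_adj UNIV (letter_A l) (letter_A (flip l))"
  by (rule disc.wshift_letter[where f = "first_gen q" and D = first_disp, OF wshift_first_gen[OF q]])+

lemma letter_B:
  "disc.wshift (letter_B l) (letter_weight (second_weight q) second_disp l) (letter_disp second_disp l)"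
  "is_adj UNIV (letter_B l) (letter_B (flip l))"
  by (rule disc.wshift_letter[where f = "second_gen q" and D = second_disp, OF wshift_second_gen[OF q]])+

lemma wshift_H: "idx.wshift (op_H w) (weight_H w) (disp_H w)"
  by (rule idx.wshift_word[OF letter_H(1)])

lemma wshift_A: "disc.wshift (op_A w) (weight_A w) (disp_A w)"
  by (rule disc.wshift_word[OF letter_A(1)])

lemma wshift_B: "disc.wshift (op_B w) (weight_B w) (disp_B w)"
  by (rule disc.wshift_word[OF letter_B(1)])

lemma bounded_letters: "bounded_op idx_set (letter_H l)" "bounded_op UNIV (letter_A l)" "bounded_op UNIV (letter_B l)"
  using idx.wshiftD(1)[OF letter_H(1)] disc.wshiftD(1)[OF letter_A(1)] disc.wshiftD(1)[OF letter_B(1)] by blast+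

lemma bounded_op_H: "bounded_op idx_set (op_H w)"
  by (rule idx.wshiftD(1)[OF wshift_H])

lemma op_A_in: "op_A w \<in> smooth_disc_set"
proof (induction w)
  case Nil
  show ?case using disc_alg.one_in by simp
next
  case (Cons l w)
  have "letter_A l \<in> smooth_disc_set"
    using first_gen_in[OF q] disc_alg.star_in[of "first_gen q (fst l)"] by (simp add: with_adj_def)
  then show ?case using disc_alg.mult_in[of "letter_A l" "op_A w"] Cons by (simp only: word_op.simps smooth_disc_simps)
qed

lemma op_B_in: "op_B w \<in> smooth_disc_set"
proof (induction w)
  case Nil
  show ?case using disc_alg.one_in by simp
next
  case (Cons l w)
  have "letter_B l \<in> smooth_disc_set"
    using second_gen_in[OF q] disc_alg.star_in[of "second_gen q (fst l)"] by (simp add: with_adj_def)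
  then show ?case using disc_alg.mult_in[of "letter_B l" "op_B w"] Cons by (simp only: word_op.simps smooth_disc_simps)
qed

text \<open>The displacement on the Hilbert space consists of exactly the data visible on the tensor
  side: the exponent of \<open>u\<close> and the diagonals occupied in the two disc factors.\<close>

lemma disp_H_eq: "disp_H w = (disp_C w, disp_A w, disp_B w)"
  by (induction w) (auto simp: zero_prod_def letter_disp_def hilbert_disp_def)

lemma letter_weight_tendsto:
  "((\<lambda>N. letter_weight (hilbert_weight q) hilbert_disp l (N, x, y)) \<longlongrightarrow>
    gen_coeff q (fst l) * letter_weight (first_weight q) first_disp l x * letter_weight (second_weight q) second_disp l y) at_top"
proof (cases "snd l")
  case True
  let ?g = "fst l"
  have "((\<lambda>N. hilbert_weight q ?g (N + - circle_disp ?g, x - first_disp ?g, y - second_disp ?g)) \<longlongrightarrow>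
      gen_coeff q ?g * first_weight q ?g (x - first_disp ?g) * second_weight q ?g (y - second_disp ?g)) at_top"
    by (rule filterlim_compose[OF hilbert_weight_tendsto[OF q] filterlim_int_add_at_top])
  then show ?thesis using True by (simp add: letter_weight_def hilbert_disp_def)
next
  case False
  then show ?thesis using hilbert_weight_tendsto[OF q] by (simp add: letter_weight_def)
qed

text \<open>Far away from the boundary of the set of labels, a word acts on the Hilbert space as its image does
  on \<open>\<ell>\<^sup>2(\<nat>) \<otimes> \<ell>\<^sup>2(\<nat>) \<otimes> \<ell>\<^sup>2(\<int>)\<close>.\<close>

lemma weight_H_tendsto:
  "((\<lambda>N. weight_H w (N, x, y)) \<longlongrightarrow> coeff w * weight_A w x * weight_B w y) at_top"
proof (induction w)
  case Nil
  show ?case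
  proof (cases "0 \<le> x \<and> 0 \<le> y")
    case True
    have "\<forall>\<^sub>F N in at_top. 1 = weight_H [] (N, x, y)"
      by (rule eventually_mono[OF eventually_ge_at_top[of "max x y"]]) (use True in \<open>simp add: idx_valid_def\<close>)
    then show ?thesis
      by (rule Lim_transform_eventually[rotated]) (use True in \<open>simp add: coeff_def\<close>)
  next
    case False
    then have "weight_H [] (N, x, y) = 0" for N by (auto simp: idx_valid_def)
    then show ?thesis using False by auto
  qed
next
  case (Cons l w)
  have "((\<lambda>N. letter_weight (hilbert_weight q) hilbert_disp l (N + disp_C w, x + disp_A w, y + disp_B w)) \<longlongrightarrow>
    gen_coeff q (fst l) * letter_weight (first_weight q) first_disp l (x + disp_A w) *
      letter_weight (second_weight q) second_disp l (y + disp_B w)) at_top"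
    by (rule filterlim_compose[OF letter_weight_tendsto filterlim_int_add_at_top])
  from tendsto_mult[OF this Cons] show ?case
    by (simp add: disp_H_eq coeff_def mult_ac)
qed

lemma op_H_entry:
  assumes "p \<in> idx_valid"
  shows "op_H w (basis_vec (idx_point p)) (idx_point (p + D)) = (if D = disp_H w then of_real (weight_H w p) else 0)"
  unfolding idx.wshift_basis[OF wshift_H assms] by (simp add: basis_vec_def idx_point_eq_iff)

section \<open>Evaluation of noncommutative polynomials in both algebras\<close>

definition eval_H :: "free_elem \<Rightarrow> idx opr" where
  "eval_H p = (\<lambda>\<xi> v. \<Sum>(z, w)\<leftarrow>p. z * op_H w \<xi> v)"

definition tensor_terms :: "free_elem \<Rightarrow> (nat opr, nat opr, real \<Rightarrow> complex) tensor_list" where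
  "tensor_terms p = map (\<lambda>(z, w). (z * of_real (coeff w), op_A w, op_B w, \<lambda>\<theta>. cis (of_int (disp_C w) * \<theta>))) p"

definition eval_T :: "free_elem \<Rightarrow> (nat opr, nat opr, real \<Rightarrow> complex) tensor" where
  "eval_T p = target.tensor_sum (tensor_terms p)"

lemma eval_H_Nil: "eval_H [] = (\<lambda>\<xi> v. 0)"
  by (simp add: eval_H_def)

lemma eval_H_Cons: "eval_H ((z, w) # p) = op_add (op_scale z (op_H w)) (eval_H p)"
  by (simp add: eval_H_def op_add_def op_scale_def)

lemma eval_H_append: "eval_H (p @ p') = op_add (eval_H p) (eval_H p')"
  by (simp add: eval_H_def op_add_def)

lemma eval_H_scale: "eval_H (free_scale c p) = op_scale c (eval_H p)"
proof (induction p)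
  case (Cons a p)
  then show ?case by (cases a) (simp add: free_scale_def eval_H_Cons op_add_def op_scale_def algebra_simps)
qed (simp add: free_scale_def eval_H_Nil op_scale_def)

lemma bounded_eval_H: "bounded_op idx_set (eval_H p)"
proof (induction p)
  case (Cons a p)
  then show ?case by (cases a) (simp add: eval_H_Cons bounded_op_add bounded_op_scale bounded_op_H)
qed (simp add: eval_H_Nil bounded_op_zero)

lemma op_H_comp_eval: "op_H w \<circ> eval_H p = eval_H (map (\<lambda>(z', w'). (z', w @ w')) p)"
proof (induction p)
  case Nil
  show ?case by (rule ext) (simp add: eval_H_Nil bounded_op_0[OF bounded_op_H])
next
  case (Cons a p)
  obtain z' w' where a: "a = (z', w')" by (cases a)
  show ?case
    unfolding a eval_H_Cons comp_op_add[OF bounded_op_H bounded_op_scale[OF bounded_op_H] bounded_eval_H]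
      comp_op_scale[OF bounded_op_H bounded_op_H] Cons
    by (simp only: list.map prod.case eval_H_Cons word_op_append[OF bounded_letters(1)])
qed

lemma eval_H_mult: "eval_H (free_mult p p') = eval_H p \<circ> eval_H p'"
proof (induction p)
  case Nil
  show ?case by (rule ext) (simp add: eval_H_Nil free_mult_def)
next
  case (Cons a p)
  obtain z w where a: "a = (z, w)" by (cases a)
  have "free_mult (a # p) p' = free_scale z (map (\<lambda>(z', w'). (z', w @ w')) p') @ free_mult p p'"
    by (simp add: a free_mult_def free_scale_def case_prod_unfold)
  then have "eval_H (free_mult (a # p) p') = op_add (op_scale z (op_H w \<circ> eval_H p')) (eval_H p \<circ> eval_H p')"
    by (simp only: eval_H_append eval_H_scale op_H_comp_eval Cons)
  then show ?case by (simp only: a eval_H_Cons op_add_comp op_scale_comp)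
qed

lemma eval_H_star: "is_adj idx_set (eval_H p) (eval_H (free_star p))"
proof (induction p)
  case Nil
  have "is_adj idx_set (op_scale 0 (op_id idx_set)) (op_scale (cnj 0) (op_id idx_set))"
    by (rule is_adj_scale[OF is_adj_id])
  then show ?case by (simp add: free_star_def eval_H_Nil op_scale_def)
next
  case (Cons a p)
  obtain z w where a: "a = (z, w)" by (cases a)
  have "free_star (a # p) = (cnj z, rev (map flip w)) # free_star p" by (simp add: a free_star_def)
  then show ?case unfolding a eval_H_Cons
    using is_adj_add[OF is_adj_scale[OF is_adj_word_op[where s = flip and f = letter_H, OF letter_H(2)]] Cons, of z w] by (simp only: eval_H_Cons)
qed

lemma terms_in_tensor_terms: "target.terms_in (tensor_terms p)"
  using op_A_in op_B_in smooth_cis[of 1]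
  by (auto simp: target.terms_in_def tensor_terms_def)

lemma eval_T_append: "eval_T (p @ p') = alg_add target_alg (eval_T p) (eval_T p')"
  by (simp add: eval_T_def tensor_terms_def target.tensor_sum_append)

lemma eval_T_scale: "eval_T (free_scale c p) = alg_scale target_alg c (eval_T p)"
proof -
  have "tensor_terms (free_scale c p) = map (\<lambda>(z, t). (c * z, t)) (tensor_terms p)"
    by (simp add: tensor_terms_def free_scale_def case_prod_unfold mult.assoc)
  then show ?thesis by (simp add: eval_T_def target.tensor_sum_scale)
qed

lemma coeff_append: "coeff (v @ w) = coeff v * coeff w"
  by (simp add: coeff_def)

lemma coeff_rev_flip: "coeff (rev (map flip w)) = coeff w"
  by (induction w) (simp_all add: coeff_def flip_def mult.commute)

text \<open>An equality of lists, not merely of tensors: both sides enumerate the pairs of terms in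
  the same order, so multiplicativity of \<open>eval_T\<close> follows from the rule for
  lists.\<close>

lemma tensor_terms_mult: "tensor_terms (free_mult p p') = target.terms_mult (tensor_terms p) (tensor_terms p')"
proof (induction p)
  case (Cons a p)
  obtain z w where a: "a = (z, w)" by (cases a)
  have "(\<lambda>\<theta>. cis (of_int (disp_C (w @ w')) * \<theta>)) = (\<lambda>\<theta>. cis (of_int (disp_C w) * \<theta>) * cis (of_int (disp_C w') * \<theta>))" for w'
    by (simp add: fun_eq_iff word_disp_append cis_mult algebra_simps)
  then have "tensor_terms (map (\<lambda>(z', w'). (z * z', w @ w')) p') =
    map (\<lambda>(z', a', b', c'). (z * of_real (coeff w) * z', op_A w \<circ> a', op_B w \<circ> b', \<lambda>\<theta>. cis (of_int (disp_C w) * \<theta>) * c' \<theta>)) (tensor_terms p')"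
    by (simp add: tensor_terms_def case_prod_unfold coeff_append word_op_append[OF bounded_letters(2)]
        word_op_append[OF bounded_letters(3)] mult_ac)
  then show ?case using Cons
    by (simp add: a free_mult_def target.terms_mult_def tensor_terms_def)
qed (simp add: free_mult_def target.terms_mult_def tensor_terms_def)

lemma eval_T_mult: "eval_T (free_mult p p') = alg_mult target_alg (eval_T p) (eval_T p')"
  unfolding eval_T_def tensor_terms_mult
  by (simp add: tensor_alg_def target.tensor_mult_sum[OF terms_in_tensor_terms terms_in_tensor_terms])

lemma tensor_terms_star: "tensor_terms (free_star p) = target.terms_star (tensor_terms p)"
proof -
  have "op_A (rev (map flip w)) = adj UNIV (op_A w)" "op_B (rev (map flip w)) = adj UNIV (op_B w)" for w
    using is_adj_adj[OF is_adj_word_op[where s = flip and f = letter_A, OF letter_A(2)]] is_adj_adj[OF is_adj_word_op[where s = flip and f = letter_B, OF letter_B(2)]] by simp_all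
  moreover have "disp_C (rev (map flip w)) = - disp_C w" for w
    by (rule word_disp_rev[where s = flip and D = "letter_disp circle_disp", OF letter_disp_flip])
  ultimately show ?thesis
    by (simp add: tensor_terms_def free_star_def target.terms_star_def case_prod_unfold coeff_rev_flip cis_cnj)
qed

lemma eval_T_star: "eval_T (free_star p) = alg_star target_alg (eval_T p)"
  unfolding eval_T_def tensor_terms_star by (simp add: tensor_alg_def target.tensor_star_sum)

text \<open>Before the limit, the sum is the matrix entry of \<open>eval_H p\<close> from
  \<open>(N, x, y)\<close> to \<open>(N, x, y) + D\<close>, in which only words of displacement
  \<open>D\<close> take part. It vanishes for all \<open>N\<close>, hence so does its limit.\<close>

lemma limit_coefficient_zero:
  assumes 0: "eval_H p = (\<lambda>\<xi> v. 0)"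
  shows "(\<Sum>(z, w)\<leftarrow>p. if disp_H w = D then z * of_real (coeff w * weight_A w x * weight_B w y) else 0) = 0"
proof -
  define f where "f t N = (case t of (z, w) \<Rightarrow> if disp_H w = D then z * complex_of_real (weight_H w (N, x, y)) else 0)"
    for t :: "complex \<times> letter list" and N
  have "((\<lambda>N. \<Sum>t\<leftarrow>p. f t N) \<longlongrightarrow>
    (\<Sum>t\<leftarrow>p. case t of (z, w) \<Rightarrow> if disp_H w = D then z * of_real (coeff w * weight_A w x * weight_B w y) else 0)) at_top"
    by (rule tendsto_sum_list)
      (auto simp: f_def simp del: of_real_mult split: prod.splits intro!: tendsto_mult tendsto_of_real weight_H_tendsto)
  moreover have "(\<Sum>t\<leftarrow>p. f t N) = 0" for N
  proof (cases "(N, x, y) \<in> idx_valid")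
    case True
    have "(\<Sum>t\<leftarrow>p. f t N) = eval_H p (basis_vec (idx_point (N, x, y))) (idx_point ((N, x, y) + D))"
      unfolding eval_H_def op_H_entry[OF True]
      by (intro arg_cong[where f = sum_list] map_cong refl) (auto simp: f_def)
    then show ?thesis using 0 by simp
  next
    case False
    have "weight_H w (N, x, y) = 0" for w
      using idx.wshiftD(3)[OF wshift_H, of w "(N, x, y)"] False by auto
    then have "f t N = 0" for t by (cases t) (simp add: f_def)
    then show ?thesis by simp
  qed
  ultimately have "((\<lambda>N::int. 0) \<longlongrightarrow>
    (\<Sum>t\<leftarrow>p. case t of (z, w) \<Rightarrow> if disp_H w = D then z * of_real (coeff w * weight_A w x * weight_B w y) else 0)) at_top"
    by simp
  then show ?thesis by (rule tendsto_unique[OF trivial_limit_at_top_linorder _ tendsto_const])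
qed

text \<open>For fixed entries \<open>i\<close> and \<open>j\<close> a word contributes only if its
  disc displacements are \<open>?dx\<close> and \<open>?dy\<close>. Contributing words are grouped
  by the remaining datum, the exponent \<open>d\<close> of \<open>u\<close>; each group is a limit
  coefficient and vanishes.\<close>

lemma eval_T_zero:
  assumes 0: "eval_H p = (\<lambda>\<xi> v. 0)"
  shows "eval_T p = (\<lambda>\<phi>. 0)"
  unfolding eval_T_def
proof (rule target.tensor_sum_zero[OF terms_in_tensor_terms])
  fix i j :: "nat \<times> nat" and \<theta> :: real
  let ?dx = "int (fst i) - int (snd i)" and ?dy = "int (fst j) - int (snd j)"
  define h where "h t = (case t of (z, w) \<Rightarrow> z * complex_of_real (coeff w) * disc_entry i (op_A w) * disc_entry j (op_B w))"
    for t :: "complex \<times> letter list"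
  have h0: "(\<Sum>t\<leftarrow>p. if disp_C (snd t) = d then h t else 0) = 0" for d
  proof -
    have "(if disp_C (snd t) = d then h t else 0) = (case t of (z, w) \<Rightarrow>
        if disp_H w = (d, ?dx, ?dy) then z * of_real (coeff w * weight_A w (int (snd i)) * weight_B w (int (snd j))) else 0)" for t
      by (cases t)
        (auto simp: h_def disc_entry_def disp_H_eq wshift_disc_entry[OF wshift_A] wshift_disc_entry[OF wshift_B])
    then show ?thesis using limit_coefficient_zero[OF 0] by simp
  qed
  have "(\<Sum>(z, a, b, c)\<leftarrow>tensor_terms p. z * disc_entry i a * disc_entry j b * c \<theta>) =
    (\<Sum>t\<leftarrow>p. h t * cis (of_int (disp_C (snd t)) * \<theta>))"
    by (simp add: tensor_terms_def h_def case_prod_unfold o_def)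
  also have "\<dots> = (\<Sum>d\<in>(\<lambda>t. disp_C (snd t)) ` set p. cis (of_int d * \<theta>) * (\<Sum>t\<leftarrow>p. if disp_C (snd t) = d then h t else 0))"
    by (rule sum_list_group) auto
  also have "\<dots> = 0" by (simp only: h0 mult_zero_right sum.neutral_const)
  finally show "(\<Sum>(z, a, b, c)\<leftarrow>tensor_terms p. z * disc_entry i a * disc_entry j b * c \<theta>) = 0" .
qed

lemma eval_T_well_defined:
  assumes "eval_H p = eval_H p'"
  shows "eval_T p = eval_T p'"
proof -
  have "eval_H (p @ free_scale (- 1) p') = (\<lambda>\<xi> v. 0)"
    by (simp add: eval_H_append eval_H_scale assms op_add_def op_scale_def)
  from eval_T_zero[OF this]
  show ?thesis by (simp add: eval_T_append eval_T_scale tensor_alg_def fun_eq_iff)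
qed


section \<open>The algebra \<open>\<B>\<close> consists of the values of the free algebra\<close>

text \<open>The relational form of \<open>delta\<close>: sums and multiples of commutators can be
  formed before uniqueness is invoked.\<close>

definition is_delta :: "idx opr \<Rightarrow> idx opr \<Rightarrow> bool" where
  "is_delta T S \<longleftrightarrow> bounded_op idx_set S \<and>
     (\<forall>\<xi>\<in>dirac_dom. T \<xi> \<in> dirac_dom \<and> S \<xi> = (\<lambda>v. abs_dirac (T \<xi>) v - T (abs_dirac \<xi>) v))"

lemma dirac_dom_iff: "\<xi> \<in> dirac_dom \<longleftrightarrow> \<xi> \<in> l2 idx_set \<and> abs_dirac \<xi> \<in> l2 idx_set"
  unfolding dirac_dom_def abs_dirac_def l2_def by (simp add: norm_mult)

lemma basis_in_dirac_dom: "v \<in> idx_set \<Longrightarrow> basis_vec v \<in> dirac_dom"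
proof -
  assume v: "v \<in> idx_set"
  have "abs_dirac (basis_vec v) = (\<lambda>u. complex_of_real \<bar>dirac_ev v\<bar> * basis_vec v u)"
    by (auto simp: abs_dirac_def basis_vec_def)
  then show ?thesis using v by (simp add: dirac_dom_iff l2_scale)
qed

text \<open>Basis vectors belong to \<open>dirac_dom\<close>, so the commutator determines its
  bounded extension.\<close>

lemma delta_eq:
  assumes "is_delta T S"
  shows "delta T = S"
  unfolding delta_def
proof (rule the_equality)
  show "bounded_op idx_set S \<and> (\<forall>\<xi>\<in>dirac_dom. T \<xi> \<in> dirac_dom \<and> S \<xi> = (\<lambda>v. abs_dirac (T \<xi>) v - T (abs_dirac \<xi>) v))"
    using assms by (simp add: is_delta_def)
  fix S' assume S': "bounded_op idx_set S' \<and> (\<forall>\<xi>\<in>dirac_dom. T \<xi> \<in> dirac_dom \<and> S' \<xi> = (\<lambda>v. abs_dirac (T \<xi>) v - T (abs_dirac \<xi>) v))"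
  show "S' = S"
  proof (rule bounded_op_eqI)
    show "bounded_op idx_set S'" "bounded_op idx_set S" using S' assms by (auto simp: is_delta_def)
    fix v w assume "w \<in> idx_set"
    from basis_in_dirac_dom[OF this]
    show "S' (basis_vec w) v = S (basis_vec w) v" using S' assms by (simp add: is_delta_def)
  qed
qed

lemma dirac_ev_point: "p \<in> idx_valid \<Longrightarrow> \<bar>dirac_ev (idx_point p)\<bar> = of_int (fst p)"
  by (auto simp: dirac_ev_def idx_point_def idx_valid_def abs_mult split: prod.splits)

lemma abs_dirac_point: "p \<in> idx_valid \<Longrightarrow> abs_dirac \<xi> (idx_point p) = of_int (fst p) * \<xi> (idx_point p)"
  by (simp add: abs_dirac_def dirac_ev_point)

text \<open>At a valid label \<open>abs_dirac\<close> multiplies by \<open>N = 2n\<close>, whatever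
  the sign of \<open>dirac_ev\<close>. A shift that changes \<open>N\<close> by \<open>fst D\<close>
  therefore has \<open>fst D\<close> times itself as commutator.\<close>

lemma is_delta_wshift:
  assumes T: "idx.wshift T c D"
  shows "is_delta T (op_scale (of_int (fst D)) T)"
  unfolding is_delta_def
proof (intro conjI ballI)
  have b: "bounded_op idx_set T" by (rule idx.wshiftD(1)[OF T])
  then show "bounded_op idx_set (op_scale (of_int (fst D)) T)" by (rule bounded_op_scale)
  fix \<xi> assume "\<xi> \<in> dirac_dom"
  then have \<xi>: "\<xi> \<in> l2 idx_set" "abs_dirac \<xi> \<in> l2 idx_set" by (auto simp: dirac_dom_iff)
  have T\<xi>: "T \<xi> \<in> l2 idx_set" "T (abs_dirac \<xi>) \<in> l2 idx_set"
    using bounded_opD(1)[OF b \<xi>(1)] bounded_opD(1)[OF b \<xi>(2)] by blast+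
  have eq: "abs_dirac (T \<xi>) v = T (abs_dirac \<xi>) v + of_int (fst D) * T \<xi> v" for v
  proof (cases "v \<in> idx_set")
    case True
    then obtain p where p: "p \<in> idx_valid" "v = idx_point p" by (rule idx.label_cases)
    show ?thesis
    proof (cases "c (p - D) = 0")
      case True
      then show ?thesis
        using idx.wshiftD(5)[OF T \<xi>(1) p(1)] idx.wshiftD(5)[OF T \<xi>(2) p(1)] by (simp add: p(2) abs_dirac_def)
    next
      case False
      then have pd: "p - D \<in> idx_valid" by (rule idx.wshiftD(3)[OF T])
      show ?thesis
        unfolding p(2) idx.wshiftD(5)[OF T \<xi>(2) p(1)] abs_dirac_point[OF p(1)] abs_dirac_point[OF pd]
          idx.wshiftD(5)[OF T \<xi>(1) p(1)]
        by (simp add: algebra_simps)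
    qed
  next
    case False
    then show ?thesis
      using l2D(1)[OF T\<xi>(1)] l2D(1)[OF T\<xi>(2)] by (simp add: abs_dirac_def)
  qed
  then have "abs_dirac (T \<xi>) = (\<lambda>v. 1 * T (abs_dirac \<xi>) v + of_int (fst D) * T \<xi> v)" by (simp add: fun_eq_iff)
  also have "\<dots> \<in> l2 idx_set" by (rule l2_comb[OF T\<xi>(2,1)])
  finally show "T \<xi> \<in> dirac_dom" using T\<xi>(1) by (simp add: dirac_dom_iff)
  show "op_scale (of_int (fst D)) T \<xi> = (\<lambda>v. abs_dirac (T \<xi>) v - T (abs_dirac \<xi>) v)"
    by (simp add: eq op_scale_def)
qed

lemma is_delta_add:
  assumes "is_delta T S" "is_delta T' S'"
  shows "is_delta (op_add T T') (op_add S S')"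
  unfolding is_delta_def
proof (intro conjI ballI)
  show "bounded_op idx_set (op_add S S')" using assms by (simp add: is_delta_def bounded_op_add)
  fix \<xi> assume \<xi>: "\<xi> \<in> dirac_dom"
  have T: "T \<xi> \<in> dirac_dom" "T' \<xi> \<in> dirac_dom" using assms \<xi> by (auto simp: is_delta_def)
  have e: "abs_dirac (\<lambda>v. \<eta> v + \<zeta> v) = (\<lambda>v. abs_dirac \<eta> v + abs_dirac \<zeta> v)" for \<eta> \<zeta>
    by (simp add: abs_dirac_def algebra_simps)
  show "op_add T T' \<xi> \<in> dirac_dom"
    using T by (simp add: dirac_dom_iff op_add_def e l2_add)
  show "op_add S S' \<xi> = (\<lambda>v. abs_dirac (op_add T T' \<xi>) v - op_add T T' (abs_dirac \<xi>) v)"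
    using assms \<xi> by (simp add: op_add_def e is_delta_def fun_eq_iff)
qed

lemma is_delta_scale:
  assumes "is_delta T S"
  shows "is_delta (op_scale c T) (op_scale c S)"
  unfolding is_delta_def
proof (intro conjI ballI)
  show "bounded_op idx_set (op_scale c S)" using assms by (simp add: is_delta_def bounded_op_scale)
  fix \<xi> assume \<xi>: "\<xi> \<in> dirac_dom"
  have T: "T \<xi> \<in> dirac_dom" using assms \<xi> by (auto simp: is_delta_def)
  have e: "abs_dirac (\<lambda>v. c * \<eta> v) = (\<lambda>v. c * abs_dirac \<eta> v)" for \<eta>
    by (simp add: abs_dirac_def algebra_simps)
  show "op_scale c T \<xi> \<in> dirac_dom"
    using T by (simp add: dirac_dom_iff op_scale_def e l2_scale)
  show "op_scale c S \<xi> = (\<lambda>v. abs_dirac (op_scale c T \<xi>) v - op_scale c T (abs_dirac \<xi>) v)"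
    using assms \<xi> by (simp add: op_scale_def e is_delta_def algebra_simps)
qed

lemma delta_power:
  assumes S: "idx.wshift S c (1, D)" and T: "idx.wshift T c' (- 1, D')"
  shows "(delta ^^ k) (op_add S T) = op_add S (op_scale ((- 1) ^ k) T)"
proof (induction k)
  case 0
  show ?case by (simp add: op_add_def op_scale_def)
next
  case (Suc k)
  have "delta (op_add S (op_scale ((- 1) ^ k) T)) = op_add (op_scale 1 S) (op_scale ((- 1) ^ k) (op_scale (- 1) T))"
    using is_delta_wshift[OF S] is_delta_wshift[OF T]
    by (intro delta_eq is_delta_add is_delta_scale) simp_all
  then show ?case using Suc by (simp add: op_add_def op_scale_def)
qed

lemma op_alg_simps [simp]:
  "alg_add (op_alg I) = op_add" "alg_scale (op_alg I) = op_scale" "alg_mult (op_alg I) = (\<circ>)"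
  "alg_one (op_alg I) = op_id I" "alg_star (op_alg I) = adj I"
  by (simp_all add: op_alg_def)

lemma B_alg_simps:
  "alg_set (B_alg q) = gen_alg (op_alg idx_set) (B_gens q)"
  "alg_add (B_alg q) = op_add" "alg_scale (B_alg q) = op_scale" "alg_mult (B_alg q) = (\<circ>)"
  "alg_one (B_alg q) = op_id idx_set" "alg_star (B_alg q) = adj idx_set"
  by (simp_all add: B_alg_def op_alg_def)

definition free_gen :: "gen \<Rightarrow> free_elem" where "free_gen g = [(1, [(g, False)])]"

lemma eval_H_gen: "eval_H (free_gen g) = hilbert_gen q g"
  using comp_op_id[OF idx.wshiftD(1)[OF wshift_hilbert_gen[OF q, of g]]]
  by (simp add: free_gen_def eval_H_Cons eval_H_Nil op_add_def op_scale_def with_adj_def fun_eq_iff)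

lemma delta_power_gen:
  "(delta ^^ k) (alpha q) = op_add (hilbert_gen q AlphaPlus) (op_scale ((- 1) ^ k) (hilbert_gen q AlphaMinus))"
  "(delta ^^ k) (beta q) = op_add (hilbert_gen q BetaPlus) (op_scale ((- 1) ^ k) (hilbert_gen q BetaMinus))"
proof -
  note w = wshift_hilbert_gen[OF q]
  have d: "hilbert_disp AlphaPlus = (1, 0, 0)" "hilbert_disp AlphaMinus = (- 1, - 1, - 1)"
    "hilbert_disp BetaPlus = (1, 1, 0)" "hilbert_disp BetaMinus = (- 1, 0, - 1)"
    by (simp_all add: hilbert_disp_def circle_disp_def first_disp_def second_disp_def)
  have "alpha q = op_add (hilbert_gen q AlphaPlus) (hilbert_gen q AlphaMinus)"
    "beta q = op_add (hilbert_gen q BetaPlus) (hilbert_gen q BetaMinus)"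
    by (simp_all add: alpha_def beta_def hilbert_gen_def)
  then show
    "(delta ^^ k) (alpha q) = op_add (hilbert_gen q AlphaPlus) (op_scale ((- 1) ^ k) (hilbert_gen q AlphaMinus))"
    "(delta ^^ k) (beta q) = op_add (hilbert_gen q BetaPlus) (op_scale ((- 1) ^ k) (hilbert_gen q BetaMinus))"
    using delta_power[OF w[of AlphaPlus, unfolded d] w[of AlphaMinus, unfolded d], of k]
      delta_power[OF w[of BetaPlus, unfolded d] w[of BetaMinus, unfolded d], of k] by simp_all
qed

definition sign_gens :: "gen \<Rightarrow> gen \<Rightarrow> nat \<Rightarrow> free_elem" where
  "sign_gens g g' k = free_gen g @ free_scale ((- 1) ^ k) (free_gen g')"

lemma eval_H_sign_gens:
  "eval_H (sign_gens g g' k) = op_add (hilbert_gen q g) (op_scale ((- 1) ^ k) (hilbert_gen q g'))"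
  by (simp add: sign_gens_def eval_H_append eval_H_scale eval_H_gen)

lemma B_gens_eq: "B_gens q = (\<Union>k. {eval_H (sign_gens AlphaPlus AlphaMinus k), eval_H (sign_gens BetaPlus BetaMinus k),
    eval_H (free_star (sign_gens AlphaPlus AlphaMinus k)), eval_H (free_star (sign_gens BetaPlus BetaMinus k))})"
proof -
  have "eval_H (free_star p) = adj idx_set (eval_H p)" for p by (rule is_adj_adj[OF eval_H_star, symmetric])
  then show ?thesis
    unfolding B_gens_def Let_def delta_power_gen eval_H_sign_gens[symmetric] by (simp only:) blast
qed

lemma B_gens_range: "T \<in> B_gens q \<Longrightarrow> \<exists>p. T = eval_H p"
  unfolding B_gens_eq by blast

abbreviation "B_set \<equiv> gen_alg (op_alg idx_set) (B_gens q)"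

lemma B_set_range: "T \<in> B_set \<Longrightarrow> \<exists>p. T = eval_H p"
proof (induction rule: gen_alg.induct)
  case one
  have "eval_H [(1, [])] = op_id idx_set" by (simp add: eval_H_Cons eval_H_Nil op_add_def op_scale_def)
  then show ?case by (metis op_alg_simps(4))
next
  case (gen T)
  then show ?case by (rule B_gens_range)
next
  case (add S T)
  then show ?case using eval_H_append by (metis op_alg_simps(1))
next
  case (scale T c)
  then show ?case using eval_H_scale by (metis op_alg_simps(2))
next
  case (mult S T)
  then show ?case using eval_H_mult by (metis op_alg_simps(3))
qed

lemma B_set_add: "S \<in> B_set \<Longrightarrow> T \<in> B_set \<Longrightarrow> op_add S T \<in> B_set"
  using gen_alg.add[of S "op_alg idx_set" "B_gens q" T] by simp

lemma B_set_scale: "T \<in> B_set \<Longrightarrow> op_scale c T \<in> B_set"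
  using gen_alg.scale[of T "op_alg idx_set" "B_gens q" c] by simp

lemma B_set_mult: "S \<in> B_set \<Longrightarrow> T \<in> B_set \<Longrightarrow> S \<circ> T \<in> B_set"
  using gen_alg.mult[of S "op_alg idx_set" "B_gens q" T] by (simp only: op_alg_simps)

text \<open>The iterated commutators for \<open>k = 0\<close> and \<open>k = 1\<close> have the form
  \<open>S + T\<close> and \<open>S - T\<close>; half their sum and half their difference separate
  the raising from the lowering part.\<close>

lemma half_sum:
  assumes "op_add S (op_scale ((- 1) ^ 0) T) \<in> B_set" "op_add S (op_scale ((- 1) ^ 1) T) \<in> B_set"
  shows "S \<in> B_set" "T \<in> B_set"
proof -
  have "op_scale (1/2) (op_add (op_add S (op_scale ((- 1) ^ 0) T)) (op_add S (op_scale ((- 1) ^ 1) T))) = S"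
    "op_scale (1/2) (op_add (op_add S (op_scale ((- 1) ^ 0) T)) (op_scale (- 1) (op_add S (op_scale ((- 1) ^ 1) T)))) = T"
    by (simp_all add: op_add_def op_scale_def fun_eq_iff)
  then show "S \<in> B_set" "T \<in> B_set"
    using B_set_scale[OF B_set_add[OF assms], of "1/2"]
      B_set_scale[OF B_set_add[OF assms(1) B_set_scale[OF assms(2), of "- 1"]], of "1/2"] by simp_all
qed

lemma hilbert_gen_in: "hilbert_gen q g \<in> B_set"
proof -
  have "eval_H (sign_gens AlphaPlus AlphaMinus k) \<in> B_set" "eval_H (sign_gens BetaPlus BetaMinus k) \<in> B_set" for k
    by (auto intro!: gen_alg.gen simp: B_gens_eq)
  then show ?thesis
    unfolding eval_H_sign_gens
    by (cases g) (blast intro: half_sum)+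
qed

text \<open>Adjoints enter \<open>B_gens\<close> only for the signed sums, not for the four parts.
  As \<open>(- 1) ^ k\<close> is real, the same separation applies to them.\<close>

lemma adj_hilbert_gen_in: "adj idx_set (hilbert_gen q g) \<in> B_set"
proof -
  define H where "H g = adj idx_set (hilbert_gen q g)" for g
  have a: "is_adj idx_set (hilbert_gen q g) (H g)" for g
    using letter_H(2)[of "(g, False)"] by (simp add: H_def with_adj_def flip_def)
  have "eval_H (free_star (sign_gens g g' k)) = op_add (H g) (op_scale (cnj ((- 1) ^ k)) (H g'))" for g g' k
    using is_adj_adj[OF is_adj_add[OF a is_adj_scale[OF a]]] is_adj_adj[OF eval_H_star] eval_H_sign_gens by metis
  then have e: "eval_H (free_star (sign_gens g g' k)) = op_add (H g) (op_scale ((- 1) ^ k) (H g'))" for g g' k by simp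
  have "eval_H (free_star (sign_gens AlphaPlus AlphaMinus k)) \<in> B_set" "eval_H (free_star (sign_gens BetaPlus BetaMinus k)) \<in> B_set" for k
    by (auto intro!: gen_alg.gen simp: B_gens_eq)
  then have "H g \<in> B_set"
    unfolding e by (cases g) (blast intro: half_sum)+
  then show ?thesis by (simp add: H_def)
qed

lemma letter_in: "letter_H l \<in> B_set"
  using hilbert_gen_in adj_hilbert_gen_in by (simp add: with_adj_def)

lemma op_H_in: "op_H w \<in> B_set"
proof (induction w)
  case Nil
  show ?case using gen_alg.one[of "op_alg idx_set" "B_gens q"] by simp
next
  case (Cons l w)
  show ?case unfolding word_op.simps by (rule B_set_mult[OF letter_in Cons])
qed

text \<open>With \<open>B_set_range\<close> this identifies \<open>B_set\<close> with the values of
  \<open>eval_H\<close>. In the uniqueness proof it licenses the homomorphism laws for every partial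
  sum of a polynomial.\<close>

lemma eval_H_in: "eval_H p \<in> B_set"
proof (induction p)
  case Nil
  show ?case using B_set_scale[OF op_H_in[of "[]"], of 0] by (simp add: eval_H_Nil op_scale_def)
next
  case (Cons a p)
  then show ?case by (cases a) (simp add: eval_H_Cons B_set_add B_set_scale op_H_in)
qed


section \<open>The homomorphism\<close>

text \<open>Any polynomial representing \<open>T\<close> will do, by
  \<open>eval_T_well_defined\<close>. Outside the range of \<open>eval_H\<close> the value is
  arbitrary, and \<open>star_hom\<close> says nothing there.\<close>

definition rho :: "idx opr \<Rightarrow> (nat opr, nat opr, real \<Rightarrow> complex) tensor" where
  "rho T = eval_T (SOME p. eval_H p = T)"

lemma rho_eval: "rho (eval_H p) = eval_T p"
  unfolding rho_def by (rule eval_T_well_defined) (rule someI[of "\<lambda>p'. eval_H p' = eval_H p"], rule refl)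

lemma rho_gen: "rho (hilbert_gen q g) = alg_scale target_alg (of_real (gen_coeff q g))
  (target_elem (first_gen q g) (second_gen q g) (\<lambda>\<theta>. cis (of_int (circle_disp g) * \<theta>)))"
proof -
  have b: "first_gen q g \<circ> op_id UNIV = first_gen q g" "second_gen q g \<circ> op_id UNIV = second_gen q g"
    by (intro comp_op_id smooth_disc_bounded first_gen_in second_gen_in q)+
  have "rho (hilbert_gen q g) = eval_T (free_gen g)" unfolding eval_H_gen[symmetric] by (rule rho_eval)
  then show ?thesis
    using b by (simp add: eval_T_def tensor_terms_def free_gen_def target.tensor_sum_def coeff_def with_adj_def
        letter_disp_def tensor_alg_def)
qed

lemma rho_star_hom: "star_hom (B_alg q) target_alg rho"
  unfolding star_hom_def B_alg_simps
proof (intro conjI ballI allI)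
  fix S assume "S \<in> B_set"
  then obtain p where S: "S = eval_H p" using B_set_range by blast
  show "rho S \<in> alg_set target_alg"
    unfolding S rho_eval eval_T_def by (rule target.tensor_sum_in[OF terms_in_tensor_terms])
  show "rho (op_scale c S) = alg_scale target_alg c (rho S)" for c
    unfolding S eval_H_scale[symmetric] rho_eval by (rule eval_T_scale)
  have "adj idx_set S = eval_H (free_star p)" unfolding S by (rule is_adj_adj[OF eval_H_star])
  then show "rho (adj idx_set S) = alg_star target_alg (rho S)" unfolding S by (simp only: rho_eval eval_T_star)
  fix T assume "T \<in> B_set"
  then obtain p' where T: "T = eval_H p'" using B_set_range by blast
  show "rho (op_add S T) = alg_add target_alg (rho S) (rho T)"
    unfolding S T eval_H_append[symmetric] rho_eval by (rule eval_T_append)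
  show "rho (S \<circ> T) = alg_mult target_alg (rho S) (rho T)"
    unfolding S T eval_H_mult[symmetric] rho_eval by (rule eval_T_mult)
next
  have "eval_H [(1, [])] = op_id idx_set" by (simp add: eval_H_Cons eval_H_Nil op_add_def op_scale_def)
  then have "rho (op_id idx_set) = eval_T [(1, [])]" using rho_eval[of "[(1, [])]"] by simp
  also have "\<dots> = alg_one target_alg"
    by (simp add: eval_T_def tensor_terms_def target.tensor_sum_def coeff_def tensor_alg_def)
  finally show "rho (op_id idx_set) = alg_one target_alg" .
qed

lemma rho_on_gens: "rho_on_generators q rho"
proof -
  have c: "(\<lambda>\<theta>. cis (of_int 1 * \<theta>)) = cis" "(\<lambda>\<theta>. cis (of_int (- 1) * \<theta>)) = alg_star smooth_circle cis"
    by (simp_all add: cis_cnj)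
  have 1: "alg_scale target_alg 1 \<Phi> = \<Phi>" for \<Phi> by (simp add: tensor_alg_def)
  show ?thesis
    unfolding rho_on_generators_def
    using rho_gen[of AlphaPlus] rho_gen[of AlphaMinus] rho_gen[of BetaPlus] rho_gen[of BetaMinus]
    by (simp only: hilbert_gen_def first_gen_def second_gen_def gen_coeff_def circle_disp_def gen.case c 1
        of_real_1 of_real_minus)
qed

text \<open>Agreement passes from the generators to their adjoints by compatibility with the
  involution, then to words and linear combinations, which exhaust the algebra.\<close>

lemma rho_unique:
  assumes h: "star_hom (B_alg q) target_alg \<rho>" and g: "rho_on_generators q \<rho>" and T: "T \<in> B_set"
  shows "\<rho> T = rho T"
proof -
  note hom = h[unfolded star_hom_def B_alg_simps] rho_star_hom[unfolded star_hom_def B_alg_simps]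
  have gens: "\<rho> (hilbert_gen q g) = rho (hilbert_gen q g)" for g
    using g rho_on_gens unfolding rho_on_generators_def by (cases g) (simp_all add: hilbert_gen_def)
  then have letters: "\<rho> (letter_H l) = rho (letter_H l)" for l
    using hom hilbert_gen_in by (simp add: with_adj_def)
  have words: "\<rho> (op_H w) = rho (op_H w)" for w
  proof (induction w)
    case Nil
    show ?case using hom by (simp only: word_op.simps)
  next
    case (Cons l w)
    show ?case
      using hom letter_in[of l] op_H_in[of w] by (simp only: word_op.simps letters Cons)
  qed
  obtain p where "T = eval_H p" using B_set_range[OF T] by blast
  moreover have "\<rho> (eval_H p) = rho (eval_H p)"
  proof (induction p)
    case Nil
    \<comment> \<open>The zero operator is written as 0 times the unit, since the homomorphism laws
      name only the unit.\<close>
    have "eval_H [] = op_scale 0 (op_H [])" by (simp add: eval_H_Nil op_scale_def)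
    then show ?case using hom op_H_in[of "[]"] words[of "[]"] by simp
  next
    case (Cons a p)
    obtain z w where "a = (z, w)" by (cases a)
    then show ?case
      using hom op_H_in[of w] eval_H_in[of p] B_set_scale[OF op_H_in[of w], of z] words[of w] Cons
      by (simp add: eval_H_Cons)
  qed
  ultimately show ?thesis by simp
qed

end

theorem proposition4:
  fixes q :: real
  assumes "0 < q" and "q < 1"
  shows "\<exists>\<rho>. star_hom (B_alg q) target_alg \<rho> \<and> rho_on_generators q \<rho> \<and>
           (\<forall>\<rho>'. star_hom (B_alg q) target_alg \<rho>' \<and> rho_on_generators q \<rho>' \<longrightarrow>
              (\<forall>T\<in>alg_set (B_alg q). \<rho>' T = \<rho> T))"
proof -
  interpret quantum_parameter q using assms by unfold_locales
  show ?thesis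
    using rho_star_hom rho_on_gens rho_unique unfolding B_alg_simps(1) by blast
qed

end
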